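(* In every packing of spherical caps of angular radius $\pi/6$ on the unit sphere $\mathbb{S}^2\subset\mathbb{E}^3$, the number of touching pairs is at most $25$ and the number of touching triplets is at most $11$.
   Context: $\mathbb{S}^2$ is the unit sphere centered at the origin of $\mathbb{E}^3$ with its spherical (geodesic) distance. A packing of spherical caps of angular radius $\pi/6$ is a finite family of closed spherical caps of angular radius $\pi/6$ with pairwise disjoint interiors (equivalently, their centers are at pairwise spherical distance at least $\pi/3$). Two caps touch if their centers are at spherical distance exactly $\pi/3$. A touching pair is a pair of distinct touching caps; a touching triplet is a set of three caps that pairwise touch. *)

theory Defs
  imports "HOL-Analysis.Analysis"
begin

definition sph_dist :: "real^3 \<Rightarrow> real^3 \<Rightarrow> real" where
  "sph_dist x y = arccos (x \<bullet> y)"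

text \<open>A packing of caps of angular radius pi/6, represented by the finite set of cap centers
  on the unit sphere, pairwise at spherical distance at least pi/3.\<close>
definition cap_packing :: "(real^3) set \<Rightarrow> bool" where
  "cap_packing C \<longleftrightarrow> finite C \<and> C \<subseteq> sphere 0 1 \<and>
     (\<forall>x\<in>C. \<forall>y\<in>C. x \<noteq> y \<longrightarrow> sph_dist x y \<ge> pi / 3)"

definition touching :: "real^3 \<Rightarrow> real^3 \<Rightarrow> bool" where
  "touching x y \<longleftrightarrow> sph_dist x y = pi / 3"

definition touching_pairs :: "(real^3) set \<Rightarrow> (real^3) set set" where
  "touching_pairs C = {P. P \<subseteq> C \<and> card P = 2 \<and> (\<forall>x\<in>P. \<forall>y\<in>P. x \<noteq> y \<longrightarrow> touching x y)}"

definition touching_triplets :: "(real^3) set \<Rightarrow> (real^3) set set" where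
  "touching_triplets C = {T. T \<subseteq> C \<and> card T = 3 \<and> (\<forall>x\<in>T. \<forall>y\<in>T. x \<noteq> y \<longrightarrow> touching x y)}"

end

theory Submission
  imports Defs "HOL-Computational_Algebra.Polynomial"
begin

text \<open>
  Reflecting a vertex of a contact triangle in the opposite side multiplies its denominator, with respect to
  the lattice spanned by a first triangle, by exactly 3.  Hence triangles glued along common sides never close up:
  an edge-connected family of $t$ triangles has exactly $t + 2$ vertices and $2t + 1$ edges.  Since a packing has at most
  12 caps (kissing number, by linear programming with Legendre polynomials), 12 triangles would
  form at least two components and hence have at least 26 edges, so the bound on triplets follows from the one on pairs.

  Suppose that there are 26 touching pairs and saturate the packing.  All of them are edges of a perturbed Delaunay
  triangulation, which contains all contact triangles; sweeping a direction over it gives at most $2N - 4 \le 20$ facets,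
  because every facet has one middle vertex and every vertex is the middle one of at most two facets.  Counting forces
  26 contact edges, 12 contact triangles, and 8 further facets that pair up to 4 rhombi.  If $d$ contact
  edges leave a vertex and $b$ of them bound only one contact triangle, then $b$ is even and
  positive, and the inner products in a fan of triangles exclude $b = 2$, $d < 5$; so $2d + b \ge 12$.  Summing over the
  12 vertices gives $2 \cdot 52 + 2 \cdot 16 \ge 144$, a contradiction.
\<close>

subsection \<open>The kissing number of the sphere\<close>

text \<open>The pure linear programming bound stops at 13 in dimension three. The polynomial is
  therefore allowed to be large near -1, and the geometry of the at most three points near the
  antipode of a given point pays for that. A contact triangle together with the origin is a regular
  tetrahedron. Its dihedral angle arccos (1/3) is an irrational multiple of pi, and this is where
  the powers of 3 come from. Saturation puts the origin inside the hull, so that a facet lies on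
  either side of every edge. Four centers may share a facet plane (a square of contacts), so facets
  need not be triangles. Perturbing the distances of the hull points from the origin, and not their
  directions, repairs this without disturbing any contact. The sweep takes the place of Euler's
  formula. Two estimates then meet exactly at 26 edges: few facets force many contact triangles, and
  many contact triangles force many edges. This rigidity leaves so little freedom at each vertex
  that finitely many inner products decide.\<close>

fun mobius_poly :: "real \<Rightarrow> real \<Rightarrow> real list \<Rightarrow> real poly" where
  "mobius_poly l u [] = 0"
| "mobius_poly l u (a # as) = smult a ([:1, 1:] ^ length as) + [:l, u:] * mobius_poly l u as"

text \<open>With n = \<open>length as\<close>, this identifies \<open>mobius_poly l u as\<close> as
  (1 + x)^(n - 1) p((l + u x) / (1 + x)), the homogenized polynomial after the substitution. The
  extra factor 1 + x on both sides avoids the truncated subtraction n - 1.\<close>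

lemma poly_mobius_poly:
  assumes "x \<noteq> -1"
  shows "(1 + x) * poly (mobius_poly l u as) x = (1 + x) ^ length as * horner_sum id ((l + u * x) / (1 + x)) as"
proof (induction as)
  case (Cons a as)
  have nz: "1 + x \<noteq> 0" using assms by linarith
  have "(1 + x) * poly (mobius_poly l u (a # as)) x =
        (1 + x) * (1 + x) ^ length as * a + (l + u * x) * ((1 + x) * poly (mobius_poly l u as) x)"
    by (simp add: algebra_simps)
  also have "\<dots> = (1 + x) * (1 + x) ^ length as * a + (l + u * x) * ((1 + x) ^ length as * horner_sum id ((l + u * x) / (1 + x)) as)"
    by (simp only: Cons)
  also have "\<dots> = (1 + x) ^ length (a # as) * horner_sum id ((l + u * x) / (1 + x)) (a # as)"
    using nz by (simp add: field_simps)
  finally show ?case .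
qed simp

text \<open>Positivity on \<^term>\<open>{l..<u}\<close> is certified by the coefficients that the polynomial gets when
  \<^term>\<open>{l..<u}\<close> is mapped to the half line by a projective change of variable.\<close>
lemma horner_nonneg_on_interval:
  assumes "l \<le> t" "t < u" and nn: "\<And>x. 0 \<le> x \<Longrightarrow> 0 \<le> poly (mobius_poly l u as) x"
  shows "0 \<le> horner_sum id t as"
proof -
  define x where "x = (t - l) / (u - t)"
  have x: "0 \<le> x" "x \<noteq> -1" using assms(1,2) by (auto simp: x_def)
      (smt (verit, best) divide_nonneg_nonneg)
  have "(l + u * x) / (1 + x) = t"
  proof -
    have "(1 + x) * t = l + u * x"
      using assms(1,2) unfolding x_def by (simp add: field_simps)
    then show ?thesis using x by (simp add: field_simps)
  qed
  then have "(1 + x) * poly (mobius_poly l u as) x = (1 + x) ^ length as * horner_sum id t as"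
    using poly_mobius_poly[OF x(2), of l u as] by simp
  moreover have "0 \<le> (1 + x) * poly (mobius_poly l u as) x" using nn x by simp
  moreover have "0 < (1 + x) ^ length as" using x by simp
  ultimately show ?thesis by (simp add: zero_le_mult_iff)
qed

definition kissing :: "(real^3) set \<Rightarrow> bool" where
  "kissing C \<longleftrightarrow> finite C \<and> C \<subseteq> sphere 0 1 \<and> (\<forall>x\<in>C. \<forall>y\<in>C. x \<noteq> y \<longrightarrow> x \<bullet> y \<le> 1/2)"

section \<open>Positive definite kernels from Legendre polynomials\<close>

fun legendre :: "nat \<Rightarrow> real \<Rightarrow> real" where
  "legendre 0 t = 1"
| "legendre (Suc 0) t = t"
| "legendre (Suc (Suc n)) t = ((2 * real n + 3) * t * legendre (Suc n) t - (real n + 1) * legendre n t) / (real n + 2)"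

text \<open>The sums carry no weights: the linear programming bound only sums a kernel over the
  point set itself.\<close>

definition psd_kernel :: "(real^3 \<Rightarrow> real^3 \<Rightarrow> real) \<Rightarrow> bool" where
  "psd_kernel K \<longleftrightarrow> (\<forall>S. finite S \<longrightarrow> S \<subseteq> sphere 0 1 \<longrightarrow> 0 \<le> (\<Sum>x\<in>S. \<Sum>y\<in>S. K x y))"

lemma psd_kernel_add: "psd_kernel K \<Longrightarrow> psd_kernel L \<Longrightarrow> psd_kernel (\<lambda>x y. K x y + L x y)"
  by (simp add: psd_kernel_def sum.distrib)

lemma psd_kernel_cmult: "0 \<le> c \<Longrightarrow> psd_kernel K \<Longrightarrow> psd_kernel (\<lambda>x y. c * K x y)"
  by (simp add: psd_kernel_def flip: sum_distrib_left)

lemma psd_kernel_cong: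
  assumes "psd_kernel L" "\<And>x y. x \<in> sphere 0 1 \<Longrightarrow> y \<in> sphere 0 1 \<Longrightarrow> K x y = L x y"
  shows "psd_kernel K"
proof -
  have "(\<Sum>x\<in>S. \<Sum>y\<in>S. K x y) = (\<Sum>x\<in>S. \<Sum>y\<in>S. L x y)" if "S \<subseteq> sphere 0 1" for S
    using that assms(2) by (intro sum.cong refl) blast+
  then show ?thesis using assms(1) by (simp add: psd_kernel_def)
qed

text \<open>In complex form, the difference of the longitudes of two points is the argument of a
  product with a conjugate, and powers produce the cosines of its multiples.\<close>

definition horizontal :: "real^3 \<Rightarrow> complex" where
  "horizontal x = Complex (x$1) (x$2)"

text \<open>The double sum is the squared modulus of a single sum: the kernel is the real part of
  w(x) times the conjugate of w(y), where w(x) is \<open>q (x$3)\<close> times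
  \<open>horizontal x ^ m\<close>.\<close>

lemma psd_kernel_harmonic:
  "psd_kernel (\<lambda>x y. q (x$3) * q (y$3) * Re ((horizontal x * cnj (horizontal y)) ^ m))"
  unfolding psd_kernel_def
proof (intro allI impI)
  fix S :: "(real^3) set"
  define w where "w = (\<Sum>x\<in>S. of_real (q (x$3)) * horizontal x ^ m)"
  have eq: "of_real (q (x$3)) * horizontal x ^ m * cnj (of_real (q (y$3)) * horizontal y ^ m)
      = of_real (q (x$3) * q (y$3)) * (horizontal x * cnj (horizontal y)) ^ m" for x y
    by (simp add: power_mult_distrib mult_ac)
  have re: "Re (of_real c * u) = c * Re u" for c u by simp
  have "(\<Sum>x\<in>S. \<Sum>y\<in>S. q (x$3) * q (y$3) * Re ((horizontal x * cnj (horizontal y)) ^ m)) = Re (w * cnj w)"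
    unfolding w_def cnj_sum sum_product Re_sum eq re ..
  also have "\<dots> = (cmod w)\<^sup>2"
    by (simp add: complex_mult_cnj cmod_power2)
  finally show "0 \<le> (\<Sum>x\<in>S. \<Sum>y\<in>S. q (x$3) * q (y$3) * Re ((horizontal x * cnj (horizontal y)) ^ m))"
    by simp
qed

lemma inner_via_horizontal:
  fixes x y :: "real^3"
  shows "x \<bullet> y = x$3 * y$3 + Re (horizontal x * cnj (horizontal y))"
  by (simp add: inner_vec_def sum_3 horizontal_def)

lemma norm_horizontal:
  assumes "x \<in> sphere 0 1"
  shows "(cmod (horizontal x))\<^sup>2 = 1 - (x$3)\<^sup>2"
proof -
  have "x \<bullet> x = 1" using assms by (simp add: dot_square_norm)
  then show ?thesis
    unfolding cmod_power2 by (simp add: inner_vec_def sum_3 horizontal_def power2_eq_square)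
qed

text \<open>z is a root of t^2 - 2 (Re z) t + |z|^2.\<close>

lemma Re_power_rec: "Re (z ^ Suc (Suc m)) = 2 * Re z * Re (z ^ Suc m) - (cmod z)\<^sup>2 * Re (z ^ m)"
  unfolding cmod_power2 by (simp add: power2_eq_square algebra_simps)

text \<open>Chebyshev polynomials, homogenized by r. For z =
  \<open>horizontal x * cnj (horizontal y)\<close> with x and y on the sphere, both s and r are
  polynomials in \<open>x$3\<close>, \<open>y$3\<close> and the inner product, so that addition
  theorems become polynomial identities.\<close>

lemma Re_power_explicit:
  fixes z :: complex
  defines "s \<equiv> Re z" and "r \<equiv> (cmod z)\<^sup>2"
  shows "Re (z ^ 0) = 1"
    and "Re (z ^ 1) = s"
    and "Re (z ^ 2) = 2 * s^2 - r"
    and "Re (z ^ 3) = 4 * s^3 - 3 * s * r"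
    and "Re (z ^ 4) = 8 * s^4 - 8 * s^2 * r + r^2"
    and "Re (z ^ 5) = 16 * s^5 - 20 * s^3 * r + 5 * s * r^2"
    and "Re (z ^ 6) = 32 * s^6 - 48 * s^4 * r + 18 * s^2 * r^2 - r^3"
    and "Re (z ^ 7) = 64 * s^7 - 112 * s^5 * r + 56 * s^3 * r^2 - 7 * s * r^3"
    and "Re (z ^ 8) = 128 * s^8 - 256 * s^6 * r + 160 * s^4 * r^2 - 32 * s^2 * r^3 + r^4"
    and "Re (z ^ 9) = 256 * s^9 - 576 * s^7 * r + 432 * s^5 * r^2 - 120 * s^3 * r^3 + 9 * s * r^4"
proof -
  have rec: "Re (z ^ n) = 2 * s * Re (z ^ k) - r * Re (z ^ m)" if "n = Suc (Suc m)" "k = Suc m" for n k m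
    unfolding s_def r_def that by (rule Re_power_rec)
  show R0: "Re (z ^ 0) = 1" by simp
  show R1: "Re (z ^ 1) = s" by (simp add: s_def)
  have "Re (z ^ 2) = 2 * s * Re (z ^ 1) - r * Re (z ^ 0)" by (rule rec) simp_all
  also have "\<dots> = 2 * s^2 - r" unfolding R1 R0 by algebra
  finally show R2: "Re (z ^ 2) = 2 * s^2 - r" .
  have "Re (z ^ 3) = 2 * s * Re (z ^ 2) - r * Re (z ^ 1)" by (rule rec) simp_all
  also have "\<dots> = 4 * s^3 - 3 * s * r" unfolding R2 R1 by algebra
  finally show R3: "Re (z ^ 3) = 4 * s^3 - 3 * s * r" .
  have "Re (z ^ 4) = 2 * s * Re (z ^ 3) - r * Re (z ^ 2)" by (rule rec) simp_all
  also have "\<dots> = 8 * s^4 - 8 * s^2 * r + r^2" unfolding R3 R2 by algebra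
  finally show R4: "Re (z ^ 4) = 8 * s^4 - 8 * s^2 * r + r^2" .
  have "Re (z ^ 5) = 2 * s * Re (z ^ 4) - r * Re (z ^ 3)" by (rule rec) simp_all
  also have "\<dots> = 16 * s^5 - 20 * s^3 * r + 5 * s * r^2" unfolding R4 R3 by algebra
  finally show R5: "Re (z ^ 5) = 16 * s^5 - 20 * s^3 * r + 5 * s * r^2" .
  have "Re (z ^ 6) = 2 * s * Re (z ^ 5) - r * Re (z ^ 4)" by (rule rec) simp_all
  also have "\<dots> = 32 * s^6 - 48 * s^4 * r + 18 * s^2 * r^2 - r^3" unfolding R5 R4 by algebra
  finally show R6: "Re (z ^ 6) = 32 * s^6 - 48 * s^4 * r + 18 * s^2 * r^2 - r^3" .
  have "Re (z ^ 7) = 2 * s * Re (z ^ 6) - r * Re (z ^ 5)" by (rule rec) simp_all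
  also have "\<dots> = 64 * s^7 - 112 * s^5 * r + 56 * s^3 * r^2 - 7 * s * r^3" unfolding R6 R5 by algebra
  finally show R7: "Re (z ^ 7) = 64 * s^7 - 112 * s^5 * r + 56 * s^3 * r^2 - 7 * s * r^3" .
  have "Re (z ^ 8) = 2 * s * Re (z ^ 7) - r * Re (z ^ 6)" by (rule rec) simp_all
  also have "\<dots> = 128 * s^8 - 256 * s^6 * r + 160 * s^4 * r^2 - 32 * s^2 * r^3 + r^4" unfolding R7 R6 by algebra
  finally show R8: "Re (z ^ 8) = 128 * s^8 - 256 * s^6 * r + 160 * s^4 * r^2 - 32 * s^2 * r^3 + r^4" .
  have "Re (z ^ 9) = 2 * s * Re (z ^ 8) - r * Re (z ^ 7)" by (rule rec) simp_all
  also have "\<dots> = 256 * s^9 - 576 * s^7 * r + 432 * s^5 * r^2 - 120 * s^3 * r^3 + 9 * s * r^4" unfolding R8 R7 by algebra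
  finally show R9: "Re (z ^ 9) = 256 * s^9 - 576 * s^7 * r + 432 * s^5 * r^2 - 120 * s^3 * r^3 + 9 * s * r^4" .
qed

lemma legendre_rec:
  assumes "n = Suc (Suc m)" "k = Suc m"
  shows "legendre n t = ((2 * real m + 3) * t * legendre k t - (real m + 1) * legendre m t) / (real m + 2)"
  by (simp add: assms)

lemma legendre_0: "legendre 0 t = 1" by simp

lemma legendre_1: "legendre 1 t = t" by simp

lemma legendre_2: "legendre 2 t = - 1/2 + 3/2 * t^2"
proof -
  have "legendre 2 t = (3 * t * legendre 1 t - 1 * legendre 0 t) / 2"
    by (subst legendre_rec[of 2 0 1]) simp_all
  then show ?thesis unfolding legendre_1 legendre_0 by algebra
qed

lemma legendre_3: "legendre 3 t = - 3/2 * t + 5/2 * t^3"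
proof -
  have "legendre 3 t = (5 * t * legendre 2 t - 2 * legendre 1 t) / 3"
    by (subst legendre_rec[of 3 1 2]) simp_all
  then show ?thesis unfolding legendre_2 legendre_1 by algebra
qed

lemma legendre_4: "legendre 4 t = 3/8 - 15/4 * t^2 + 35/8 * t^4"
proof -
  have "legendre 4 t = (7 * t * legendre 3 t - 3 * legendre 2 t) / 4"
    by (subst legendre_rec[of 4 2 3]) simp_all
  then show ?thesis unfolding legendre_3 legendre_2 by algebra
qed

lemma legendre_5: "legendre 5 t = 15/8 * t - 35/4 * t^3 + 63/8 * t^5"
proof -
  have "legendre 5 t = (9 * t * legendre 4 t - 4 * legendre 3 t) / 5"
    by (subst legendre_rec[of 5 3 4]) simp_all
  then show ?thesis unfolding legendre_4 legendre_3 by algebra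
qed

lemma legendre_6: "legendre 6 t = - 5/16 + 105/16 * t^2 - 315/16 * t^4 + 231/16 * t^6"
proof -
  have "legendre 6 t = (11 * t * legendre 5 t - 5 * legendre 4 t) / 6"
    by (subst legendre_rec[of 6 4 5]) simp_all
  then show ?thesis unfolding legendre_5 legendre_4 by algebra
qed

lemma legendre_7: "legendre 7 t = - 35/16 * t + 315/16 * t^3 - 693/16 * t^5 + 429/16 * t^7"
proof -
  have "legendre 7 t = (13 * t * legendre 6 t - 6 * legendre 5 t) / 7"
    by (subst legendre_rec[of 7 5 6]) simp_all
  then show ?thesis unfolding legendre_6 legendre_5 by algebra
qed

lemma legendre_8: "legendre 8 t = 35/128 - 315/32 * t^2 + 3465/64 * t^4 - 3003/32 * t^6 + 6435/128 * t^8"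
proof -
  have "legendre 8 t = (15 * t * legendre 7 t - 7 * legendre 6 t) / 8"
    by (subst legendre_rec[of 8 6 7]) simp_all
  then show ?thesis unfolding legendre_7 legendre_6 by algebra
qed

lemma legendre_9: "legendre 9 t = 315/128 * t - 1155/32 * t^3 + 9009/64 * t^5 - 6435/32 * t^7 + 12155/128 * t^9"
proof -
  have "legendre 9 t = (17 * t * legendre 8 t - 8 * legendre 7 t) / 9"
    by (subst legendre_rec[of 9 7 8]) simp_all
  then show ?thesis unfolding legendre_8 legendre_7 by algebra
qed

text \<open>The decompositions below are the addition theorem for Legendre polynomials, in cylindrical coordinates
  about the third axis.\<close>
lemma psd_kernel_legendre_1: "psd_kernel (\<lambda>x y. legendre 1 (x \<bullet> y))"
proof (rule psd_kernel_cong)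
  show "psd_kernel (\<lambda>x y.
    (1) * ((\<lambda>a. a) (x$3) * (\<lambda>a. a) (y$3) * Re ((horizontal x * cnj (horizontal y)) ^ 0)) +
    (1) * ((\<lambda>a. 1) (x$3) * (\<lambda>a. 1) (y$3) * Re ((horizontal x * cnj (horizontal y)) ^ 1)))"
    by (intro psd_kernel_add psd_kernel_cmult psd_kernel_harmonic) simp_all
next
  fix x y :: "real^3"
  assume xy: "x \<in> sphere 0 1" "y \<in> sphere 0 1"
  define z where "z = horizontal x * cnj (horizontal y)"
  have r: "(cmod z)\<^sup>2 = (1 - (x$3)\<^sup>2) * (1 - (y$3)\<^sup>2)"
    using xy by (simp add: z_def norm_mult power_mult_distrib norm_horizontal)
  show "legendre 1 (x \<bullet> y) =
    (1) * ((\<lambda>a. a) (x$3) * (\<lambda>a. a) (y$3) * Re ((horizontal x * cnj (horizontal y)) ^ 0)) +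
    (1) * ((\<lambda>a. 1) (x$3) * (\<lambda>a. 1) (y$3) * Re ((horizontal x * cnj (horizontal y)) ^ 1))"
    unfolding inner_via_horizontal legendre_1 z_def[symmetric] Re_power_explicit r
    by algebra
qed

lemma psd_kernel_legendre_2: "psd_kernel (\<lambda>x y. legendre 2 (x \<bullet> y))"
proof (rule psd_kernel_cong)
  \<comment> \<open>The factors are proportional to the derivatives of order m = 0, 1, 2 of the
    Legendre polynomial of degree n = 2. The weights are 2 (n - m)! / (n + m)!, without the 2 for m
    = 0, adjusted to integer factors. Higher degrees follow the same recipe.\<close>
  show "psd_kernel (\<lambda>x y.
    (1/4) * ((\<lambda>a. - 1 + 3 * a^2) (x$3) * (\<lambda>a. - 1 + 3 * a^2) (y$3) * Re ((horizontal x * cnj (horizontal y)) ^ 0)) +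
    (3) * ((\<lambda>a. a) (x$3) * (\<lambda>a. a) (y$3) * Re ((horizontal x * cnj (horizontal y)) ^ 1)) +
    (3/4) * ((\<lambda>a. 1) (x$3) * (\<lambda>a. 1) (y$3) * Re ((horizontal x * cnj (horizontal y)) ^ 2)))"
    by (intro psd_kernel_add psd_kernel_cmult psd_kernel_harmonic) simp_all
next
  fix x y :: "real^3"
  assume xy: "x \<in> sphere 0 1" "y \<in> sphere 0 1"
  define z where "z = horizontal x * cnj (horizontal y)"
  have r: "(cmod z)\<^sup>2 = (1 - (x$3)\<^sup>2) * (1 - (y$3)\<^sup>2)"
    using xy by (simp add: z_def norm_mult power_mult_distrib norm_horizontal)
  show "legendre 2 (x \<bullet> y) =
    (1/4) * ((\<lambda>a. - 1 + 3 * a^2) (x$3) * (\<lambda>a. - 1 + 3 * a^2) (y$3) * Re ((horizontal x * cnj (horizontal y)) ^ 0)) +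
    (3) * ((\<lambda>a. a) (x$3) * (\<lambda>a. a) (y$3) * Re ((horizontal x * cnj (horizontal y)) ^ 1)) +
    (3/4) * ((\<lambda>a. 1) (x$3) * (\<lambda>a. 1) (y$3) * Re ((horizontal x * cnj (horizontal y)) ^ 2))"
    unfolding inner_via_horizontal legendre_2 z_def[symmetric] Re_power_explicit r
    by algebra
qed

lemma psd_kernel_legendre_3: "psd_kernel (\<lambda>x y. legendre 3 (x \<bullet> y))"
proof (rule psd_kernel_cong)
  show "psd_kernel (\<lambda>x y.
    (1/4) * ((\<lambda>a. - 3 * a + 5 * a^3) (x$3) * (\<lambda>a. - 3 * a + 5 * a^3) (y$3) * Re ((horizontal x * cnj (horizontal y)) ^ 0)) +
    (3/8) * ((\<lambda>a. - 1 + 5 * a^2) (x$3) * (\<lambda>a. - 1 + 5 * a^2) (y$3) * Re ((horizontal x * cnj (horizontal y)) ^ 1)) +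
    (15/4) * ((\<lambda>a. a) (x$3) * (\<lambda>a. a) (y$3) * Re ((horizontal x * cnj (horizontal y)) ^ 2)) +
    (5/8) * ((\<lambda>a. 1) (x$3) * (\<lambda>a. 1) (y$3) * Re ((horizontal x * cnj (horizontal y)) ^ 3)))"
    by (intro psd_kernel_add psd_kernel_cmult psd_kernel_harmonic) simp_all
next
  fix x y :: "real^3"
  assume xy: "x \<in> sphere 0 1" "y \<in> sphere 0 1"
  define z where "z = horizontal x * cnj (horizontal y)"
  have r: "(cmod z)\<^sup>2 = (1 - (x$3)\<^sup>2) * (1 - (y$3)\<^sup>2)"
    using xy by (simp add: z_def norm_mult power_mult_distrib norm_horizontal)
  show "legendre 3 (x \<bullet> y) =
    (1/4) * ((\<lambda>a. - 3 * a + 5 * a^3) (x$3) * (\<lambda>a. - 3 * a + 5 * a^3) (y$3) * Re ((horizontal x * cnj (horizontal y)) ^ 0)) +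
    (3/8) * ((\<lambda>a. - 1 + 5 * a^2) (x$3) * (\<lambda>a. - 1 + 5 * a^2) (y$3) * Re ((horizontal x * cnj (horizontal y)) ^ 1)) +
    (15/4) * ((\<lambda>a. a) (x$3) * (\<lambda>a. a) (y$3) * Re ((horizontal x * cnj (horizontal y)) ^ 2)) +
    (5/8) * ((\<lambda>a. 1) (x$3) * (\<lambda>a. 1) (y$3) * Re ((horizontal x * cnj (horizontal y)) ^ 3))"
    unfolding inner_via_horizontal legendre_3 z_def[symmetric] Re_power_explicit r
    by algebra
qed

lemma psd_kernel_legendre_4: "psd_kernel (\<lambda>x y. legendre 4 (x \<bullet> y))"
proof (rule psd_kernel_cong)
  show "psd_kernel (\<lambda>x y.
    (1/64) * ((\<lambda>a. 3 - 30 * a^2 + 35 * a^4) (x$3) * (\<lambda>a. 3 - 30 * a^2 + 35 * a^4) (y$3) * Re ((horizontal x * cnj (horizontal y)) ^ 0)) +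
    (5/8) * ((\<lambda>a. - 3 * a + 7 * a^3) (x$3) * (\<lambda>a. - 3 * a + 7 * a^3) (y$3) * Re ((horizontal x * cnj (horizontal y)) ^ 1)) +
    (5/16) * ((\<lambda>a. - 1 + 7 * a^2) (x$3) * (\<lambda>a. - 1 + 7 * a^2) (y$3) * Re ((horizontal x * cnj (horizontal y)) ^ 2)) +
    (35/8) * ((\<lambda>a. a) (x$3) * (\<lambda>a. a) (y$3) * Re ((horizontal x * cnj (horizontal y)) ^ 3)) +
    (35/64) * ((\<lambda>a. 1) (x$3) * (\<lambda>a. 1) (y$3) * Re ((horizontal x * cnj (horizontal y)) ^ 4)))"
    by (intro psd_kernel_add psd_kernel_cmult psd_kernel_harmonic) simp_all
next
  fix x y :: "real^3"
  assume xy: "x \<in> sphere 0 1" "y \<in> sphere 0 1"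
  define z where "z = horizontal x * cnj (horizontal y)"
  have r: "(cmod z)\<^sup>2 = (1 - (x$3)\<^sup>2) * (1 - (y$3)\<^sup>2)"
    using xy by (simp add: z_def norm_mult power_mult_distrib norm_horizontal)
  show "legendre 4 (x \<bullet> y) =
    (1/64) * ((\<lambda>a. 3 - 30 * a^2 + 35 * a^4) (x$3) * (\<lambda>a. 3 - 30 * a^2 + 35 * a^4) (y$3) * Re ((horizontal x * cnj (horizontal y)) ^ 0)) +
    (5/8) * ((\<lambda>a. - 3 * a + 7 * a^3) (x$3) * (\<lambda>a. - 3 * a + 7 * a^3) (y$3) * Re ((horizontal x * cnj (horizontal y)) ^ 1)) +
    (5/16) * ((\<lambda>a. - 1 + 7 * a^2) (x$3) * (\<lambda>a. - 1 + 7 * a^2) (y$3) * Re ((horizontal x * cnj (horizontal y)) ^ 2)) +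
    (35/8) * ((\<lambda>a. a) (x$3) * (\<lambda>a. a) (y$3) * Re ((horizontal x * cnj (horizontal y)) ^ 3)) +
    (35/64) * ((\<lambda>a. 1) (x$3) * (\<lambda>a. 1) (y$3) * Re ((horizontal x * cnj (horizontal y)) ^ 4))"
    unfolding inner_via_horizontal legendre_4 z_def[symmetric] Re_power_explicit r
    by algebra
qed

lemma psd_kernel_legendre_5: "psd_kernel (\<lambda>x y. legendre 5 (x \<bullet> y))"
proof (rule psd_kernel_cong)
  show "psd_kernel (\<lambda>x y.
    (1/64) * ((\<lambda>a. 15 * a - 70 * a^3 + 63 * a^5) (x$3) * (\<lambda>a. 15 * a - 70 * a^3 + 63 * a^5) (y$3) * Re ((horizontal x * cnj (horizontal y)) ^ 0)) +
    (15/64) * ((\<lambda>a. 1 - 14 * a^2 + 21 * a^4) (x$3) * (\<lambda>a. 1 - 14 * a^2 + 21 * a^4) (y$3) * Re ((horizontal x * cnj (horizontal y)) ^ 1)) +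
    (105/16) * ((\<lambda>a. - a + 3 * a^3) (x$3) * (\<lambda>a. - a + 3 * a^3) (y$3) * Re ((horizontal x * cnj (horizontal y)) ^ 2)) +
    (35/128) * ((\<lambda>a. - 1 + 9 * a^2) (x$3) * (\<lambda>a. - 1 + 9 * a^2) (y$3) * Re ((horizontal x * cnj (horizontal y)) ^ 3)) +
    (315/64) * ((\<lambda>a. a) (x$3) * (\<lambda>a. a) (y$3) * Re ((horizontal x * cnj (horizontal y)) ^ 4)) +
    (63/128) * ((\<lambda>a. 1) (x$3) * (\<lambda>a. 1) (y$3) * Re ((horizontal x * cnj (horizontal y)) ^ 5)))"
    by (intro psd_kernel_add psd_kernel_cmult psd_kernel_harmonic) simp_all
next
  fix x y :: "real^3"
  assume xy: "x \<in> sphere 0 1" "y \<in> sphere 0 1"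
  define z where "z = horizontal x * cnj (horizontal y)"
  have r: "(cmod z)\<^sup>2 = (1 - (x$3)\<^sup>2) * (1 - (y$3)\<^sup>2)"
    using xy by (simp add: z_def norm_mult power_mult_distrib norm_horizontal)
  show "legendre 5 (x \<bullet> y) =
    (1/64) * ((\<lambda>a. 15 * a - 70 * a^3 + 63 * a^5) (x$3) * (\<lambda>a. 15 * a - 70 * a^3 + 63 * a^5) (y$3) * Re ((horizontal x * cnj (horizontal y)) ^ 0)) +
    (15/64) * ((\<lambda>a. 1 - 14 * a^2 + 21 * a^4) (x$3) * (\<lambda>a. 1 - 14 * a^2 + 21 * a^4) (y$3) * Re ((horizontal x * cnj (horizontal y)) ^ 1)) +
    (105/16) * ((\<lambda>a. - a + 3 * a^3) (x$3) * (\<lambda>a. - a + 3 * a^3) (y$3) * Re ((horizontal x * cnj (horizontal y)) ^ 2)) +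
    (35/128) * ((\<lambda>a. - 1 + 9 * a^2) (x$3) * (\<lambda>a. - 1 + 9 * a^2) (y$3) * Re ((horizontal x * cnj (horizontal y)) ^ 3)) +
    (315/64) * ((\<lambda>a. a) (x$3) * (\<lambda>a. a) (y$3) * Re ((horizontal x * cnj (horizontal y)) ^ 4)) +
    (63/128) * ((\<lambda>a. 1) (x$3) * (\<lambda>a. 1) (y$3) * Re ((horizontal x * cnj (horizontal y)) ^ 5))"
    unfolding inner_via_horizontal legendre_5 z_def[symmetric] Re_power_explicit r
    by algebra
qed

lemma psd_kernel_legendre_9: "psd_kernel (\<lambda>x y. legendre 9 (x \<bullet> y))"
proof (rule psd_kernel_cong)
  show "psd_kernel (\<lambda>x y.
    (1/16384) * ((\<lambda>a. 315 * a - 4620 * a^3 + 18018 * a^5 - 25740 * a^7 + 12155 * a^9) (x$3) * (\<lambda>a. 315 * a - 4620 * a^3 + 18018 * a^5 - 25740 * a^7 + 12155 * a^9) (y$3) * Re ((horizontal x * cnj (horizontal y)) ^ 0)) +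
    (45/16384) * ((\<lambda>a. 7 - 308 * a^2 + 2002 * a^4 - 4004 * a^6 + 2431 * a^8) (x$3) * (\<lambda>a. 7 - 308 * a^2 + 2002 * a^4 - 4004 * a^6 + 2431 * a^8) (y$3) * Re ((horizontal x * cnj (horizontal y)) ^ 1)) +
    (495/2048) * ((\<lambda>a. - 7 * a + 91 * a^3 - 273 * a^5 + 221 * a^7) (x$3) * (\<lambda>a. - 7 * a + 91 * a^3 - 273 * a^5 + 221 * a^7) (y$3) * Re ((horizontal x * cnj (horizontal y)) ^ 2)) +
    (1155/8192) * ((\<lambda>a. - 1 + 39 * a^2 - 195 * a^4 + 221 * a^6) (x$3) * (\<lambda>a. - 1 + 39 * a^2 - 195 * a^4 + 221 * a^6) (y$3) * Re ((horizontal x * cnj (horizontal y)) ^ 3)) +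
    (45045/4096) * ((\<lambda>a. a - 10 * a^3 + 17 * a^5) (x$3) * (\<lambda>a. a - 10 * a^3 + 17 * a^5) (y$3) * Re ((horizontal x * cnj (horizontal y)) ^ 4)) +
    (1287/8192) * ((\<lambda>a. 1 - 30 * a^2 + 85 * a^4) (x$3) * (\<lambda>a. 1 - 30 * a^2 + 85 * a^4) (y$3) * Re ((horizontal x * cnj (horizontal y)) ^ 5)) +
    (2145/2048) * ((\<lambda>a. - 3 * a + 17 * a^3) (x$3) * (\<lambda>a. - 3 * a + 17 * a^3) (y$3) * Re ((horizontal x * cnj (horizontal y)) ^ 6)) +
    (6435/32768) * ((\<lambda>a. - 1 + 17 * a^2) (x$3) * (\<lambda>a. - 1 + 17 * a^2) (y$3) * Re ((horizontal x * cnj (horizontal y)) ^ 7)) +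
    (109395/16384) * ((\<lambda>a. a) (x$3) * (\<lambda>a. a) (y$3) * Re ((horizontal x * cnj (horizontal y)) ^ 8)) +
    (12155/32768) * ((\<lambda>a. 1) (x$3) * (\<lambda>a. 1) (y$3) * Re ((horizontal x * cnj (horizontal y)) ^ 9)))"
    by (intro psd_kernel_add psd_kernel_cmult psd_kernel_harmonic) simp_all
next
  fix x y :: "real^3"
  assume xy: "x \<in> sphere 0 1" "y \<in> sphere 0 1"
  define z where "z = horizontal x * cnj (horizontal y)"
  have r: "(cmod z)\<^sup>2 = (1 - (x$3)\<^sup>2) * (1 - (y$3)\<^sup>2)"
    using xy by (simp add: z_def norm_mult power_mult_distrib norm_horizontal)
  show "legendre 9 (x \<bullet> y) =
    (1/16384) * ((\<lambda>a. 315 * a - 4620 * a^3 + 18018 * a^5 - 25740 * a^7 + 12155 * a^9) (x$3) * (\<lambda>a. 315 * a - 4620 * a^3 + 18018 * a^5 - 25740 * a^7 + 12155 * a^9) (y$3) * Re ((horizontal x * cnj (horizontal y)) ^ 0)) +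
    (45/16384) * ((\<lambda>a. 7 - 308 * a^2 + 2002 * a^4 - 4004 * a^6 + 2431 * a^8) (x$3) * (\<lambda>a. 7 - 308 * a^2 + 2002 * a^4 - 4004 * a^6 + 2431 * a^8) (y$3) * Re ((horizontal x * cnj (horizontal y)) ^ 1)) +
    (495/2048) * ((\<lambda>a. - 7 * a + 91 * a^3 - 273 * a^5 + 221 * a^7) (x$3) * (\<lambda>a. - 7 * a + 91 * a^3 - 273 * a^5 + 221 * a^7) (y$3) * Re ((horizontal x * cnj (horizontal y)) ^ 2)) +
    (1155/8192) * ((\<lambda>a. - 1 + 39 * a^2 - 195 * a^4 + 221 * a^6) (x$3) * (\<lambda>a. - 1 + 39 * a^2 - 195 * a^4 + 221 * a^6) (y$3) * Re ((horizontal x * cnj (horizontal y)) ^ 3)) +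
    (45045/4096) * ((\<lambda>a. a - 10 * a^3 + 17 * a^5) (x$3) * (\<lambda>a. a - 10 * a^3 + 17 * a^5) (y$3) * Re ((horizontal x * cnj (horizontal y)) ^ 4)) +
    (1287/8192) * ((\<lambda>a. 1 - 30 * a^2 + 85 * a^4) (x$3) * (\<lambda>a. 1 - 30 * a^2 + 85 * a^4) (y$3) * Re ((horizontal x * cnj (horizontal y)) ^ 5)) +
    (2145/2048) * ((\<lambda>a. - 3 * a + 17 * a^3) (x$3) * (\<lambda>a. - 3 * a + 17 * a^3) (y$3) * Re ((horizontal x * cnj (horizontal y)) ^ 6)) +
    (6435/32768) * ((\<lambda>a. - 1 + 17 * a^2) (x$3) * (\<lambda>a. - 1 + 17 * a^2) (y$3) * Re ((horizontal x * cnj (horizontal y)) ^ 7)) +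
    (109395/16384) * ((\<lambda>a. a) (x$3) * (\<lambda>a. a) (y$3) * Re ((horizontal x * cnj (horizontal y)) ^ 8)) +
    (12155/32768) * ((\<lambda>a. 1) (x$3) * (\<lambda>a. 1) (y$3) * Re ((horizontal x * cnj (horizontal y)) ^ 9))"
    unfolding inner_via_horizontal legendre_9 z_def[symmetric] Re_power_explicit r
    by algebra
qed

text \<open>The coefficients come from a linear program.  What matters is that they are positive and that, with 13 points,
  $3000 + 580 < 12 \cdot 1493/5$: the value at 1, the bound on the excess over $-1493/5$ in the cap opposite to a point,
  and the bound outside that cap.\<close>
definition kiss_poly :: "real \<Rightarrow> real" where
  "kiss_poly t = 590 * legendre 1 t + 1044 * legendre 2 t + 612 * legendre 3 t + 593 * legendre 4 t
     + 53 * legendre 5 t + 108 * legendre 9 t"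

lemma kiss_poly_eq_horner:
  "kiss_poly t = horner_sum id t [- 2397/8, 1189/32, - 2631/4, - 22655/8, 20755/8, 249921/16, 0, - 173745/8, 0, 328185/32]"
  unfolding kiss_poly_def legendre_1 legendre_2 legendre_3 legendre_4 legendre_5 legendre_9
  by (simp only: horner_sum_simps id_apply) algebra

lemma psd_kernel_kiss_poly: "psd_kernel (\<lambda>x y. kiss_poly (x \<bullet> y))"
  unfolding kiss_poly_def
  by (intro psd_kernel_add psd_kernel_cmult psd_kernel_legendre_1 psd_kernel_legendre_2
      psd_kernel_legendre_3 psd_kernel_legendre_4 psd_kernel_legendre_5 psd_kernel_legendre_9) simp_all

text \<open>The argument is the cosine of the angle to the antipode. Outside the cap c > 17/24
  around the antipode, \<open>kiss_poly\<close> stays below -1493/5 at all permitted distances, so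
  this measures what a point inside the cap costs. The radius satisfies (17/24)^2 > 1/2, which
  leaves room for at most three points.\<close>

definition cap_poly :: "real \<Rightarrow> real" where
  "cap_poly c = kiss_poly (- c) + 1493/5"

lemma cap_poly_eq_horner:
  "cap_poly c = horner_sum id c [- 41/40, - 1189/32, - 2631/4, 22655/8, 20755/8, - 249921/16, 0, 173745/8, 0, - 328185/32]"
  unfolding cap_poly_def kiss_poly_eq_horner by (simp only: horner_sum_simps id_apply) algebra

lemma kiss_poly_le:
  assumes "-17/24 \<le> t" "t \<le> 1/2"
  shows "kiss_poly t \<le> - 1493/5"
proof -
  let ?p = "[41/40, - 1189/32, 2631/4, 22655/8, - 20755/8, - 249921/16, 0, 173745/8, 0, - 328185/32] :: real list"
  \<comment> \<open>The pieces are short enough for the transformed coefficients to show the sign.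
    Each certificate covers a half-open interval, so the right end 1/2 is evaluated
    separately.\<close>
  consider "-17/24 \<le> t" "t < -9/16" | "-9/16 \<le> t" "t < -2/5" | "-2/5 \<le> t" "t < -1/10" | "-1/10 \<le> t" "t < 1/20"
    | "1/20 \<le> t" "t < 1/5" | "1/5 \<le> t" "t < 1/2" | "t = 1/2"
    using assms by linarith
  then have "0 \<le> horner_sum id t ?p"
    by cases ((erule (1) horner_nonneg_on_interval, simp add: eval_nat_numeral)+, hypsubst, simp)
  also have "horner_sum id t ?p = - 1493/5 - kiss_poly t"
    unfolding kiss_poly_eq_horner by (simp only: horner_sum_simps id_apply) algebra
  finally show ?thesis by simp
qed

lemma cap_poly_le:
  assumes "17/24 \<le> c" "c \<le> 1"
  shows "cap_poly c \<le> 580"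
proof -
  let ?p = "[580 + 41/40, 1189/32, 2631/4, - 22655/8, - 20755/8, 249921/16, 0, - 173745/8, 0, 328185/32] :: real list"
  consider "17/24 \<le> c" "c < 17/20" | "17/20 \<le> c" "c < 93/100" | "93/100 \<le> c" "c < 1" | "c = 1"
    using assms by linarith
  then have "0 \<le> horner_sum id c ?p"
    by cases ((erule (1) horner_nonneg_on_interval, simp add: eval_nat_numeral)+, hypsubst, simp)
  also have "horner_sum id c ?p = 580 - cap_poly c"
    unfolding cap_poly_eq_horner by (simp only: horner_sum_simps id_apply) algebra
  finally show ?thesis by simp
qed

text \<open>Meant for three points in the cap: while their cosines exceed 17/24 by at most 1/4 in
  total, it gives 2250/4 < 580.\<close>

lemma cap_poly_le_linear:
  assumes "17/24 \<le> c" "c \<le> 1"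
  shows "cap_poly c \<le> 2250 * (c - 17/24)"
proof -
  let ?p = "[41/40 - 6375/4, 1189/32 + 2250, 2631/4, - 22655/8, - 20755/8, 249921/16, 0, - 173745/8, 0, 328185/32] :: real list"
  consider "17/24 \<le> c" "c < 17/20" | "17/20 \<le> c" "c < 1" | "c = 1"
    using assms by linarith
  then have "0 \<le> horner_sum id c ?p"
    by cases ((erule (1) horner_nonneg_on_interval, simp add: eval_nat_numeral)+, hypsubst, simp)
  also have "horner_sum id c ?p = 2250 * (c - 17/24) - cap_poly c"
    unfolding cap_poly_eq_horner by (simp only: horner_sum_simps id_apply) algebra
  finally show ?thesis by simp
qed

text \<open>Meant for three points of larger total excess: the constraint of
  \<open>triple_in_cap\<close> controls the sum of the squared excesses, so a quadratic term is
  affordable in exchange for a smaller slope.\<close>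

lemma cap_poly_le_quadratic:
  assumes "17/24 \<le> c" "c \<le> 1"
  shows "cap_poly c \<le> 700 * (c - 17/24) + 7500 * (c - 17/24)\<^sup>2"
proof -
  let ?p = "[41/40 - 2975/6 + 90312500/24000, 1189/32 + 700 - 10625, 2631/4 + 7500, - 22655/8, - 20755/8, 249921/16, 0, - 173745/8, 0, 328185/32] :: real list"
  consider "17/24 \<le> c" "c < 3/4" | "3/4 \<le> c" "c < 17/20" | "17/20 \<le> c" "c < 1" | "c = 1"
    using assms by linarith
  then have "0 \<le> horner_sum id c ?p"
    by cases ((erule (1) horner_nonneg_on_interval, simp add: eval_nat_numeral)+, hypsubst, simp)
  also have "horner_sum id c ?p = 700 * (c - 17/24) + 7500 * (c - 17/24)\<^sup>2 - cap_poly c"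
    unfolding cap_poly_eq_horner by (simp only: horner_sum_simps id_apply) algebra
  finally show ?thesis by simp
qed

text \<open>The derivative is negative at 1, so the range has to stop earlier; 49/50 is enough for
  \<open>cap_poly_pair\<close>.\<close>

lemma cap_poly_mono:
  assumes "17/24 \<le> c" "c \<le> d" "d \<le> 49/50"
  shows "cap_poly c \<le> cap_poly d"
proof (rule DERIV_nonneg_imp_nondecreasing[OF assms(2)])
  fix x assume x: "c \<le> x" "x \<le> d"
  let ?p = "[- 1189/32, - 2631/2, 67965/8, 20755/2, - 1249605/16, 0, 1216215/8, 0, - 2953665/32] :: real list"
  have "(cap_poly has_real_derivative horner_sum id x ?p) (at x)"
    unfolding cap_poly_eq_horner[abs_def] by (auto intro!: derivative_eq_intros simp: algebra_simps eval_nat_numeral)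
  moreover have "0 \<le> horner_sum id x ?p"
    using x assms
    \<comment> \<open>The certificate excludes its right end, hence the extra 1/1000.\<close>
    by (intro horner_nonneg_on_interval[of "17/24" x "49/50 + 1/1000"]) (simp_all add: eval_nat_numeral)
  ultimately show "\<exists>y. (cap_poly has_real_derivative y) (at x) \<and> 0 \<le> y" by blast
qed

text \<open>The hypothesis is the ellipse c^2 + d^2 - c d = 3/4 in terms of sum and product. On it a
  symmetric polynomial depends on the sum alone, so that one-variable certificates apply.\<close>

lemma cap_poly_pair_symmetric:
  assumes "c * d = (c + d)\<^sup>2 / 3 - 1/4"
  shows "cap_poly c + cap_poly d = horner_sum id (c + d)
    [- 2121/320, - 6386929/8192, 4531/3, 111495/1024, - 20755/72, - 95947/512, 0, 6435/128]"
proof -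
  define p q where "p = c + d" and "q = c * d"
  \<comment> \<open>Power sums of c and d in the elementary symmetric polynomials p and q.\<close>
  have sum: "cap_poly c + cap_poly d = - 41/20 - 1189/32 * p - 2631/4 * (p^2 - 2 * q) + 22655/8 * (p^3 - 3 * p * q)
    + 20755/8 * (p^4 - 4 * p^2 * q + 2 * q^2) - 249921/16 * (p^5 - 5 * p^3 * q + 5 * p * q^2)
    + 173745/8 * (p^7 - 7 * p^5 * q + 14 * p^3 * q^2 - 7 * p * q^3)
    - 328185/32 * (p^9 - 9 * p^7 * q + 27 * p^5 * q^2 - 30 * p^3 * q^3 + 9 * p * q^4)"
    unfolding cap_poly_eq_horner p_def q_def by (simp only: horner_sum_simps id_apply) algebra
  have q: "q = 1/3 * p\<^sup>2 - 1/4" using assms by (simp add: p_def q_def)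
  show ?thesis unfolding sum q p_def[symmetric] by (simp only: horner_sum_simps id_apply) algebra
qed

text \<open>The two cosines lie in an ellipse. Monotonicity lets d grow up to its boundary, where
  the sum of the cosines is the only parameter left.\<close>

lemma cap_poly_pair:
  assumes "17/24 \<le> c" "17/24 \<le> d" and cd: "c\<^sup>2 + d\<^sup>2 - c * d \<le> 3/4" and "c \<le> 1" "d \<le> 1"
  shows "cap_poly c + cap_poly d \<le> 580"
proof -
  \<comment> \<open>The larger root of c^2 + e^2 - c e = 3/4.\<close>
  define e where "e = c / 2 + sqrt (3/4 - 3/4 * c\<^sup>2)"
  have c2: "c\<^sup>2 \<le> 1" using assms by (intro power_le_one) auto
  have sq: "(e - c/2)\<^sup>2 = 3/4 - 3/4 * c\<^sup>2" using c2 by (simp add: e_def)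
  have "(d - c/2)\<^sup>2 = (c\<^sup>2 + d\<^sup>2 - c * d) - 3/4 * c\<^sup>2" by algebra
  then have "(d - c/2)\<^sup>2 \<le> 3/4 - 3/4 * c\<^sup>2" using cd by linarith
  then have "d - c/2 \<le> sqrt (3/4 - 3/4 * c\<^sup>2)" by (rule real_le_rsqrt)
  then have de: "d \<le> e" unfolding e_def by linarith
  have "c\<^sup>2 + e\<^sup>2 - c * e = (e - c/2)\<^sup>2 + 3/4 * c\<^sup>2" by algebra
  then have tight: "c\<^sup>2 + e\<^sup>2 - c * e = 3/4" using sq by linarith
  have "e \<le> 49/50"
  proof (rule ccontr)
    assume "\<not> e \<le> 49/50"
    then have e: "49/50 < e" by simp
    have "0 \<le> (e - 49/50) * (e + 49/50 - c)" using e assms(4) by (intro mult_nonneg_nonneg) auto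
    moreover have "(e - 49/50) * (e + 49/50 - c) = (c\<^sup>2 + e\<^sup>2 - c * e) - c\<^sup>2 - 2401/2500 + 49/50 * c"
      by algebra
    moreover have "0 \<le> (c - 17/24) * (c + 17/24 - 49/50)" using assms(1) by (intro mult_nonneg_nonneg) auto
    moreover have "(c - 17/24) * (c + 17/24 - 49/50) = c\<^sup>2 - 49/50 * c + 2771/14400"
      by algebra
    ultimately show False using tight by linarith
  qed
  then have "cap_poly d \<le> cap_poly e" using cap_poly_mono assms(2) de by blast
  moreover have "cap_poly c + cap_poly e \<le> 580"
  proof -
    define p where "p = c + e"
    have "p\<^sup>2 = (c\<^sup>2 + e\<^sup>2 - c * e) + 3 * (c * e)" unfolding p_def by algebra
    then have ce: "c * e = p\<^sup>2 / 3 - 1/4" using tight by linarith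
    have "17/24 * (17/24) \<le> c * e" using assms(1,2) de by (intro mult_mono) auto
    then have "9/4 \<le> p\<^sup>2" using ce by linarith
    then have "(3/2)\<^sup>2 \<le> p\<^sup>2" by (simp add: power2_eq_square)
    moreover have "0 \<le> p" using assms(1,2) de by (simp add: p_def)
    ultimately have lo: "3/2 \<le> p" by (rule power2_le_imp_le)
    have "p\<^sup>2 = 4 * (c\<^sup>2 + e\<^sup>2 - c * e) - 3 * (c - e)\<^sup>2" unfolding p_def by algebra
    then have "p\<^sup>2 \<le> 3" unfolding tight by simp
    \<comment> \<open>The value 3 is taken at c = e; 87/50 is just above its square root.\<close>
    also have "3 < (87/50 :: real)\<^sup>2" by (simp add: power2_eq_square)
    finally have hi: "p < 87/50" by (rule power2_less_imp_less) simp
    let ?p = "[580 + 2121/320, 6386929/8192, - 4531/3, - 111495/1024, 20755/72, 95947/512, 0, - 6435/128] :: real list"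
    consider "3/2 \<le> p" "p < 17/10" | "17/10 \<le> p" "p < 87/50" using lo hi by linarith
    then have "0 \<le> horner_sum id p ?p"
      by cases (erule (1) horner_nonneg_on_interval, simp add: eval_nat_numeral)+
    also have "horner_sum id p ?p = 580 - (cap_poly c + cap_poly e)"
      unfolding cap_poly_pair_symmetric[OF ce[unfolded p_def]] p_def[symmetric]
      by (simp only: horner_sum_simps id_apply) algebra
    finally show ?thesis by simp
  qed
  ultimately show ?thesis by simp
qed

text \<open>The sums \<open>z1\<close> and \<open>z2\<close> of the excesses over 17/24 and of their
  squares are tied together by the last hypothesis, which forces \<open>z1\<close> to be at most
  7/20. The linear bound settles values up to 1/4, the quadratic one the rest.\<close>

lemma cap_poly_triple:
  assumes "17/24 \<le> c" "17/24 \<le> d" "17/24 \<le> e" and "c \<le> 1" "d \<le> 1" "e \<le> 1"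
    and cde: "2 * (c\<^sup>2 + d\<^sup>2 + e\<^sup>2) - (c + d + e)\<^sup>2 / 2 \<le> 1"
  shows "cap_poly c + cap_poly d + cap_poly e \<le> 580"
proof -
  define z1 where "z1 = (c - 17/24) + (d - 17/24) + (e - 17/24)"
  define z2 where "z2 = (c - 17/24)\<^sup>2 + (d - 17/24)\<^sup>2 + (e - 17/24)\<^sup>2"
  have lin: "cap_poly c + cap_poly d + cap_poly e \<le> 2250 * z1"
    using cap_poly_le_linear[of c] cap_poly_le_linear[of d] cap_poly_le_linear[of e] assms(1-6) by (simp add: z1_def)
  have quad: "cap_poly c + cap_poly d + cap_poly e \<le> 700 * z1 + 7500 * z2"
    using cap_poly_le_quadratic[of c] cap_poly_le_quadratic[of d] cap_poly_le_quadratic[of e] assms(1-6)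
    by (simp add: z1_def z2_def)
  have ell: "2 * z2 + 17/24 * z1 - z1\<^sup>2 / 2 \<le> 1 - 3/2 * (17/24)\<^sup>2"
  proof -
    have "2 * z2 + 17/24 * z1 - z1\<^sup>2 / 2
        = 2 * (c\<^sup>2 + d\<^sup>2 + e\<^sup>2) - (c + d + e)\<^sup>2 / 2 - 3/2 * (17/24)\<^sup>2"
      unfolding z1_def z2_def by algebra
    then show ?thesis using cde by linarith
  qed
  have z1: "0 \<le> z1" using assms(1-3) by (simp add: z1_def)
  have "0 \<le> (c - d)\<^sup>2 + (d - e)\<^sup>2 + (c - e)\<^sup>2" by simp
  then have "z1\<^sup>2 \<le> 3 * z2" by (simp add: z1_def z2_def power2_eq_square algebra_simps)
  then have up: "z1\<^sup>2 / 6 + 17/24 * z1 \<le> 1 - 3/2 * (17/24)\<^sup>2" using ell by simp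
  then have "17/24 * z1 \<le> 1 - 3/2 * (17/24)\<^sup>2" using zero_le_power2[of z1] by linarith
  then have z1': "z1 \<le> 7/20" by (simp add: power2_eq_square)
  show ?thesis
  proof (cases "z1 \<le> 1/4")
    case True then show ?thesis using lin by simp
  next
    case False
    \<comment> \<open>The chord of the square over [1/4, 7/20] bounds the square of
      \<open>z1\<close> and makes the remaining estimate linear.\<close>
    have "0 \<le> (z1 - 1/4) * (7/20 - z1)" using False z1' by (intro mult_nonneg_nonneg) auto
    also have "(z1 - 1/4) * (7/20 - z1) = 3/5 * z1 - 7/80 - z1\<^sup>2" by algebra
    finally show ?thesis using quad ell False by (simp add: power2_eq_square)
  qed
qed

section \<open>Points of a packing inside a small cap\<close>

lemma plane_dependent:
  fixes g u v w :: "real^3"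
  assumes "g \<noteq> 0" "g \<bullet> u = 0" "g \<bullet> v = 0" "g \<bullet> w = 0"
  obtains a b c where "a *\<^sub>R u + b *\<^sub>R v + c *\<^sub>R w = 0" "a \<noteq> 0 \<or> b \<noteq> 0 \<or> c \<noteq> 0"
\<comment> \<open>A set does not see repetitions, so equal vectors have to supply a dependence of
  their own.\<close>
proof (cases "distinct [u, v, w]")
  case True
  have "{u, v, w} \<subseteq> {x. g \<bullet> x = 0}" using assms by auto
  then have "dim {u, v, w} \<le> dim {x. g \<bullet> x = 0}" by (rule dim_subset)
  also have "\<dots> = 2" using assms(1) by (simp add: dim_hyperplane)
  finally have "dim {u, v, w} < card {u, v, w}" using True by simp
  then have "dependent {u, v, w}" using independent_card_le_dim[of "{u,v,w}" "{u,v,w}"] by force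
  then obtain k where k: "\<exists>x\<in>{u,v,w}. k x \<noteq> 0" "(\<Sum>x\<in>{u,v,w}. k x *\<^sub>R x) = 0"
    using dependent_finite[of "{u,v,w}"] by auto
  have "k u *\<^sub>R u + k v *\<^sub>R v + k w *\<^sub>R w = 0" using k(2) True by (simp add: add.assoc)
  moreover have "k u \<noteq> 0 \<or> k v \<noteq> 0 \<or> k w \<noteq> 0" using k(1) by auto
  ultimately show ?thesis by (rule that)
next
  case False
  then consider "u = v" | "v = w" | "u = w" by auto
  then show ?thesis
  proof cases
    case 1 then show ?thesis using that[of 1 "-1" 0] by simp
  next
    case 2 then show ?thesis using that[of 0 1 "-1"] by simp
  next
    case 3 then show ?thesis using that[of 1 0 "-1"] by simp
  qed
qed

text \<open>Replacing the coefficients of a linear dependence among u, v, w by their absolute values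
  can only shorten the combination, because the mixed inner products are negative. So the new
  combination is zero as well, although its product with t is negative.\<close>

lemma planar_obtuse_vectors:
  fixes g :: "real^3"
  assumes "g \<noteq> 0" and orth: "g \<bullet> u = 0" "g \<bullet> v = 0" "g \<bullet> w = 0"
    and neg: "u \<bullet> v < 0" "u \<bullet> w < 0" "v \<bullet> w < 0" "u \<bullet> t < 0" "v \<bullet> t < 0" "w \<bullet> t < 0"
  shows False
proof -
  obtain a b c where rel: "a *\<^sub>R u + b *\<^sub>R v + c *\<^sub>R w = 0" and nz: "a \<noteq> 0 \<or> b \<noteq> 0 \<or> c \<noteq> 0"
    using plane_dependent[OF assms(1) orth] by blast
  define s where "s = \<bar>a\<bar> *\<^sub>R u + \<bar>b\<bar> *\<^sub>R v + \<bar>c\<bar> *\<^sub>R w"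
  have "s \<bullet> s = (a *\<^sub>R u + b *\<^sub>R v + c *\<^sub>R w) \<bullet> (a *\<^sub>R u + b *\<^sub>R v + c *\<^sub>R w)
      + 2 * ((\<bar>a\<bar> * \<bar>b\<bar> - a * b) * (u \<bullet> v) + (\<bar>a\<bar> * \<bar>c\<bar> - a * c) * (u \<bullet> w) + (\<bar>b\<bar> * \<bar>c\<bar> - b * c) * (v \<bullet> w))"
    unfolding s_def by (simp add: inner_add_left inner_add_right inner_commute algebra_simps flip: power2_eq_square abs_mult_self_eq)
  also have "\<dots> \<le> 0"
  proof -
    have "(\<bar>x\<bar> * \<bar>y\<bar> - x * y) * k \<le> 0" if "k < 0" for x y k :: real
      using that by (intro mult_nonneg_nonpos) (auto simp flip: abs_mult)
    from this[OF neg(1), of a b] this[OF neg(2), of a c] this[OF neg(3), of b c]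
    show ?thesis unfolding rel by simp
  qed
  finally have "s = 0" by (metis inner_gt_zero_iff not_le)
  then have "s \<bullet> t = 0" by simp
  then have "\<bar>a\<bar> * (u \<bullet> t) + \<bar>b\<bar> * (v \<bullet> t) + \<bar>c\<bar> * (w \<bullet> t) = 0"
    by (simp add: s_def inner_add_left)
  moreover have "\<bar>x\<bar> * k \<le> 0" "x \<noteq> 0 \<Longrightarrow> \<bar>x\<bar> * k < 0" if "k < 0" for x k :: real
    using that by (auto simp: mult_nonneg_nonpos mult_pos_neg)
  ultimately show False using nz neg(4-6) by (smt (verit))
qed

lemma kissing_subset: "kissing C \<Longrightarrow> S \<subseteq> C \<Longrightarrow> kissing S"
  unfolding kissing_def by (meson finite_subset order_trans subsetD)

lemma kissing_unit: "kissing C \<Longrightarrow> x \<in> C \<Longrightarrow> x \<bullet> x = 1"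
  by (auto simp: kissing_def dot_square_norm)

lemma kissing_inner_le: "kissing C \<Longrightarrow> x \<in> C \<Longrightarrow> y \<in> C \<Longrightarrow> x \<noteq> y \<Longrightarrow> x \<bullet> y \<le> 1/2"
  by (auto simp: kissing_def)

text \<open>For a and b at inner product 1/2, this says that the projection of x to their plane has
  length at most 1. The weights p and q are those of the projection up to scale; as they are
  nonnegative, a smaller \<open>a \<bullet> b\<close> does no harm.\<close>

lemma pair_in_cap:
  fixes x a b :: "real^3"
  assumes "x \<bullet> x = 1" "a \<bullet> a = 1" "b \<bullet> b = 1" "a \<bullet> b \<le> 1/2"
    and "0 \<le> 2 * (x \<bullet> a) - x \<bullet> b" "0 \<le> 2 * (x \<bullet> b) - x \<bullet> a"
  shows "(x \<bullet> a)\<^sup>2 + (x \<bullet> b)\<^sup>2 - (x \<bullet> a) * (x \<bullet> b) \<le> 3/4"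
proof -
  define c d where "c = x \<bullet> a" and "d = x \<bullet> b"
  define p q where "p = 2 * c - d" and "q = 2 * d - c"
  define m where "m = c\<^sup>2 + d\<^sup>2 - c * d"
  have pq: "0 \<le> p" "0 \<le> q" using assms by (auto simp: p_def q_def c_def d_def)
  have "(x \<bullet> (p *\<^sub>R a + q *\<^sub>R b))\<^sup>2 \<le> (p *\<^sub>R a + q *\<^sub>R b) \<bullet> (p *\<^sub>R a + q *\<^sub>R b)"
    using Cauchy_Schwarz_ineq[of x "p *\<^sub>R a + q *\<^sub>R b"] assms(1) by simp
  also have "\<dots> = p\<^sup>2 + q\<^sup>2 + 2 * (p * q) * (a \<bullet> b)"
    using assms(2,3) by (simp add: inner_add_left inner_add_right inner_commute power2_eq_square algebra_simps)
  also have "\<dots> \<le> p\<^sup>2 + q\<^sup>2 + 2 * (p * q) * (1/2)"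
    using assms(4) pq by (intro add_left_mono mult_left_mono) auto
  also have "\<dots> = 3 * m" unfolding p_def q_def m_def by algebra
  also have "x \<bullet> (p *\<^sub>R a + q *\<^sub>R b) = 2 * m"
    unfolding inner_add_right inner_scaleR_right c_def[symmetric] d_def[symmetric] p_def q_def m_def by algebra
  finally have "m * (4 * m - 3) \<le> 0" by (simp add: power2_eq_square algebra_simps)
  then have "m \<le> 3/4" by (auto simp: mult_le_0_iff)
  then show ?thesis by (simp add: m_def c_def d_def)
qed

text \<open>The analogue for three vectors, with weights from the inverse Gram matrix of three unit
  vectors at inner products 1/2. In the cap these weights are nonnegative because 3 * 17/24 >
  2.\<close>

lemma triple_in_cap:
  fixes x a b e :: "real^3"
  assumes "x \<bullet> x = 1" "a \<bullet> a = 1" "b \<bullet> b = 1" "e \<bullet> e = 1" "a \<bullet> b \<le> 1/2" "a \<bullet> e \<le> 1/2" "b \<bullet> e \<le> 1/2"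
    and "0 \<le> 3 * (x \<bullet> a) - x \<bullet> b - x \<bullet> e" "0 \<le> 3 * (x \<bullet> b) - x \<bullet> a - x \<bullet> e" "0 \<le> 3 * (x \<bullet> e) - x \<bullet> a - x \<bullet> b"
  shows "2 * ((x \<bullet> a)\<^sup>2 + (x \<bullet> b)\<^sup>2 + (x \<bullet> e)\<^sup>2) - (x \<bullet> a + x \<bullet> b + x \<bullet> e)\<^sup>2 / 2 \<le> 1"
proof -
  define c d f where "c = x \<bullet> a" and "d = x \<bullet> b" and "f = x \<bullet> e"
  define p q r where "p = 3 * c - d - f" and "q = 3 * d - c - f" and "r = 3 * f - c - d"
  define m where "m = 2 * (c\<^sup>2 + d\<^sup>2 + f\<^sup>2) - (c + d + f)\<^sup>2 / 2"
  let ?v = "p *\<^sub>R a + q *\<^sub>R b + r *\<^sub>R e"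
  have pq: "0 \<le> p" "0 \<le> q" "0 \<le> r" using assms by (auto simp: p_def q_def r_def c_def d_def f_def)
  have "(x \<bullet> ?v)\<^sup>2 \<le> ?v \<bullet> ?v"
    using Cauchy_Schwarz_ineq[of x ?v] assms(1) by simp
  also have "\<dots> = p\<^sup>2 + q\<^sup>2 + r\<^sup>2 + (2 * (p * q) * (a \<bullet> b) + 2 * (p * r) * (a \<bullet> e) + 2 * (q * r) * (b \<bullet> e))"
    using assms(2,3,4) by (simp add: inner_add_left inner_add_right inner_commute power2_eq_square algebra_simps)
  also have "\<dots> \<le> p\<^sup>2 + q\<^sup>2 + r\<^sup>2 + (2 * (p * q) * (1/2) + 2 * (p * r) * (1/2) + 2 * (q * r) * (1/2))"
    using assms(5-7) pq by (intro add_left_mono add_mono mult_left_mono) auto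
  also have "\<dots> = 4 * m" unfolding p_def q_def r_def m_def by algebra
  also have "x \<bullet> ?v = 2 * m"
    unfolding inner_add_right inner_scaleR_right c_def[symmetric] d_def[symmetric] f_def[symmetric] p_def q_def r_def m_def by algebra
  finally have "m * (m - 1) \<le> 0" by (simp add: power2_eq_square algebra_simps)
  then have "m \<le> 1" by (auto simp: mult_le_0_iff)
  then show ?thesis by (simp add: m_def c_def d_def f_def)
qed

text \<open>Since (17/24)^2 > 1/2, the components orthogonal to x have pairwise negative inner
  products, and a plane has no room for four such vectors.\<close>

lemma card_in_cap_le_3:
  assumes C: "kissing C" and x: "x \<bullet> x = 1"
  shows "card {y \<in> C. 17/24 < x \<bullet> y} \<le> 3" (is "card ?A \<le> 3")
proof (rule ccontr)
  assume "\<not> card ?A \<le> 3"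
  then have "Suc 3 \<le> card ?A" by simp
  then obtain T where T: "T \<subseteq> ?A" "card T = Suc 3"
    by (rule obtain_subset_with_card_n)
  obtain a T' where a: "T = insert a T'" "a \<notin> T'" "card T' = 3"
    using T(2) by (metis card_Suc_eq)
  then obtain b c d where b: "T' = {b, c, d}" "b \<noteq> c" "c \<noteq> d" "b \<noteq> d"
    by (auto simp: card_3_iff)
  define u where "u y = y - (x \<bullet> y) *\<^sub>R x" for y
  have orth: "x \<bullet> u y = 0" for y by (simp add: u_def inner_diff_right x)
  have neg: "u y \<bullet> u z < 0" if "y \<in> T" "z \<in> T" "y \<noteq> z" for y z
  proof -
    have yz: "y \<in> C" "z \<in> C" "17/24 < x \<bullet> y" "17/24 < x \<bullet> z" using that T by auto
    have "u y \<bullet> u z = y \<bullet> z - (x \<bullet> y) * (x \<bullet> z)"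
      by (simp add: u_def inner_diff_right inner_diff_left x inner_commute algebra_simps)
    moreover have "17/24 * (17/24) < (x \<bullet> y) * (x \<bullet> z)" using yz by (intro mult_strict_mono) auto
    moreover have "y \<bullet> z \<le> 1/2" using kissing_inner_le C yz that by blast
    ultimately show ?thesis by simp
  qed
  have "x \<noteq> 0" using x by auto
  moreover have "u a \<bullet> u b < 0" "u a \<bullet> u c < 0" "u b \<bullet> u c < 0" "u a \<bullet> u d < 0" "u b \<bullet> u d < 0" "u c \<bullet> u d < 0"
    by (rule neg; use a b in blast)+
  ultimately show False using planar_obtuse_vectors[of x "u a" "u b" "u c" "u d"] orth by blast
qed

lemma sum_cap_poly_le:
  assumes C: "kissing C" and x: "x \<bullet> x = 1"
  shows "(\<Sum>y | y \<in> C \<and> 17/24 < x \<bullet> y. cap_poly (x \<bullet> y)) \<le> 580"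
proof -
  define A where "A = {y \<in> C. 17/24 < x \<bullet> y}"
  have finA: "finite A" using C by (simp add: A_def kissing_def)
  have unit: "a \<bullet> a = 1" if "a \<in> A" for a using that C kissing_unit by (simp add: A_def)
  have ip: "a \<bullet> b \<le> 1/2" if "a \<in> A" "b \<in> A" "a \<noteq> b" for a b using that C kissing_inner_le by (auto simp: A_def)
  have gt: "17/24 \<le> x \<bullet> a" if "a \<in> A" for a using that by (simp add: A_def)
  have le1: "x \<bullet> a \<le> 1" if "a \<in> A" for a
    using norm_cauchy_schwarz[of x a] unit[OF that] x by (simp add: norm_eq_sqrt_inner)
  have "card A \<le> 3" using card_in_cap_le_3[OF C x] by (simp add: A_def)
  then consider "card A = 0" | "card A = 1" | "card A = 2" | "card A = 3" by linarith
  then have "(\<Sum>y\<in>A. cap_poly (x \<bullet> y)) \<le> 580"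
  proof cases
    case 1 then show ?thesis using finA by simp
  next
    case 2
    then obtain a where "A = {a}" by (auto simp: card_1_singleton_iff)
    then show ?thesis using cap_poly_le[of "x \<bullet> a"] gt le1 by simp
  next
    case 3
    then obtain a b where A: "A = {a, b}" "a \<noteq> b" by (auto simp: card_2_iff)
    have "17/24 \<le> x \<bullet> a" "17/24 \<le> x \<bullet> b" "x \<bullet> a \<le> 1" "x \<bullet> b \<le> 1" using gt le1 A by auto
    then have "cap_poly (x \<bullet> a) + cap_poly (x \<bullet> b) \<le> 580"
      using pair_in_cap[of x a b] unit ip A x by (intro cap_poly_pair) auto
    then show ?thesis using A by simp
  next
    case 4
    then obtain a b e where A: "A = {a, b, e}" "a \<noteq> b" "b \<noteq> e" "a \<noteq> e" by (auto simp: card_3_iff)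
    have "17/24 \<le> x \<bullet> a" "17/24 \<le> x \<bullet> b" "17/24 \<le> x \<bullet> e" "x \<bullet> a \<le> 1" "x \<bullet> b \<le> 1" "x \<bullet> e \<le> 1"
      using gt le1 A by auto
    then have "cap_poly (x \<bullet> a) + cap_poly (x \<bullet> b) + cap_poly (x \<bullet> e) \<le> 580"
      using triple_in_cap[of x a b e] unit ip A x by (intro cap_poly_triple) auto
    then show ?thesis using A by simp
  qed
  then show ?thesis by (simp add: A_def)
qed

theorem kissing_card_le_12:
  assumes "kissing C"
  shows "card C \<le> 12"
proof (rule ccontr)
  assume "\<not> card C \<le> 12"
  then have "13 \<le> card C" by simp
  then obtain S where S: "S \<subseteq> C" "card S = 13" by (rule obtain_subset_with_card_n)
  have kS: "kissing S" and fin: "finite S" using kissing_subset[OF assms S(1)] by (auto simp: kissing_def)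
  have "(\<Sum>y\<in>S. kiss_poly (x \<bullet> y)) < 0" if x: "x \<in> S" for x
  proof -
    have xx: "x \<bullet> x = 1" using kissing_unit[OF kS x] .
    \<comment> \<open>Besides x itself, the points near its antipode are the only ones at which
      \<open>kiss_poly\<close> may exceed -1493/5.\<close>
    define A where "A = {y \<in> S. 17/24 < (- x) \<bullet> y}"
    have A: "A \<subseteq> S - {x}" using xx by (auto simp: A_def)
    have "card (S - {x}) = 12" using fin S(2) x by simp
    then have cards: "real (card A) + real (card (S - {x} - A)) = 12"
      using card_Diff_subset[OF finite_subset[OF A] A] card_mono[OF _ A] fin by simp
    have "(\<Sum>y\<in>S. kiss_poly (x \<bullet> y)) = kiss_poly (x \<bullet> x) + (\<Sum>y\<in>S - {x}. kiss_poly (x \<bullet> y))"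
      using x fin by (simp add: sum.remove)
    also have "kiss_poly (x \<bullet> x) = 3000" by (simp add: xx kiss_poly_eq_horner)
    also have "(\<Sum>y\<in>S - {x}. kiss_poly (x \<bullet> y))
      = (\<Sum>y\<in>S - {x} - A. kiss_poly (x \<bullet> y)) + (\<Sum>y\<in>A. kiss_poly (x \<bullet> y))"
      using fin A by (intro sum.subset_diff) auto
    also have "(\<Sum>y\<in>A. kiss_poly (x \<bullet> y)) = (\<Sum>y\<in>A. cap_poly ((- x) \<bullet> y)) - 1493/5 * card A"
      by (simp add: cap_poly_def sum.distrib)
    also have "(\<Sum>y\<in>S - {x} - A. kiss_poly (x \<bullet> y)) \<le> (\<Sum>y\<in>S - {x} - A. - 1493/5)"
    proof (rule sum_mono)
      fix y assume y: "y \<in> S - {x} - A"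
      then have "x \<bullet> y \<le> 1/2" using kissing_inner_le[OF kS x] by auto
      moreover have "\<not> 17/24 < - (x \<bullet> y)" using y by (simp add: A_def)
      then have "-17/24 \<le> x \<bullet> y" by linarith
      ultimately show "kiss_poly (x \<bullet> y) \<le> - 1493/5" by (intro kiss_poly_le)
    qed
    also have "(\<Sum>y\<in>A. cap_poly ((- x) \<bullet> y)) \<le> 580"
      unfolding A_def using xx by (intro sum_cap_poly_le[OF kS]) simp
    finally show ?thesis using cards by simp
  qed
  moreover have "S \<noteq> {}" using S(2) by auto
  ultimately have "(\<Sum>x\<in>S. \<Sum>y\<in>S. kiss_poly (x \<bullet> y)) < (\<Sum>x\<in>S. 0)"
    using fin by (intro sum_strict_mono)
  moreover have "0 \<le> (\<Sum>x\<in>S. \<Sum>y\<in>S. kiss_poly (x \<bullet> y))"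
    using psd_kernel_kiss_poly kS by (simp add: psd_kernel_def kissing_def)
  ultimately show False by simp
qed

subsection \<open>Unfolding contact triangles\<close>

text \<open>Unit length is part of the notion, so that unfolding triangles needs no ambient
  packing.\<close>

definition contact :: "real^3 \<Rightarrow> real^3 \<Rightarrow> bool" where
  "contact a b \<longleftrightarrow> a \<bullet> a = 1 \<and> b \<bullet> b = 1 \<and> a \<bullet> b = 1/2"

lemma contact_sym: "contact a b \<Longrightarrow> contact b a"
  by (simp add: contact_def inner_commute)

lemma contact_neq: "contact a b \<Longrightarrow> a \<noteq> b"
  by (auto simp: contact_def)

text \<open>The points c and d are mirror images in the plane of a and b, and (a + b)/3 is the
  projection of c to that plane. Formally, \<open>u\<close> is orthogonal to a, b and
  \<open>v\<close>, so these are dependent; but \<open>v\<close> is orthogonal to the independent a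
  and b, hence zero.\<close>

lemma contact_mirror:
  assumes "contact a b" "contact a c" "contact b c" "contact a d" "contact b d" "c \<noteq> d"
  shows "c + d = (2/3) *\<^sub>R (a + b)"
proof -
  define u v where "u = c - d" and "v = c + d - (2/3) *\<^sub>R (a + b)"
  have ip: "a \<bullet> a = 1" "b \<bullet> b = 1" "c \<bullet> c = 1" "d \<bullet> d = 1" "a \<bullet> b = 1/2" "b \<bullet> a = 1/2"
    "a \<bullet> c = 1/2" "b \<bullet> c = 1/2" "a \<bullet> d = 1/2" "b \<bullet> d = 1/2" "c \<bullet> a = 1/2" "c \<bullet> b = 1/2" "d \<bullet> a = 1/2" "d \<bullet> b = 1/2"
    using assms by (simp_all add: contact_def inner_commute)
  have u: "u \<noteq> 0" "u \<bullet> a = 0" "u \<bullet> b = 0" "u \<bullet> v = 0"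
    using assms(6) by (simp_all add: u_def v_def inner_diff_left inner_diff_right inner_add_left inner_add_right ip inner_commute[of c d])
  have v: "v \<bullet> a = 0" "v \<bullet> b = 0"
    by (simp_all add: v_def inner_diff_left inner_add_left ip)
  obtain x y z where rel: "x *\<^sub>R a + y *\<^sub>R b + z *\<^sub>R v = 0" and nz: "x \<noteq> 0 \<or> y \<noteq> 0 \<or> z \<noteq> 0"
    using plane_dependent[OF u] by blast
  have "x + y / 2 = 0" using arg_cong[OF rel, of "\<lambda>w. w \<bullet> a"] by (simp add: inner_add_left ip v)
  moreover have "x / 2 + y = 0" using arg_cong[OF rel, of "\<lambda>w. w \<bullet> b"] by (simp add: inner_add_left ip v)
  ultimately have "x = 0" "y = 0" by linarith+
  then have "z \<noteq> 0" "z *\<^sub>R v = 0" using nz rel by auto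
  then show ?thesis by (simp add: v_def)
qed

definition contact_triangle :: "(real^3) set \<Rightarrow> bool" where
  "contact_triangle T \<longleftrightarrow> card T = 3 \<and> (\<forall>x\<in>T. \<forall>y\<in>T. x \<noteq> y \<longrightarrow> contact x y)"

lemma contact_triangleI: "contact a b \<Longrightarrow> contact a c \<Longrightarrow> contact b c \<Longrightarrow> contact_triangle {a, b, c}"
  unfolding contact_triangle_def using contact_neq contact_sym
  by (auto simp: card_insert_if)

lemma contact_triangle_insertD:
  assumes "contact_triangle {a, b, c}"
  shows "contact a b" "contact a c" "contact b c" "a \<noteq> b" "a \<noteq> c" "b \<noteq> c"
proof -
  have "a \<noteq> b \<and> a \<noteq> c \<and> b \<noteq> c"
    using assms unfolding contact_triangle_def by (auto simp: card_insert_if split: if_splits)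
  then show "contact a b" "contact a c" "contact b c" "a \<noteq> b" "a \<noteq> c" "b \<noteq> c"
    using assms unfolding contact_triangle_def by auto
qed

lemma contact_triangle_adjacent:
  assumes "contact_triangle S" "contact_triangle T" "card (S \<inter> T) = 2"
  obtains p q v w where "S = {v, p, q}" "T = {w, p, q}" "v \<notin> T" "w \<notin> S"
proof -
  have fin: "finite S" "finite T" "card S = 3" "card T = 3"
    using assms by (auto simp: contact_triangle_def intro: card_ge_0_finite)
  obtain p q where pq: "S \<inter> T = {p, q}" using assms(3) by (auto simp: card_2_iff)
  have "card (S - T) = 1" "card (T - S) = 1"
    using fin assms(3) card_Diff_subset_Int[of S T] card_Diff_subset_Int[of T S] by (auto simp: Int_commute)
  then obtain v w where "S - T = {v}" "T - S = {w}" by (auto simp: card_1_singleton_iff)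
  then show ?thesis using that[of v p q w] pq by blast
qed

lemma no_three_contact_triangles_on_edge:
  assumes "contact_triangle {u, p, q}" "contact_triangle {v, p, q}" "contact_triangle {w, p, q}" "u \<noteq> v" "v \<noteq> w"
  shows "u = w"
proof -
  note 1 = contact_triangle_insertD[OF assms(1)] and 2 = contact_triangle_insertD[OF assms(2)]
    and 3 = contact_triangle_insertD[OF assms(3)]
  have "u + v = (2/3) *\<^sub>R (p + q)" using 1 2 assms(4) by (intro contact_mirror) (auto intro: contact_sym)
  moreover have "w + v = (2/3) *\<^sub>R (p + q)" using 3 2 assms(5) by (intro contact_mirror) (auto intro: contact_sym)
  ultimately show ?thesis by (metis add_right_cancel)
qed

section \<open>Denominators of reflected vertices\<close>

definition lattice :: "(real^3) set \<Rightarrow> (real^3) set" where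
  "lattice S = range (\<lambda>k::real^3 \<Rightarrow> int. \<Sum>x\<in>S. of_int (k x) *\<^sub>R x)"

lemma latticeI: "x = (\<Sum>v\<in>S. of_int (k v) *\<^sub>R v) \<Longrightarrow> x \<in> lattice S"
  by (auto simp: lattice_def)

lemma lattice_generator:
  assumes "finite S" "a \<in> S"
  shows "a \<in> lattice S"
proof -
  have "(\<Sum>x\<in>S. of_int (if x = a then 1 else 0) *\<^sub>R x) = (\<Sum>x\<in>S. if x = a then x else 0)"
    by (intro sum.cong) auto
  then show ?thesis using assms by (intro latticeI[where k = "\<lambda>x. if x = a then 1 else 0"]) simp
qed

lemma lattice_add:
  assumes "x \<in> lattice S" "y \<in> lattice S"
  shows "x + y \<in> lattice S"
proof -
  obtain k l where "x = (\<Sum>v\<in>S. of_int (k v) *\<^sub>R v)" "y = (\<Sum>v\<in>S. of_int (l v) *\<^sub>R v)"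
    using assms unfolding lattice_def by blast
  then show ?thesis
    by (intro latticeI[where k = "\<lambda>v. k v + l v"]) (simp add: scaleR_add_left sum.distrib)
qed

lemma lattice_scale:
  assumes "x \<in> lattice S"
  shows "of_int n *\<^sub>R x \<in> lattice S"
proof -
  obtain k where "x = (\<Sum>v\<in>S. of_int (k v) *\<^sub>R v)"
    using assms unfolding lattice_def by blast
  then show ?thesis
    by (intro latticeI[where k = "\<lambda>v. n * k v"]) (simp add: scaleR_sum_right)
qed

lemma lattice_diff:
  assumes "x \<in> lattice S" "y \<in> lattice S"
  shows "x - y \<in> lattice S"
  using lattice_add[OF assms(1) lattice_scale[OF assms(2), of "-1"]] by simp

text \<open>The 3-adic denominator of a vertex grows by one with each reflection, since the reflected vertex is
  \<^term>\<open>(2/3) *\<^sub>R (p + q) - v\<close>.  Therefore unfolding triangles never returns to the start.\<close>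
definition exact_depth :: "(real^3) set \<Rightarrow> nat \<Rightarrow> real^3 \<Rightarrow> bool" where
  "exact_depth L k w \<longleftrightarrow> 3 ^ k *\<^sub>R w \<in> L \<and> 3 ^ k *\<^sub>R w \<notin> (\<lambda>x. 3 *\<^sub>R x) ` L"

text \<open>Here w is the newest vertex, p an older one of the same triangle, and q the vertex that
  is reflected. Modulo 3 times the lattice, only \<open>2 *\<^sub>R (3 ^ k *\<^sub>R w)\<close>
  survives, and 2 is invertible modulo 3.\<close>

lemma exact_depth_reflect:
  assumes "exact_depth (lattice S) k w" "3 ^ k *\<^sub>R p \<in> (\<lambda>x. 3 *\<^sub>R x) ` lattice S"
    "3 ^ k *\<^sub>R q \<in> lattice S" and w': "w' + q = (2/3) *\<^sub>R (w + p)"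
  shows "exact_depth (lattice S) (Suc k) w'"
proof -
  let ?L = "lattice S"
  obtain p' where p': "p' \<in> ?L" "3 ^ k *\<^sub>R p = 3 *\<^sub>R p'" using assms(2) by blast
  have "w' = (2/3) *\<^sub>R (w + p) - q" using w' by (simp add: algebra_simps)
  then have "3 ^ Suc k *\<^sub>R w' = 2 *\<^sub>R (3 ^ k *\<^sub>R w) + 2 *\<^sub>R (3 ^ k *\<^sub>R p) - 3 *\<^sub>R (3 ^ k *\<^sub>R q)"
    by (simp add: scaleR_diff_right scaleR_add_right mult.commute)
  then have eq: "3 ^ Suc k *\<^sub>R w' = 2 *\<^sub>R (3 ^ k *\<^sub>R w) + 3 *\<^sub>R (2 *\<^sub>R p' - 3 ^ k *\<^sub>R q)"
    unfolding p'(2) by (simp add: scaleR_diff_right)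
  have inL: "2 *\<^sub>R p' - 3 ^ k *\<^sub>R q \<in> ?L"
    using lattice_diff[OF lattice_scale[OF p'(1), of 2] assms(3)] by simp
  have wL: "3 ^ k *\<^sub>R w \<in> ?L" using assms(1) by (simp add: exact_depth_def)
  have "3 ^ Suc k *\<^sub>R w' \<in> ?L"
    unfolding eq using lattice_add[OF lattice_scale[OF wL, of 2] lattice_scale[OF inL, of 3]] by simp
  moreover have False if "3 ^ Suc k *\<^sub>R w' = 3 *\<^sub>R x" "x \<in> ?L" for x
  proof -
    \<comment> \<open>Inverts 2 modulo 3, as 1 = 3 - 2.\<close>
    have "3 ^ k *\<^sub>R w = 3 *\<^sub>R (3 ^ k *\<^sub>R w) - 2 *\<^sub>R (3 ^ k *\<^sub>R w)" by (simp flip: scaleR_left_diff_distrib)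
    also have "\<dots> = 3 *\<^sub>R (3 ^ k *\<^sub>R w - (x - (2 *\<^sub>R p' - 3 ^ k *\<^sub>R q)))"
      using eq that(1) by (simp add: algebra_simps)
    finally have "3 ^ k *\<^sub>R w \<in> (\<lambda>x. 3 *\<^sub>R x) ` ?L"
      using lattice_diff[OF wL lattice_diff[OF that(2) inL]] by blast
    then show False using assms(1) by (simp add: exact_depth_def)
  qed
  ultimately show ?thesis by (auto simp: exact_depth_def)
qed

text \<open>At the first reflection all vertices have the same denominator, so
  \<open>exact_depth_reflect\<close> does not apply. Instead 3 w = 2 a + 2 b - 3 c, and by linear
  independence of a, b, c the coefficient 2 decides.\<close>

lemma exact_depth_first_reflect:
  assumes "contact_triangle {a, b, c}" "w + c = (2/3) *\<^sub>R (a + b)"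
  shows "exact_depth (lattice {a, b, c}) 1 w"
proof -
  note ct = contact_triangle_insertD(1-3)[OF assms(1)]
  have "w = (2/3) *\<^sub>R (a + b) - c" using assms(2) by (simp add: algebra_simps)
  then have eq: "3 *\<^sub>R w = of_int 2 *\<^sub>R a + of_int 2 *\<^sub>R b + of_int (- 3) *\<^sub>R c"
    by (simp add: scaleR_diff_right scaleR_add_right)
  have no: False if "3 *\<^sub>R w = 3 *\<^sub>R (of_int i *\<^sub>R a + of_int j *\<^sub>R b + of_int k *\<^sub>R c)" for i j k :: int
  proof -
    define x y z where "x = real_of_int (3 * i) - 2" and "y = real_of_int (3 * j) - 2" and "z = real_of_int (3 * k) + 3"
    have 0: "x *\<^sub>R a + y *\<^sub>R b + z *\<^sub>R c = 0"
      using that unfolding eq x_def y_def z_def by (simp add: algebra_simps)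
    have ip: "a \<bullet> a = 1" "b \<bullet> b = 1" "c \<bullet> c = 1" "a \<bullet> b = 1/2" "b \<bullet> a = 1/2"
      "a \<bullet> c = 1/2" "c \<bullet> a = 1/2" "b \<bullet> c = 1/2" "c \<bullet> b = 1/2"
      using ct by (simp_all add: contact_def inner_commute)
    have "x + y/2 + z/2 = 0" "x/2 + y + z/2 = 0" "x/2 + y/2 + z = 0"
      using arg_cong[OF 0, of "\<lambda>v. v \<bullet> a"] arg_cong[OF 0, of "\<lambda>v. v \<bullet> b"] arg_cong[OF 0, of "\<lambda>v. v \<bullet> c"]
      by (simp_all add: inner_add_left ip)
    then have "x = 0" by linarith
    then have "real_of_int (3 * i) = real_of_int 2" by (simp add: x_def)
    then show False unfolding of_int_eq_iff by presburger
  qed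
  have sum: "(\<Sum>v\<in>{a, b, c}. of_int (k v) *\<^sub>R v) = of_int (k a) *\<^sub>R a + of_int (k b) *\<^sub>R b + of_int (k c) *\<^sub>R c"
    for k :: "real^3 \<Rightarrow> int"
    using contact_triangle_insertD(4-6)[OF assms(1)] by (simp add: add.assoc)
  have gen: "a \<in> lattice {a, b, c}" "b \<in> lattice {a, b, c}" "c \<in> lattice {a, b, c}"
    by (simp_all add: lattice_generator)
  have "3 *\<^sub>R w \<in> lattice {a, b, c}" unfolding eq by (intro lattice_add lattice_scale gen)
  moreover have "3 *\<^sub>R w \<notin> (\<lambda>x. 3 *\<^sub>R x) ` lattice {a, b, c}"
    unfolding lattice_def image_image sum using no by blast
  ultimately show ?thesis by (simp add: exact_depth_def)
qed

definition adjacent :: "'a set \<Rightarrow> 'a set \<Rightarrow> bool" where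
  "adjacent S T \<longleftrightarrow> card (S \<inter> T) = 2"

lemma adjacent_sym: "adjacent S T \<Longrightarrow> adjacent T S"
  by (simp add: adjacent_def Int_commute)

definition gallery :: "(real^3) set list \<Rightarrow> bool" where
  "gallery Ts \<longleftrightarrow> Ts \<noteq> [] \<and> distinct Ts \<and> (\<forall>T\<in>set Ts. contact_triangle T) \<and> successively adjacent Ts"

lemma contact_triangle_adjacent_at:
  assumes "contact_triangle S" "contact_triangle T" "adjacent S T" "w \<in> S" "w \<in> T"
  obtains x y z where "S = {y, w, x}" "T = {z, w, x}" "y \<notin> T" "z \<notin> S"
proof -
  obtain p q v z where pq: "S = {v, p, q}" "T = {z, p, q}" "v \<notin> T" "z \<notin> S"
    using contact_triangle_adjacent assms(1-3) unfolding adjacent_def by metis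
  then have "w = p \<or> w = q" using assms(4,5) by auto
  then show ?thesis using that[of v q z] that[of v p z] pq by (auto simp: insert_commute)
qed

text \<open>Otherwise T would contain the common edge of R and S, and three contact triangles would
  share it. So every step keeps the newest vertex, the one with the largest denominator.\<close>

lemma gallery_turns:
  assumes "contact_triangle R" "contact_triangle S" "contact_triangle T" "adjacent R S" "adjacent S T" "R \<noteq> T"
    and w: "w \<in> S" "w \<notin> R"
  shows "w \<in> T"
proof (rule ccontr)
  assume nT: "w \<notin> T"
  obtain p q u v where pq: "R = {u, p, q}" "S = {v, p, q}" "u \<notin> S" "v \<notin> R"
    using contact_triangle_adjacent assms(1,2,4) unfolding adjacent_def by metis
  obtain p' q' u' v' where pq': "S = {u', p', q'}" "T = {v', p', q'}" "u' \<notin> T" "v' \<notin> S"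
    using contact_triangle_adjacent assms(2,3,5) unfolding adjacent_def by metis
  have "w = v" "w = u'" using w nT pq pq' by auto
  moreover have "v \<notin> {p, q}" "u' \<notin> {p', q'}" using pq pq' by auto
  ultimately have "{p, q} = {p', q'}" using pq(2) pq'(1) by (metis insert_ident)
  then have "T = {v', p, q}" using pq'(2) by simp
  moreover have "v \<noteq> u" "v \<noteq> v'" using pq pq' by auto
  ultimately have "u = v'" using no_three_contact_triangles_on_edge assms(1-3) pq by metis
  then show False using \<open>T = {v', p, q}\<close> pq(1) assms(6) by simp
qed

text \<open>The list exposes its last two triangles because the invariant is about one step: the
  vertex just gained has depth equal to the number of steps, and the other two have smaller
  depth.\<close>

lemma gallery_exact_depth:
  assumes "gallery (Us @ [R, T])" "S = hd (Us @ [R])"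
  shows "\<exists>w. w \<in> T \<and> w \<notin> R \<and> exact_depth (lattice S) (Suc (length Us)) w \<and>
    (\<forall>p\<in>T - {w}. 3 ^ length Us *\<^sub>R p \<in> lattice S)"
  using assms
proof (induction Us arbitrary: R T rule: rev_induct)
  case Nil
  then have RT: "contact_triangle R" "contact_triangle T" "adjacent R T" "R = S"
    by (auto simp: gallery_def)
  then obtain p q v w where pq: "R = {v, p, q}" "T = {w, p, q}" "v \<notin> T" "w \<notin> R"
    using contact_triangle_adjacent unfolding adjacent_def by metis
  note 1 = contact_triangle_insertD[OF RT(1)[unfolded pq(1)]] and 2 = contact_triangle_insertD[OF RT(2)[unfolded pq(2)]]
  have "w + v = (2/3) *\<^sub>R (p + q)"
    using 1 2 pq by (intro contact_mirror) (auto intro: contact_sym)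
  moreover have "R = {p, q, v}" using pq by auto
  ultimately have "exact_depth (lattice {p, q, v}) 1 w"
    using exact_depth_first_reflect RT(1) by blast
  moreover have "S = {p, q, v}" using RT(4) \<open>R = {p, q, v}\<close> by simp
  moreover have "\<forall>x\<in>T - {w}. x \<in> lattice S"
    using pq RT(4) by (auto intro: lattice_generator)
  ultimately show ?case using pq by auto
next
  case (snoc Q Us)
  let ?L = "lattice S" and ?n = "length Us"
  have ct: "contact_triangle Q" "contact_triangle R" "contact_triangle T" "adjacent Q R" "adjacent R T" "Q \<noteq> T"
    and g: "gallery (Us @ [Q, R])"
    using snoc.prems(1) by (auto simp: gallery_def successively_append_iff)
  have "S = hd (Us @ [Q])" using snoc.prems(2) by (simp add: hd_append split: if_splits)
  with snoc.IH[OF g] obtain w where w: "w \<in> R" "w \<notin> Q" "exact_depth ?L (Suc ?n) w"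
    "\<forall>p\<in>R - {w}. 3 ^ ?n *\<^sub>R p \<in> ?L" by blast
  have "w \<in> T" using gallery_turns[OF ct] w by blast
  then obtain x y z where RT: "R = {y, w, x}" "T = {z, w, x}" "y \<notin> T" "z \<notin> R"
    using contact_triangle_adjacent_at ct(2,3,5) w(1) by metis
  note 1 = contact_triangle_insertD[OF ct(2)[unfolded RT(1)]] and 2 = contact_triangle_insertD[OF ct(3)[unfolded RT(2)]]
  have refl: "z + y = (2/3) *\<^sub>R (w + x)"
    using 1 2 RT by (intro contact_mirror) (auto intro: contact_sym)
  have xy: "3 ^ ?n *\<^sub>R x \<in> ?L" "3 ^ ?n *\<^sub>R y \<in> ?L" using w(4) RT 1 by auto
  have up: "3 ^ Suc ?n *\<^sub>R v = 3 *\<^sub>R (3 ^ ?n *\<^sub>R v)" for v :: "real^3" by simp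
  have L3: "3 *\<^sub>R v \<in> ?L" if "v \<in> ?L" for v using lattice_scale[OF that, of 3] by simp
  have "3 ^ Suc ?n *\<^sub>R x \<in> ?L" "3 ^ Suc ?n *\<^sub>R y \<in> ?L"
    unfolding up using xy by (auto intro: L3 simp del: scaleR_scaleR)
  moreover have "3 ^ Suc ?n *\<^sub>R x \<in> (\<lambda>x. 3 *\<^sub>R x) ` ?L" unfolding up using xy by blast
  ultimately have "exact_depth ?L (Suc (Suc ?n)) z" using exact_depth_reflect[OF w(3) _ _ refl] by blast
  moreover have "3 ^ Suc ?n *\<^sub>R w \<in> ?L" using w(3) by (simp add: exact_depth_def)
  ultimately show ?case using RT \<open>3 ^ Suc ?n *\<^sub>R x \<in> ?L\<close> by (intro exI[of _ z]) auto
qed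

text \<open>Vertices of S lie in its lattice, hence differ from the newest vertex of T, and all
  other vertices of T belong to the preceding triangle.\<close>

lemma gallery_leaves_start:
  assumes "gallery (S # Ts @ [T])"
  shows "T \<inter> S \<subseteq> last (S # Ts)"
proof
  fix v assume v: "v \<in> T \<inter> S"
  define Us R where "Us = butlast (S # Ts)" and "R = last (S # Ts)"
  have eq: "S # Ts = Us @ [R]" by (simp add: Us_def R_def)
  then have g: "gallery (Us @ [R, T])" using assms by (metis append.assoc append_Cons append_Nil)
  have "contact_triangle S" using assms by (simp add: gallery_def)
  then have "finite S" by (auto simp: contact_triangle_def intro: card_ge_0_finite)
  have "S = hd (Us @ [R])" by (metis eq list.sel(1))
  from gallery_exact_depth[OF g this] obtain w where w: "w \<in> T" "w \<notin> R" "exact_depth (lattice S) (Suc (length Us)) w"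
    by blast
  have "v \<in> lattice S" using v \<open>finite S\<close> lattice_generator by auto
  then have "3 ^ length Us *\<^sub>R v \<in> lattice S" using lattice_scale[of v S "3 ^ length Us"] by simp
  moreover have "3 ^ Suc (length Us) *\<^sub>R v = 3 *\<^sub>R (3 ^ length Us *\<^sub>R v)" by simp
  ultimately have "3 ^ Suc (length Us) *\<^sub>R v \<in> (\<lambda>x. 3 *\<^sub>R x) ` lattice S" by blast
  then have "v \<noteq> w" using w(3) unfolding exact_depth_def by blast
  have "contact_triangle R" "contact_triangle T" "adjacent R T"
    using g by (auto simp: gallery_def successively_append_iff)
  then obtain p q x y where pq: "R = {x, p, q}" "T = {y, p, q}" "x \<notin> T" "y \<notin> R"
    using contact_triangle_adjacent unfolding adjacent_def by metis
  then have "w = y" using w by auto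
  then have "v \<in> R" using v \<open>v \<noteq> w\<close> pq by auto
  then show "v \<in> last (S # Ts)" by (simp add: R_def)
qed

section \<open>Vertices and edges of edge-connected families\<close>

definition pairs_of :: "'a set set \<Rightarrow> 'a set set" where
  "pairs_of F = {e. card e = 2 \<and> (\<exists>T\<in>F. e \<subseteq> T)}"

text \<open>Edge-connectedness in the form of a construction sequence, so that vertices and edges
  can be counted by induction.\<close>

inductive grown :: "(real^3) set set \<Rightarrow> (real^3) set set \<Rightarrow> bool" for F where
  start: "T \<in> F \<Longrightarrow> grown F {T}"
| grow: "grown F K \<Longrightarrow> S \<in> K \<Longrightarrow> T \<in> F \<Longrightarrow> T \<notin> K \<Longrightarrow> adjacent S T \<Longrightarrow> grown F (insert T K)"

lemma grown_subset: "grown F K \<Longrightarrow> K \<subseteq> F \<and> K \<noteq> {} \<and> finite K"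
  by (induction rule: grown.induct) auto

text \<open>The inclusion \<open>set Ts \<subseteq> K\<close> separates a newly attached triangle
  from the earlier ones and thus keeps galleries free of repetition.\<close>

lemma grown_gallery:
  assumes "grown F K" "\<forall>T\<in>F. contact_triangle T" "S \<in> K" "T \<in> K"
  shows "\<exists>Ts. gallery Ts \<and> hd Ts = S \<and> last Ts = T \<and> set Ts \<subseteq> K"
  using assms
proof (induction arbitrary: S T rule: grown.induct)
  case (start T0)
  then show ?case by (intro exI[of _ "[T0]"]) (auto simp: gallery_def)
next
  case (grow K S0 T0)
  have ct: "contact_triangle T0" using grow by simp
  have old: "\<exists>Ts. gallery Ts \<and> hd Ts = S \<and> last Ts = T \<and> set Ts \<subseteq> K" if "S \<in> K" "T \<in> K" for S T
    using grow.IH that grow.prems by blast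
  consider "S \<in> K" "T \<in> K" | "S \<in> K" "T = T0" | "S = T0" "T \<in> K" | "S = T0" "T = T0"
    using grow.prems by blast
  then show ?case
  proof cases
    case 1 then show ?thesis using old by blast
  next
    case 2
    obtain Ts where Ts: "gallery Ts" "hd Ts = S" "last Ts = S0" "set Ts \<subseteq> K" using old 2 grow.hyps(2) by blast
    then have "gallery (Ts @ [T0])"
      using ct grow.hyps by (auto simp: gallery_def successively_append_iff)
    then show ?thesis using Ts 2 by (intro exI[of _ "Ts @ [T0]"]) (auto simp: gallery_def)
  next
    case 3
    obtain Ts where Ts: "gallery Ts" "hd Ts = S0" "last Ts = T" "set Ts \<subseteq> K" using old 3 grow.hyps(2) by blast
    then have "gallery (T0 # Ts)"
      using ct grow.hyps adjacent_sym by (cases Ts) (auto simp: gallery_def)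
    then show ?thesis using Ts 3 by (intro exI[of _ "T0 # Ts"]) (auto simp: gallery_def)
  next
    case 4
    then show ?thesis using ct by (intro exI[of _ "[T0]"]) (auto simp: gallery_def)
  qed
qed

lemma grown_counts:
  assumes "grown F K" "\<forall>T\<in>F. contact_triangle T"
  shows "finite (\<Union>K) \<and> card (\<Union>K) = card K + 2 \<and> finite (pairs_of K) \<and> card (pairs_of K) = 2 * card K + 1"
  using assms
proof (induction rule: grown.induct)
  case (start T)
  then have T: "card T = 3" by (simp add: contact_triangle_def)
  then have "finite T" by (auto intro: card_ge_0_finite)
  moreover have "pairs_of {T} = {e. e \<subseteq> T \<and> card e = 2}" by (auto simp: pairs_of_def)
  moreover have "card {e. e \<subseteq> T \<and> card e = 2} = 3 choose 2"
    using n_subsets[OF \<open>finite T\<close>, of 2] T by simp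
  ultimately show ?case using T by (simp add: choose_two)
next
  case (grow K S T)
  note IH = grow.IH[OF grow.prems]
  have ct: "contact_triangle S" "contact_triangle T"
    using grow grown_subset by blast+
  obtain p q v w where pq: "S = {v, p, q}" "T = {w, p, q}" "v \<notin> T" "w \<notin> S"
    using contact_triangle_adjacent ct grow.hyps(5) unfolding adjacent_def by metis
  note tri = contact_triangle_insertD(4-6)[OF ct(2)[unfolded pq(2)]]
  \<comment> \<open>Continue a gallery from R to S by T. Then T meets R only inside S, which does
    not contain w. So T adds exactly one vertex and two edges.\<close>
  have new: "w \<notin> R" if R: "R \<in> K" for R
  proof
    assume "w \<in> R"
    obtain Ts where Ts: "gallery Ts" "hd Ts = R" "last Ts = S" "set Ts \<subseteq> K"
      using grown_gallery[OF grow.hyps(1) grow.prems R grow.hyps(2)] by blast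
    have "gallery (Ts @ [T])"
      using Ts ct grow.hyps by (auto simp: gallery_def successively_append_iff)
    moreover obtain Ts' where "Ts = R # Ts'" using Ts(1,2) by (cases Ts) (auto simp: gallery_def)
    ultimately have "T \<inter> R \<subseteq> S" using gallery_leaves_start[of R Ts' T] Ts(3) by simp
    then show False using \<open>w \<in> R\<close> pq by auto
  qed
  have fin: "finite K" using grow.hyps(1) grown_subset by blast
  have "\<Union>(insert T K) = insert w (\<Union>K)" using pq grow.hyps(2) by auto
  moreover have "w \<notin> \<Union>K" using new by blast
  ultimately have V: "finite (\<Union>(insert T K))" "card (\<Union>(insert T K)) = card (insert T K) + 2"
    using IH fin grow.hyps(4) by auto
  have "pairs_of (insert T K) = {{w, p}, {w, q}} \<union> pairs_of K"
  proof
    show "pairs_of (insert T K) \<subseteq> {{w, p}, {w, q}} \<union> pairs_of K"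
    proof
      fix e assume "e \<in> pairs_of (insert T K)"
      then have e: "card e = 2" "e \<subseteq> T \<or> e \<in> pairs_of K" by (auto simp: pairs_of_def)
      show "e \<in> {{w, p}, {w, q}} \<union> pairs_of K"
      proof (cases "e \<in> pairs_of K")
        case False
        then have "e \<subseteq> {w, p, q}" using e pq by simp
        then have "e \<in> {{w, p}, {w, q}, {p, q}}" using e(1) by (auto simp: card_2_iff doubleton_eq_iff)
        moreover have "{p, q} \<in> pairs_of K"
          using tri grow.hyps(2) pq(1) by (auto simp: pairs_of_def intro!: bexI[of _ S])
        ultimately show ?thesis by blast
      qed blast
    qed
    show "{{w, p}, {w, q}} \<union> pairs_of K \<subseteq> pairs_of (insert T K)"
      using tri pq(2) by (auto simp: pairs_of_def)
  qed
  moreover have "{w, p} \<notin> pairs_of K" "{w, q} \<notin> pairs_of K" using new by (auto simp: pairs_of_def)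
  moreover have "{w, p} \<noteq> {w, q}" using tri by (auto simp: doubleton_eq_iff)
  ultimately have "finite (pairs_of (insert T K))" "card (pairs_of (insert T K)) = 2 * card (insert T K) + 1"
    using IH fin grow.hyps(4) by auto
  then show ?case using V by blast
qed

lemma maximal_grown:
  assumes "finite F" "F \<noteq> {}"
  obtains K where "grown F K" "\<And>S T. S \<in> K \<Longrightarrow> T \<in> F - K \<Longrightarrow> \<not> adjacent S T"
proof -
  obtain T where "T \<in> F" using assms by blast
  then have "grown F {T}" by (rule grown.start)
  moreover have "\<forall>K. grown F K \<longrightarrow> card K \<le> card F" using grown_subset card_mono[OF assms(1)] by blast
  ultimately obtain K where K: "grown F K" "\<And>L. grown F L \<Longrightarrow> card L \<le> card K"
    using ex_has_greatest_nat[of "grown F" "{T}" card "Suc (card F)"] by (auto simp: less_Suc_eq_le)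
  have "\<not> adjacent S T" if "S \<in> K" "T \<in> F - K" for S T
  proof
    assume "adjacent S T"
    then have "grown F (insert T K)" using grown.grow K(1) that by blast
    then have "card (insert T K) \<le> card K" by (rule K(2))
    then show False using that grown_subset[OF K(1)] by simp
  qed
  then show ?thesis using that K(1) by blast
qed

text \<open>Distinct triangles with a common pair are adjacent, so no pair is shared across the
  separation.\<close>

lemma pairs_of_split:
  assumes F: "finite F" "\<forall>T\<in>F. contact_triangle T" and K: "K \<subseteq> F"
    and sep: "\<And>S T. S \<in> K \<Longrightarrow> T \<in> F - K \<Longrightarrow> \<not> adjacent S T"
  shows "pairs_of F = pairs_of K \<union> pairs_of (F - K)" "pairs_of K \<inter> pairs_of (F - K) = {}"
proof -
  show "pairs_of F = pairs_of K \<union> pairs_of (F - K)" using K by (auto simp: pairs_of_def)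
  show "pairs_of K \<inter> pairs_of (F - K) = {}"
  proof (rule ccontr)
    assume "pairs_of K \<inter> pairs_of (F - K) \<noteq> {}"
    then obtain e S T where e: "card e = 2" "S \<in> K" "T \<in> F - K" "e \<subseteq> S" "e \<subseteq> T" by (auto simp: pairs_of_def)
    have "contact_triangle S" "contact_triangle T" using e K F(2) by blast+
    then have S: "card S = 3" "finite S" and T: "card T = 3" "finite T"
      by (auto simp: contact_triangle_def intro: card_ge_0_finite)
    have "2 \<le> card (S \<inter> T)" using e card_mono[of "S \<inter> T" e] S by auto
    moreover have "S \<inter> T \<subset> S" using e S T by (metis DiffD2 Int_lower1 Int_lower2 card_subset_eq psubsetI)
    then have "card (S \<inter> T) < 3" using psubset_card_mono[of S "S \<inter> T"] S by simp
    ultimately have "adjacent S T" by (simp add: adjacent_def)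
    then show False using sep e by blast
  qed
qed

lemma finite_pairs_of:
  assumes "finite F" "\<forall>T\<in>F. contact_triangle T"
  shows "finite (pairs_of F)"
proof -
  have "finite T" if "T \<in> F" for T
    using assms(2) that by (auto simp: contact_triangle_def intro: card_ge_0_finite)
  then have "finite (\<Union>F)" using assms(1) by blast
  moreover have "pairs_of F \<subseteq> Pow (\<Union>F)" by (auto simp: pairs_of_def)
  ultimately show ?thesis by (meson finite_Pow_iff finite_subset)
qed

text \<open>Components are peeled off one at a time; each of t triangles has 2 t + 1 pairs of its
  own.\<close>

theorem card_pairs_of_ge:
  assumes "finite F" "\<forall>T\<in>F. contact_triangle T" "F \<noteq> {}"
  shows "2 * card F + 1 \<le> card (pairs_of F)"
  using assms
proof (induction "card F" arbitrary: F rule: less_induct)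
  case less
  obtain K where K: "grown F K" "\<And>S T. S \<in> K \<Longrightarrow> T \<in> F - K \<Longrightarrow> \<not> adjacent S T"
    using maximal_grown less.prems(1,3) by metis
  note sub = grown_subset[OF K(1)] and cnt = grown_counts[OF K(1) less.prems(2)]
  show ?case
  proof (cases "K = F")
    case True then show ?thesis using cnt by simp
  next
    case False
    have "card (F - K) < card F" using sub less.prems(1) by (intro psubset_card_mono) auto
    then have "2 * card (F - K) + 1 \<le> card (pairs_of (F - K))"
      using less.hyps[of "F - K"] less.prems False sub by auto
    moreover have "card (pairs_of F) = card (pairs_of K) + card (pairs_of (F - K))"
      using pairs_of_split[OF less.prems(1,2) _ K(2)] sub cnt finite_pairs_of[of "F - K"] less.prems
      by (metis DiffD1 card_Un_disjoint finite_Diff)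
    moreover have "card F = card K + card (F - K)" using sub less.prems(1)
      by (metis card_Diff_subset card_mono le_add_diff_inverse)
    ultimately show ?thesis using cnt by simp
  qed
qed

text \<open>A single component would need \<open>card F + 2\<close> vertices. So there are at least
  two, and each contributes an additional 1.\<close>

theorem card_pairs_of_ge':
  assumes "finite F" "\<forall>T\<in>F. contact_triangle T" "F \<noteq> {}" and few: "card (\<Union>F) < card F + 2"
  shows "2 * card F + 2 \<le> card (pairs_of F)"
proof -
  obtain K where K: "grown F K" "\<And>S T. S \<in> K \<Longrightarrow> T \<in> F - K \<Longrightarrow> \<not> adjacent S T"
    using maximal_grown assms(1,3) by metis
  note sub = grown_subset[OF K(1)] and cnt = grown_counts[OF K(1) assms(2)]
  have "F - K \<noteq> {}" using few cnt sub by auto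
  then have "2 * card (F - K) + 1 \<le> card (pairs_of (F - K))"
    using card_pairs_of_ge[of "F - K"] assms by auto
  moreover have "card (pairs_of F) = card (pairs_of K) + card (pairs_of (F - K))"
    using pairs_of_split[OF assms(1,2) _ K(2)] sub cnt finite_pairs_of[of "F - K"] assms
    by (metis DiffD1 card_Un_disjoint finite_Diff)
  moreover have "card F = card K + card (F - K)" using sub assms(1)
    by (metis card_Diff_subset card_mono le_add_diff_inverse)
  ultimately show ?thesis using cnt by simp
qed

subsection \<open>A perturbed Delaunay triangulation\<close>

text \<open>Moving h in the direction l changes the value of l at the positive rate
  \<open>B l\<close>, while the other functionals are nonzero already. Each value is thus a nonzero
  affine function of t, and all but finitely many small t > 0 work.\<close>

lemma perturb_avoiding_hyperplanes:
  fixes L :: "('a \<Rightarrow> real) set"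
  assumes "finite L" "finite C" "\<And>l. l \<in> L \<Longrightarrow> \<exists>x\<in>C. l x \<noteq> 0" "0 < e"
  shows "\<exists>h. (\<forall>x\<in>C. \<bar>h x - 1\<bar> < e) \<and> (\<forall>l\<in>L. (\<Sum>x\<in>C. l x * h x) \<noteq> 0)"
  using assms(1,3)
proof (induction L rule: finite_induct)
  case empty
  then show ?case using assms(4) by (intro exI[of _ "\<lambda>_. 1"]) auto
next
  case (insert l L)
  then obtain h where h: "\<forall>x\<in>C. \<bar>h x - 1\<bar> < e" "\<forall>l\<in>L. (\<Sum>x\<in>C. l x * h x) \<noteq> 0" by auto
  define A where "A m = (\<Sum>x\<in>C. m x * h x)" for m
  define B where "B m = (\<Sum>x\<in>C. m x * l x)" for m
  obtain x0 where "x0 \<in> C" "l x0 \<noteq> 0" using insert.prems by blast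
  then have "0 < B l" unfolding B_def using assms(2) by (intro sum_pos2[of C x0]) (auto simp: zero_less_mult_iff)
  then have nz: "A m \<noteq> 0 \<or> B m \<noteq> 0" if "m \<in> insert l L" for m using that h(2) by (auto simp: A_def)
  have "finite {t. A m + t * B m = 0}" if "m \<in> insert l L" for m
  proof (cases "B m = 0")
    case True then show ?thesis using nz[OF that] by simp
  next
    case False
    then have "{t. A m + t * B m = 0} \<subseteq> {- A m / B m}" by (auto simp: field_simps)
    then show ?thesis by (rule finite_subset) simp
  qed
  then have fin: "finite (\<Union>m\<in>insert l L. {t. A m + t * B m = 0})" using insert.hyps(1) by blast
  have "\<forall>\<^sub>F t in at_right (0::real). \<forall>x\<in>C. \<bar>h x + t * l x - 1\<bar> < e"
  proof (rule eventually_ball_finite[OF assms(2)], rule ballI)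
    fix x assume "x \<in> C"
    have "((\<lambda>t. \<bar>h x + t * l x - 1\<bar>) \<longlongrightarrow> \<bar>h x + 0 * l x - 1\<bar>) (at_right 0)" by (intro tendsto_intros)
    then show "\<forall>\<^sub>F t in at_right 0. \<bar>h x + t * l x - 1\<bar> < e"
      using h(1) \<open>x \<in> C\<close> by (intro order_tendstoD(2)) auto
  qed
  then obtain d where d: "0 < d" "\<And>t. 0 < t \<Longrightarrow> t < d \<Longrightarrow> \<forall>x\<in>C. \<bar>h x + t * l x - 1\<bar> < e"
    unfolding eventually_at_right_field by auto
  have "infinite ({0<..<d} - (\<Union>m\<in>insert l L. {t. A m + t * B m = 0}))"
    using fin d(1) by (intro Diff_infinite_finite) auto
  then obtain t where t: "t \<in> {0<..<d}" "t \<notin> (\<Union>m\<in>insert l L. {t. A m + t * B m = 0})"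
    using infinite_imp_nonempty by blast
  have "(\<Sum>x\<in>C. m x * (h x + t * l x)) = A m + t * B m" for m
    by (simp add: A_def B_def algebra_simps sum.distrib sum_distrib_left)
  then show ?case using t d(2)[of t] by (intro exI[of _ "\<lambda>x. h x + t * l x"]) auto
qed

text \<open>If n \<bullet> x = h x on a set, every linear dependence of that set is inherited by its
  heights. So h only has to avoid one hyperplane for each dependent subset of C.\<close>

lemma generic_heights:
  fixes C :: "(real^3) set"
  assumes "finite C" "0 < e"
  obtains h where "\<And>x. x \<in> C \<Longrightarrow> \<bar>h x - 1\<bar> < e" "\<And>n. independent {x \<in> C. n \<bullet> x = h x}"
proof -
  define D where "D = {S. S \<subseteq> C \<and> dependent S}"
  have "\<forall>S\<in>D. \<exists>l. (\<exists>x\<in>S. l x \<noteq> 0) \<and> (\<Sum>x\<in>S. l x *\<^sub>R x) = 0"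
  proof
    fix S assume "S \<in> D"
    then have "dependent S" "finite S" using assms(1) by (auto simp: D_def intro: finite_subset)
    then show "\<exists>l. (\<exists>x\<in>S. l x \<noteq> 0) \<and> (\<Sum>x\<in>S. l x *\<^sub>R x) = 0" by (simp add: dependent_finite)
  qed
  then obtain l where "\<forall>S\<in>D. (\<exists>x\<in>S. l S x \<noteq> 0) \<and> (\<Sum>x\<in>S. l S x *\<^sub>R x) = 0"
    by (rule bchoice[THEN exE])
  then have l: "\<And>S. S \<in> D \<Longrightarrow> \<exists>x\<in>S. l S x \<noteq> 0" "\<And>S. S \<in> D \<Longrightarrow> (\<Sum>x\<in>S. l S x *\<^sub>R x) = 0"
    by blast+
  define l' where "l' S x = (if x \<in> S then l S x else 0)" for S x
  have "finite D" unfolding D_def using assms(1) by auto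
  moreover have "\<exists>x\<in>C. m x \<noteq> 0" if m: "m \<in> l' ` D" for m
  proof -
    obtain S where S: "S \<in> D" "m = l' S" using m by blast
    then obtain x where "x \<in> S" "l S x \<noteq> 0" using l(1) by blast
    then show ?thesis using S by (intro bexI[of _ x]) (auto simp: l'_def D_def)
  qed
  ultimately obtain h where h: "\<forall>x\<in>C. \<bar>h x - 1\<bar> < e" "\<forall>m\<in>l' ` D. (\<Sum>x\<in>C. m x * h x) \<noteq> 0"
    using perturb_avoiding_hyperplanes[of "l' ` D" C e] assms by auto
  have "independent {x \<in> C. n \<bullet> x = h x}" (is "independent ?S") for n
  proof
    assume "dependent ?S"
    then have S: "?S \<in> D" by (simp add: D_def)
    have "(\<Sum>x\<in>C. l' ?S x * h x) = (\<Sum>x\<in>?S. l ?S x * h x)"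
      using assms(1) by (intro sum.mono_neutral_cong_right) (auto simp: l'_def)
    also have "\<dots> = (\<Sum>x\<in>?S. n \<bullet> (l ?S x *\<^sub>R x))" by (intro sum.cong) auto
    also have "\<dots> = n \<bullet> (\<Sum>x\<in>?S. l ?S x *\<^sub>R x)" by (simp add: inner_sum_right)
    also have "\<dots> = 0" using l(2)[OF S] by simp
    finally show False using h(2) S by blast
  qed
  then show ?thesis using that h(1) by blast
qed

lemma avoid_hyperplanes:
  fixes D :: "(real^3) set"
  assumes "finite D" "0 \<notin> D"
  obtains g where "\<And>d. d \<in> D \<Longrightarrow> g \<bullet> d \<noteq> 0"
proof -
  have "negligible (\<Union>d\<in>D. {x. d \<bullet> x = 0})"
    using assms by (intro negligible_Union finite_imageI) (auto intro!: negligible_hyperplane)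
  then have "(\<Union>d\<in>D. {x. d \<bullet> x = 0}) \<noteq> UNIV" using non_negligible_UNIV by force
  then obtain g where "g \<notin> (\<Union>d\<in>D. {x. d \<bullet> x = 0})" by blast
  then show ?thesis using that[of g] by (auto simp: inner_commute)
qed

text \<open>The facets are those of the hull of the points \<^term>\<open>x /\<^sub>R h x\<close>.  Heights in general position make them
  triangles, and heights close to 1 keep the contact triangles among them.\<close>
locale delaunay =
  fixes C :: "(real^3) set" and h :: "real^3 \<Rightarrow> real"
  assumes kissing: "kissing C"
    and spanning: "\<And>p. p \<noteq> 0 \<Longrightarrow> \<exists>x\<in>C. 0 < x \<bullet> p"
    and heights: "\<And>x. x \<in> C \<Longrightarrow> \<bar>h x - 1\<bar> < 1/20"
    and generic: "\<And>n. independent {x \<in> C. n \<bullet> x = h x}"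
begin

definition tight :: "real^3 \<Rightarrow> (real^3) set" where
  "tight n = {x \<in> C. n \<bullet> x = h x}"

text \<open>The feasible n form the polar body of the hull of the points x / h x: the hull lies in
  the half space n \<bullet> y \<le> 1, and \<open>tight n\<close> collects the centers whose points
  lie on its boundary plane.\<close>

definition feasible :: "real^3 \<Rightarrow> bool" where
  "feasible n \<longleftrightarrow> (\<forall>x\<in>C. n \<bullet> x \<le> h x)"

definition facets :: "(real^3) set set" where
  "facets = {tight n | n. feasible n \<and> card (tight n) = 3}"

lemma finite_C: "finite C" using kissing by (simp add: kissing_def)

lemma height_bounds:
  assumes "x \<in> C"
  shows "19/20 < h x" "h x < 21/20"
  using heights[OF assms] by linarith+

lemma facets_subset: "F \<in> facets \<Longrightarrow> F \<subseteq> C"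
  by (auto simp: facets_def tight_def)

lemma facets_card: "F \<in> facets \<Longrightarrow> card F = 3"
  by (auto simp: facets_def)

lemma finite_facets: "finite facets"
proof (rule finite_subset)
  show "facets \<subseteq> Pow C" using facets_subset by blast
  show "finite (Pow C)" using finite_C by simp
qed

lemma finite_tight: "finite (tight n)"
  using finite_C by (simp add: tight_def)

lemma card_tight_le: "card (tight n) \<le> 3"
  using independent_bound[OF generic[of n]] by (simp add: tight_def)

lemma facetI:
  assumes "feasible n" "{a, b, c} \<subseteq> tight n" "card {a, b, c} = 3"
  shows "{a, b, c} \<in> facets" "tight n = {a, b, c}"
proof -
  show "tight n = {a, b, c}"
    using assms card_tight_le[of n] card_seteq[OF finite_tight, of "{a, b, c}" n] by simp
  then show "{a, b, c} \<in> facets" using assms by (auto simp: facets_def)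
qed

lemma facet_off_plane:
  assumes "{a, b, c} \<subseteq> tight n" "card {a, b, c} = 3" "w \<noteq> 0" "w \<bullet> a = 0" "w \<bullet> b = 0"
  shows "w \<bullet> c \<noteq> 0"
proof
  assume "w \<bullet> c = 0"
  then obtain x y z where rel: "x *\<^sub>R a + y *\<^sub>R b + z *\<^sub>R c = 0" "x \<noteq> 0 \<or> y \<noteq> 0 \<or> z \<noteq> 0"
    using plane_dependent[OF assms(3-5)] by blast
  have ne: "a \<noteq> b" "a \<noteq> c" "b \<noteq> c" using assms(2) by (auto simp: card_insert_if split: if_splits)
  define k where "k v = (if v = a then x else if v = b then y else z)" for v
  have "(\<Sum>v\<in>{a, b, c}. k v *\<^sub>R v) = 0" using rel(1) ne by (simp add: k_def add.assoc)
  moreover have "\<exists>v\<in>{a, b, c}. k v \<noteq> 0" using rel(2) ne by (auto simp: k_def)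
  ultimately have "dependent {a, b, c}" using dependent_finite[of "{a, b, c}"] by auto
  then show False using generic[of n] assms(1) dependent_mono unfolding tight_def by blast
qed

text \<open>A pivot step: n moves along w until the first constraint with
  \<open>0 < w \<bullet> x\<close> becomes tight. Such a constraint exists by
  \<open>spanning\<close>, and tight points orthogonal to w stay tight.\<close>

lemma ray:
  assumes n: "feasible n" and w: "w \<noteq> 0" "\<And>x. x \<in> tight n \<Longrightarrow> w \<bullet> x \<le> 0"
  obtains m x where "feasible m" "{y \<in> tight n. w \<bullet> y = 0} \<subseteq> tight m" "x \<in> tight m" "0 < w \<bullet> x"
proof -
  define P where "P = {x \<in> C. 0 < w \<bullet> x}"
  define r where "r x = (h x - n \<bullet> x) / (w \<bullet> x)" for x
  have P: "finite P" "P \<noteq> {}" using finite_C spanning[OF w(1)] by (auto simp: P_def inner_commute)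
  have "Min (r ` P) \<in> r ` P" using P by (intro Min_in) auto
  then obtain x where x: "x \<in> P" "r x = Min (r ` P)" by force
  have min: "r x \<le> r y" if "y \<in> P" for y using x P that by simp
  have xC: "x \<in> C" "0 < w \<bullet> x" using x(1) by (simp_all add: P_def)
  have "x \<notin> tight n" using xC(2) w(2)[of x] by linarith
  then have "n \<bullet> x < h x" using n xC(1) by (force simp: tight_def feasible_def)
  then have "0 < r x" using xC by (simp add: r_def)
  have "(n + r x *\<^sub>R w) \<bullet> y \<le> h y" if y: "y \<in> C" for y
  proof (cases "0 < w \<bullet> y")
    case True
    then have "r x * (w \<bullet> y) \<le> r y * (w \<bullet> y)" using min y by (intro mult_right_mono) (auto simp: P_def)
    also have "\<dots> = h y - n \<bullet> y" using True by (simp add: r_def)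
    finally show ?thesis by (simp add: inner_add_left)
  next
    case False
    then have "r x * (w \<bullet> y) \<le> 0" using \<open>0 < r x\<close> by (simp add: mult_nonneg_nonpos)
    moreover have "n \<bullet> y \<le> h y" using n y by (simp add: feasible_def)
    ultimately show ?thesis by (simp add: inner_add_left)
  qed
  then have "feasible (n + r x *\<^sub>R w)" by (simp add: feasible_def)
  moreover have "{y \<in> tight n. w \<bullet> y = 0} \<subseteq> tight (n + r x *\<^sub>R w)" by (auto simp: tight_def inner_add_left)
  moreover have "x \<in> tight (n + r x *\<^sub>R w)" "0 < w \<bullet> x" using xC by (simp_all add: tight_def r_def inner_add_left)
  ultimately show ?thesis by (rule that)
qed

lemma facet_on_side:
  assumes n: "feasible n" "a \<in> tight n" "b \<in> tight n" "a \<noteq> b" and w: "w \<noteq> 0" "w \<bullet> a = 0" "w \<bullet> b = 0"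
  obtains c where "{a, b, c} \<in> facets" "0 < w \<bullet> c"
proof (cases "\<exists>x\<in>tight n. 0 < w \<bullet> x")
  case True
  then obtain c where c: "c \<in> tight n" "0 < w \<bullet> c" by blast
  then have "card {a, b, c} = 3" using n(4) w by (auto simp: card_insert_if)
  moreover have "{a, b, c} \<subseteq> tight n" using n(2,3) c(1) by simp
  ultimately show ?thesis using that[OF facetI(1)[OF n(1)] c(2)] by simp
next
  case False
  then have np: "w \<bullet> x \<le> 0" if "x \<in> tight n" for x using that by (simp add: not_less)
  obtain m c where m: "feasible m" "{y \<in> tight n. w \<bullet> y = 0} \<subseteq> tight m" "c \<in> tight m" "0 < w \<bullet> c"
    using ray[OF n(1) w(1) np] .
  then have "card {a, b, c} = 3" using n(4) w by (auto simp: card_insert_if)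
  moreover have "{a, b, c} \<subseteq> tight m" using m(2,3) n(2,3) w(2,3) by auto
  ultimately show ?thesis using that[OF facetI(1)[OF m(1)] m(4)] by simp
qed

text \<open>The normals of the two facets differ by a multiple of w. By feasibility the difference
  is nonpositive at c and nonnegative at d, whereas w is positive at both. So the normals
  coincide.\<close>

lemma facet_on_side_unique:
  assumes "{a, b, c} \<in> facets" "{a, b, d} \<in> facets" "w \<noteq> 0" "w \<bullet> a = 0" "w \<bullet> b = 0" "0 < w \<bullet> c" "0 < w \<bullet> d" "a \<noteq> b"
  shows "c = d"
proof -
  obtain n where n: "feasible n" "tight n = {a, b, c}" "card {a, b, c} = 3" using assms(1) by (auto simp: facets_def)
  obtain m where m: "feasible m" "tight m = {a, b, d}" "card {a, b, d} = 3" using assms(2) by (auto simp: facets_def)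
  have "a \<in> tight n" "b \<in> tight n" "c \<in> tight n" "a \<in> tight m" "b \<in> tight m" "d \<in> tight m"
    using n(2) m(2) by simp_all
  then have at: "n \<bullet> a = h a" "n \<bullet> b = h b" "n \<bullet> c = h c" "m \<bullet> a = h a" "m \<bullet> b = h b" "m \<bullet> d = h d"
    and "c \<in> C" "d \<in> C" by (simp_all add: tight_def)
  have ip: "(m - n) \<bullet> a = 0" "(m - n) \<bullet> b = 0" using at by (simp_all add: inner_diff_left)
  have "m \<bullet> c \<le> h c" "n \<bullet> d \<le> h d" using n(1) m(1) \<open>c \<in> C\<close> \<open>d \<in> C\<close> by (simp_all add: feasible_def)
  then have le: "(m - n) \<bullet> c \<le> 0" "0 \<le> (m - n) \<bullet> d"
    using at by (simp_all add: inner_diff_left)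
  have "m = n"
  proof (rule ccontr)
    assume "m \<noteq> n"
    then have v: "m - n \<noteq> 0" by simp
    \<comment> \<open>\<^term>\<open>m - n\<close> is parallel to \<^term>\<open>w\<close>; the combination below vanishes on \<^term>\<open>a\<close>, \<^term>\<open>b\<close> and \<^term>\<open>c\<close>.\<close>
    define u where "u = (w \<bullet> c) *\<^sub>R (m - n) - ((m - n) \<bullet> c) *\<^sub>R w"
    have "u \<bullet> a = 0" "u \<bullet> b = 0" "u \<bullet> c = 0"
      using assms ip by (simp_all add: u_def inner_diff_left)
    then have "u = 0" using facet_off_plane[of a b c n u] n by auto
    then have "u \<bullet> d = 0" by simp
    then have eq: "(w \<bullet> c) * ((m - n) \<bullet> d) = ((m - n) \<bullet> c) * (w \<bullet> d)" by (simp add: u_def inner_diff_left)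
    moreover have "0 \<le> (w \<bullet> c) * ((m - n) \<bullet> d)" "((m - n) \<bullet> c) * (w \<bullet> d) \<le> 0"
      using le assms(6,7) by (simp_all add: mult_nonpos_nonneg)
    ultimately have "(m - n) \<bullet> c = 0" using assms(6,7) by auto
    then show False using facet_off_plane[of a b c n "m - n"] n v ip by auto
  qed
  then have "{a, b, c} = {a, b, d}" using n m by simp
  then show ?thesis using n(3) m(3) by (auto simp: card_insert_if doubleton_eq_iff split: if_splits)
qed

lemma orthogonal_exists:
  fixes a b :: "real^3"
  obtains w where "w \<noteq> 0" "w \<bullet> a = 0" "w \<bullet> b = 0"
proof -
  have "dim {a, b} \<le> card {a, b}" by (intro dim_le_card') simp
  also have "\<dots> < DIM(real^3)" by (simp add: card_insert_if)
  finally obtain w where "w \<noteq> 0" "\<And>x. x \<in> span {a, b} \<Longrightarrow> orthogonal w x"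
    using orthogonal_to_subspace_exists by blast
  then show ?thesis using that[of w] by (simp add: orthogonal_def span_base)
qed

text \<open>There is one facet on either side of the plane through a, b and the origin: the
  triangulated surface neither ends nor branches.\<close>

lemma two_facets_at_pair:
  assumes n: "feasible n" "a \<in> tight n" "b \<in> tight n" "a \<noteq> b"
  obtains c d where "c \<noteq> d" "{F \<in> facets. a \<in> F \<and> b \<in> F} = {{a, b, c}, {a, b, d}}" "c \<notin> {a, b}" "d \<notin> {a, b}"
proof -
  obtain w where w: "w \<noteq> 0" "w \<bullet> a = 0" "w \<bullet> b = 0" using orthogonal_exists by blast
  obtain c where c: "{a, b, c} \<in> facets" "0 < w \<bullet> c" using facet_on_side[OF n w] .
  have w': "- w \<noteq> 0" "(- w) \<bullet> a = 0" "(- w) \<bullet> b = 0" using w by auto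
  obtain d where d: "{a, b, d} \<in> facets" "0 < (- w) \<bullet> d" using facet_on_side[OF n w'] .
  have "F \<in> {{a, b, c}, {a, b, d}}" if F: "F \<in> facets" "a \<in> F" "b \<in> F" for F
  proof -
    have "card F = 3" using F facets_card by blast
    then have "card (F - {a, b}) = 1" using F n(4) by (subst card_Diff_subset) auto
    then obtain e where "F - {a, b} = {e}" by (auto simp: card_1_singleton_iff)
    then have e: "F = {a, b, e}" using F by auto
    obtain m where m: "tight m = F" using F by (auto simp: facets_def)
    have "w \<bullet> e \<noteq> 0" using facet_off_plane[of a b e m w] m e w \<open>card F = 3\<close> by auto
    then consider "0 < w \<bullet> e" | "0 < (- w) \<bullet> e" unfolding inner_minus_left by linarith
    then show ?thesis
    proof cases
      case 1 then have "e = c" using facet_on_side_unique[of a b e c w] F e c w n(4) by auto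
      then show ?thesis using e by simp
    next
      case 2 then have "e = d" using facet_on_side_unique[of a b e d "- w"] F e d w' n(4) by auto
      then show ?thesis using e by simp
    qed
  qed
  then have "{F \<in> facets. a \<in> F \<and> b \<in> F} = {{a, b, c}, {a, b, d}}" using c d by auto
  moreover have "c \<noteq> d" "c \<notin> {a, b}" "d \<notin> {a, b}" using c d w by auto
  ultimately show ?thesis using that by blast
qed

lemma facet_pair:
  assumes "F \<in> facets" "a \<in> F" "b \<in> F" "a \<noteq> b"
  obtains c d where "c \<noteq> d" "{F \<in> facets. a \<in> F \<and> b \<in> F} = {{a, b, c}, {a, b, d}}" "c \<notin> {a, b}" "d \<notin> {a, b}"
proof -
  obtain n where "feasible n" "tight n = F" using assms(1) by (auto simp: facets_def)
  then show ?thesis using two_facets_at_pair[of n a b] assms that by blast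
qed

lemma kissing_unit': "x \<in> C \<Longrightarrow> x \<bullet> x = 1"
  using kissing_unit[OF kissing] .

text \<open>The Gram matrix of a and b determines the n in their span that is tight at both. Its
  coefficients are nonnegative for heights near 1, so the value at any other point is at most their
  half sum, about 2/3, which is below the height.\<close>

lemma contact_pair_tight:
  assumes "a \<in> C" "b \<in> C" "a \<bullet> b = 1/2"
  obtains n where "feasible n" "a \<in> tight n" "b \<in> tight n"
proof -
  define p q where "p = 4/3 * h a - 2/3 * h b" and "q = 4/3 * h b - 2/3 * h a"
  define n where "n = p *\<^sub>R a + q *\<^sub>R b"
  note hb = height_bounds[OF assms(1)] height_bounds[OF assms(2)]
  have pq: "0 \<le> p" "0 \<le> q" using hb by (simp_all add: p_def q_def)
  have ip: "a \<bullet> a = 1" "b \<bullet> b = 1" "a \<bullet> b = 1/2" "b \<bullet> a = 1/2"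
    using assms kissing_unit' by (simp_all add: inner_commute)
  have na: "n \<bullet> a = h a" "n \<bullet> b = h b"
    by (simp_all add: n_def inner_add_left ip p_def q_def field_simps)
  have "n \<bullet> x \<le> h x" if x: "x \<in> C" for x
  proof (cases "x = a \<or> x = b")
    case True then show ?thesis using na by auto
  next
    case False
    then have "a \<bullet> x \<le> 1/2" "b \<bullet> x \<le> 1/2" using kissing_inner_le[OF kissing] assms x by auto
    then have "n \<bullet> x \<le> p * (1/2) + q * (1/2)"
      unfolding n_def inner_add_left inner_scaleR_left using pq by (intro add_mono mult_left_mono)
    also have "p * (1/2) + q * (1/2) = 1/3 * h a + 1/3 * h b" by (simp add: p_def q_def field_simps)
    also have "\<dots> \<le> h x" using hb height_bounds[OF x] by linarith
    finally show ?thesis .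
  qed
  then have "feasible n" by (simp add: feasible_def)
  then show ?thesis using that na assms by (simp add: tight_def)
qed

lemma contact_triangle_facet:
  assumes T: "contact_triangle {a, b, c}" and C: "{a, b, c} \<subseteq> C"
  shows "{a, b, c} \<in> facets"
proof -
  \<comment> \<open>The inverse Gram matrix again, now for three vectors; the half sum of the
    coefficients is about 3/4.\<close>
  define p q r where "p = 2 * h a - (h a + h b + h c) / 2" and "q = 2 * h b - (h a + h b + h c) / 2"
    and "r = 2 * h c - (h a + h b + h c) / 2"
  define n where "n = p *\<^sub>R a + q *\<^sub>R b + r *\<^sub>R c"
  have abc: "a \<in> C" "b \<in> C" "c \<in> C" using C by auto
  note hb = height_bounds[OF abc(1)] height_bounds[OF abc(2)] height_bounds[OF abc(3)]
  have ip: "a \<bullet> a = 1" "b \<bullet> b = 1" "c \<bullet> c = 1" "a \<bullet> b = 1/2" "b \<bullet> a = 1/2"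
      "a \<bullet> c = 1/2" "c \<bullet> a = 1/2" "b \<bullet> c = 1/2" "c \<bullet> b = 1/2"
    using contact_triangle_insertD(1-3)[OF T] by (simp_all add: contact_def inner_commute)
  have pq: "0 \<le> p" "0 \<le> q" "0 \<le> r" using hb by (simp_all add: p_def q_def r_def)
  have na: "n \<bullet> a = h a" "n \<bullet> b = h b" "n \<bullet> c = h c"
    by (simp_all add: n_def inner_add_left ip p_def q_def r_def field_simps)
  have "n \<bullet> x \<le> h x" if x: "x \<in> C" for x
  proof (cases "x = a \<or> x = b \<or> x = c")
    case True then show ?thesis using na by auto
  next
    case False
    then have "a \<bullet> x \<le> 1/2" "b \<bullet> x \<le> 1/2" "c \<bullet> x \<le> 1/2" using kissing_inner_le[OF kissing] abc x by auto
    then have "n \<bullet> x \<le> p * (1/2) + q * (1/2) + r * (1/2)"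
      unfolding n_def inner_add_left inner_scaleR_left using pq by (intro add_mono mult_left_mono)
    also have "p * (1/2) + q * (1/2) + r * (1/2) = 1/4 * h a + 1/4 * h b + 1/4 * h c" by (simp add: p_def q_def r_def field_simps)
    also have "\<dots> \<le> h x" using hb height_bounds[OF x] by linarith
    finally show ?thesis .
  qed
  then have "feasible n" by (simp add: feasible_def)
  moreover have "{a, b, c} \<subseteq> tight n" using abc na by (simp add: tight_def)
  moreover have "card {a, b, c} = 3" using contact_triangle_insertD(4-6)[OF T] by simp
  ultimately show ?thesis by (rule facetI(1))
qed

text \<open>The other diagonal of the rhombus is the one used by the facets.\<close>
lemma no_crossing_diagonal:
  assumes "F \<in> facets" "p \<in> F" "q \<in> F" "r \<in> C" "s \<in> C"
  shows "p + q \<noteq> (2/3) *\<^sub>R (r + s)"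
proof
  assume eq: "p + q = (2/3) *\<^sub>R (r + s)"
  obtain n where n: "feasible n" "tight n = F" using assms(1) by (auto simp: facets_def)
  have "p \<in> C" "q \<in> C" "n \<bullet> p = h p" "n \<bullet> q = h q" using n(2) assms(2,3) by (auto simp: tight_def)
  moreover have "n \<bullet> r \<le> h r" "n \<bullet> s \<le> h s" using n(1) assms(4,5) by (auto simp: feasible_def)
  moreover have "n \<bullet> p + n \<bullet> q = 2/3 * (n \<bullet> r + n \<bullet> s)"
    using arg_cong[OF eq, of "\<lambda>v. n \<bullet> v"] by (simp add: inner_add_right)
  ultimately show False
    using height_bounds[of p] height_bounds[of q] height_bounds[of r] height_bounds[of s] assms(4,5) by simp
qed

end

section \<open>A sweep that bounds the number of facets\<close>

lemma sign_clash:
  fixes a b c :: real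
  assumes "b * x + c * x' = 0" "x < 0" "x' < 0" "a * y + c * y' = 0" "y < 0" "y' < 0"
    "a * z + b * z' = 0" "z < 0" "z' < 0"
  shows "a = 0" "b = 0" "c = 0"
proof -
  \<comment> \<open>The coefficients in a relation have opposite signs or are both zero, and three
    numbers cannot have pairwise opposite signs.\<close>
  have opp: "(0 < s \<longrightarrow> t < 0) \<and> (s < 0 \<longrightarrow> 0 < t) \<and> (s = 0 \<longrightarrow> t = 0)"
    if "s * u + t * v = 0" "u < 0" "v < 0" for s t u v :: real
  proof -
    have "t * v = - s * u" using that(1) by simp
    then have "t = - s * u / v" using that(3) by (simp add: field_simps)
    then show ?thesis using that(2,3) by (auto simp: mult_neg_neg mult_pos_neg divide_pos_neg divide_neg_neg)
  qed
  show "a = 0" "b = 0" "c = 0"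
    using opp[OF assms(1-3)] opp[OF assms(4-6)] opp[OF assms(7-9)] by linarith+
qed

context delaunay begin

lemma exists_sweep:
  obtains g where "g \<noteq> 0" "\<And>x y. x \<in> C \<Longrightarrow> y \<in> C \<Longrightarrow> g \<bullet> x / h x = g \<bullet> y / h y \<Longrightarrow> x = y"
proof -
  define D where "D = (\<lambda>(x, y). x /\<^sub>R h x - y /\<^sub>R h y) ` {(x, y). x \<in> C \<and> y \<in> C \<and> x \<noteq> y}"
  have "{(x, y). x \<in> C \<and> y \<in> C \<and> x \<noteq> y} \<subseteq> C \<times> C" by auto
  then have "finite {(x, y). x \<in> C \<and> y \<in> C \<and> x \<noteq> y}" by (rule finite_subset) (simp add: finite_C)
  then have fin: "finite D" unfolding D_def by (rule finite_imageI)
  \<comment> \<open>Equal scaled points have equal norms, so the heights agree and then the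
    centers.\<close>
  have nz: "x /\<^sub>R h x - y /\<^sub>R h y \<noteq> 0" if "x \<in> C" "y \<in> C" "x \<noteq> y" for x y
  proof
    assume "x /\<^sub>R h x - y /\<^sub>R h y = 0"
    then have eq: "x /\<^sub>R h x = y /\<^sub>R h y" by simp
    have h: "0 < h x" "0 < h y" using height_bounds that by fastforce+
    have "norm (x /\<^sub>R h x) = inverse (h x)" "norm (y /\<^sub>R h y) = inverse (h y)"
      using h kissing that by (auto simp: kissing_def)
    then have "h x = h y" using eq by (metis inverse_eq_iff_eq)
    then show False using eq h that(3) by simp
  qed
  \<comment> \<open>The vector \<open>axis 1 1\<close> is included to force g to be nonzero.\<close>
  have "0 \<notin> insert (axis 1 1) D"
  proof
    assume "0 \<in> insert (axis 1 1 :: real^3) D"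
    then consider "0 = (axis 1 1 :: real^3)" | "0 \<in> D" by blast
    then show False
    proof cases
      case 1 then show False by (metis axis_eq_0_iff zero_neq_one)
    next
      case 2
      then obtain x y where "x \<in> C" "y \<in> C" "x \<noteq> y" "0 = x /\<^sub>R h x - y /\<^sub>R h y" unfolding D_def by auto
      then show False using nz[of x y] by simp
    qed
  qed
  then obtain g where g: "\<And>d. d \<in> insert (axis 1 1) D \<Longrightarrow> g \<bullet> d \<noteq> 0"
    using avoid_hyperplanes[of "insert (axis 1 1) D"] fin by blast
  have "g \<noteq> 0" using g[of "axis 1 1"] by auto
  moreover have "x = y" if "x \<in> C" "y \<in> C" "g \<bullet> x / h x = g \<bullet> y / h y" for x y
  proof (rule ccontr)
    assume "x \<noteq> y"
    then have "x /\<^sub>R h x - y /\<^sub>R h y \<in> D" unfolding D_def using that by (intro image_eqI[of _ _ "(x, y)"]) auto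
    then show False using g[of "x /\<^sub>R h x - y /\<^sub>R h y"] that(3) by (simp add: inner_diff_right divide_inverse mult.commute)
  qed
  ultimately show ?thesis using that by blast
qed

definition sweep_middle :: "real^3 \<Rightarrow> real^3 \<Rightarrow> (real^3) set \<Rightarrow> bool" where
  "sweep_middle g v F \<longleftrightarrow> F \<in> facets \<and> v \<in> F \<and> (\<exists>a\<in>F. g \<bullet> a / h a < g \<bullet> v / h v) \<and> (\<exists>c\<in>F. g \<bullet> v / h v < g \<bullet> c / h c)"

text \<open>The plane through v / h v on which g is constant cuts F in a segment from that point to
  the opposite edge, and w is a positive multiple of its direction. Another facet at v has a or c
  strictly inside its half space, whence the sign.\<close>

lemma sweep_segment:
  assumes "sweep_middle g v F" "feasible n" "tight n = F"
  obtains w where "g \<bullet> w = 0" "n \<bullet> w = 0"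
    "\<And>m. feasible m \<Longrightarrow> v \<in> tight m \<Longrightarrow> tight m \<in> facets \<Longrightarrow> tight m \<noteq> F \<Longrightarrow> m \<bullet> w < 0"
proof -
  obtain a c where ac: "a \<in> F" "c \<in> F" "g \<bullet> a / h a < g \<bullet> v / h v" "g \<bullet> v / h v < g \<bullet> c / h c"
    and F: "F \<in> facets" "v \<in> F" using assms(1) by (auto simp: sweep_middle_def)
  have C: "a \<in> C" "c \<in> C" "v \<in> C" using ac F facets_subset by blast+
  have h: "0 < h a" "0 < h c" "0 < h v" using height_bounds[OF C(1)] height_bounds[OF C(2)] height_bounds[OF C(3)] by linarith+
  have "{a, v, c} \<subseteq> F" "card {a, v, c} = 3" using ac F by (auto simp: card_insert_if)
  then have Favc: "F = {a, v, c}" using facets_card[OF F(1)] assms(3) finite_tight by (metis card_subset_eq)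
  define s where "s = (g \<bullet> c / h c - g \<bullet> v / h v)"
  define t where "t = (g \<bullet> v / h v - g \<bullet> a / h a)"
  define w where "w = (s / h a) *\<^sub>R a + (t / h c) *\<^sub>R c - ((s + t) / h v) *\<^sub>R v"
  have st: "0 < s" "0 < t" using ac by (auto simp: s_def t_def)
  have gw: "g \<bullet> w = s * (g \<bullet> a / h a) + t * (g \<bullet> c / h c) - (s + t) * (g \<bullet> v / h v)"
    by (simp add: w_def inner_add_right inner_diff_right)
  have "g \<bullet> w = 0" unfolding gw s_def t_def by algebra
  moreover have mw: "m \<bullet> w = s * (m \<bullet> a / h a - 1) + t * (m \<bullet> c / h c - 1)" if "v \<in> tight m" for m
  proof -
    have "m \<bullet> v = h v" using that by (simp add: tight_def)
    then have "m \<bullet> w = s * (m \<bullet> a / h a) + t * (m \<bullet> c / h c) - (s + t)"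
      using h by (simp add: w_def inner_add_right inner_diff_right)
    then show ?thesis by (simp add: algebra_simps)
  qed
  have n: "a \<in> tight n" "c \<in> tight n" "v \<in> tight n" using assms(3) ac F by simp_all
  then have "n \<bullet> w = 0" using mw[of n] h by (simp add: tight_def)
  moreover have "m \<bullet> w < 0" if m: "feasible m" "v \<in> tight m" "tight m \<in> facets" "tight m \<noteq> F" for m
  proof -
    have le: "m \<bullet> a / h a - 1 \<le> 0" "m \<bullet> c / h c - 1 \<le> 0"
      using m(1) C h by (simp_all add: feasible_def)
    have "\<not> (m \<bullet> a / h a - 1 = 0 \<and> m \<bullet> c / h c - 1 = 0)"
    proof
      assume "m \<bullet> a / h a - 1 = 0 \<and> m \<bullet> c / h c - 1 = 0"
      then have "{a, v, c} \<subseteq> tight m" using m(2) C h by (simp add: tight_def)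
      then have "F = tight m" unfolding Favc[symmetric]
        using facets_card[OF m(3)] facets_card[OF F(1)] finite_tight[of m] by (metis card_subset_eq)
      then show False using m(4) by simp
    qed
    then consider "m \<bullet> a / h a - 1 < 0" | "m \<bullet> c / h c - 1 < 0" using le by linarith
    then show ?thesis
    proof cases
      case 1
      then have "s * (m \<bullet> a / h a - 1) < 0" using st by (simp add: mult_pos_neg)
      moreover have "t * (m \<bullet> c / h c - 1) \<le> 0" using st le by (simp add: mult_nonneg_nonpos)
      ultimately show ?thesis using mw[OF m(2)] by linarith
    next
      case 2
      then have "t * (m \<bullet> c / h c - 1) < 0" using st by (simp add: mult_pos_neg)
      moreover have "s * (m \<bullet> a / h a - 1) \<le> 0" using st le by (simp add: mult_nonneg_nonpos)
      ultimately show ?thesis using mw[OF m(2)] by linarith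
    qed
  qed
  ultimately show ?thesis by (rule that)
qed

text \<open>In the plane through \<^term>\<open>v\<close> on which the sweep function is constant, the surface of the hull is a
  convex curve, of which only two pieces end in \<^term>\<open>v\<close>.\<close>
lemma card_sweep_middle_le:
  assumes "g \<noteq> 0"
  shows "card {F. sweep_middle g v F} \<le> 2"
proof (rule ccontr)
  assume "\<not> card {F. sweep_middle g v F} \<le> 2"
  then have "3 \<le> card {F. sweep_middle g v F}" by simp
  then obtain T where "T \<subseteq> {F. sweep_middle g v F}" "card T = 3" by (rule obtain_subset_with_card_n)
  then obtain F G H where FGH: "F \<noteq> G" "G \<noteq> H" "F \<noteq> H" "sweep_middle g v F" "sweep_middle g v G" "sweep_middle g v H"
    by (auto simp: card_3_iff)
  then have mem: "F \<in> facets" "G \<in> facets" "H \<in> facets" "v \<in> F" "v \<in> G" "v \<in> H" by (auto simp: sweep_middle_def)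
  obtain l where l: "feasible l" "tight l = F" using mem by (auto simp: facets_def)
  obtain m where m: "feasible m" "tight m = G" using mem by (auto simp: facets_def)
  obtain n where n: "feasible n" "tight n = H" using mem by (auto simp: facets_def)
  obtain x where x: "g \<bullet> x = 0" "l \<bullet> x = 0" "m \<bullet> x < 0" "n \<bullet> x < 0"
    using sweep_segment[OF FGH(4) l] m n mem FGH by metis
  obtain y where y: "g \<bullet> y = 0" "m \<bullet> y = 0" "l \<bullet> y < 0" "n \<bullet> y < 0"
    using sweep_segment[OF FGH(5) m] l n mem FGH by metis
  obtain z where z: "g \<bullet> z = 0" "n \<bullet> z = 0" "l \<bullet> z < 0" "m \<bullet> z < 0"
    using sweep_segment[OF FGH(6) n] l m mem FGH by metis
  \<comment> \<open>Three vectors orthogonal to g are dependent, and pairing the dependence with the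
    three normals gives the relations of \<open>sign_clash\<close>.\<close>
  obtain a b c where rel: "a *\<^sub>R x + b *\<^sub>R y + c *\<^sub>R z = 0" and nz: "a \<noteq> 0 \<or> b \<noteq> 0 \<or> c \<noteq> 0"
    using plane_dependent[OF assms x(1) y(1) z(1)] by blast
  have "b * (l \<bullet> y) + c * (l \<bullet> z) = 0" using arg_cong[OF rel, of "\<lambda>u. l \<bullet> u"] x by (simp add: inner_add_right)
  moreover have "a * (m \<bullet> x) + c * (m \<bullet> z) = 0" using arg_cong[OF rel, of "\<lambda>u. m \<bullet> u"] y by (simp add: inner_add_right)
  moreover have "a * (n \<bullet> x) + b * (n \<bullet> y) = 0" using arg_cong[OF rel, of "\<lambda>u. n \<bullet> u"] z by (simp add: inner_add_right)
  ultimately show False using sign_clash x y z nz by metis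
qed

text \<open>The 4 comes from the lowest and the highest vertex, which are the middle of no
  facet.\<close>

theorem card_facets_le:
  assumes "facets \<noteq> {}"
  shows "card facets + 4 \<le> 2 * card (\<Union>facets)"
proof -
  obtain g where g: "g \<noteq> 0" "\<And>x y. x \<in> C \<Longrightarrow> y \<in> C \<Longrightarrow> g \<bullet> x / h x = g \<bullet> y / h y \<Longrightarrow> x = y"
    using exists_sweep by blast
  define f where "f x = g \<bullet> x / h x" for x
  define V where "V = \<Union>facets"
  have VC: "V \<subseteq> C" using facets_subset by (auto simp: V_def)
  then have fin: "finite V" using finite_C finite_subset by blast
  have inj: "inj_on f C" using g(2) by (auto simp: inj_on_def f_def)
  have facet_order: "\<exists>a b c. F = {a, b, c} \<and> f a < f b \<and> f b < f c" if F: "F \<in> facets" for F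
  proof -
    obtain a b c where abc: "F = {a, b, c}" "a \<noteq> b" "b \<noteq> c" "a \<noteq> c"
      using facets_card[OF F] by (auto simp: card_3_iff)
    have "a \<in> C" "b \<in> C" "c \<in> C" using abc(1) facets_subset[OF F] by auto
    then have "f a \<noteq> f b" "f b \<noteq> f c" "f a \<noteq> f c" using inj abc by (auto simp: inj_on_def)
    then consider "f a < f b \<and> f b < f c" | "f a < f c \<and> f c < f b" | "f b < f a \<and> f a < f c"
      | "f b < f c \<and> f c < f a" | "f c < f a \<and> f a < f b" | "f c < f b \<and> f b < f a" by linarith
    then show ?thesis using abc(1) by cases (auto simp: insert_commute)
  qed
  obtain F0 where F0: "F0 \<in> facets" using assms by blast
  then obtain a0 b0 c0 where abc0: "F0 = {a0, b0, c0}" "f a0 < f b0" "f b0 < f c0" using facet_order by blast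
  have 0: "a0 \<in> V" "c0 \<in> V" "f a0 < f c0" using F0 abc0 by (auto simp: V_def)
  have ne: "f ` V \<noteq> {}" and finf: "finite (f ` V)" using 0 fin by auto
  obtain lo where lo: "lo \<in> V" "f lo = Min (f ` V)" using Min_in[OF finf ne] by force
  obtain hi where hi: "hi \<in> V" "f hi = Max (f ` V)" using Max_in[OF finf ne] by force
  have lo_le: "f lo \<le> f x" and hi_ge: "f x \<le> f hi" if "x \<in> V" for x
    using that finf lo(2) hi(2) by auto
  have "lo \<noteq> hi" using lo_le[OF 0(1)] hi_ge[OF 0(2)] 0(3) by auto
  have "facets \<subseteq> (\<Union>v\<in>V - {lo, hi}. {F. sweep_middle g v F})"
  proof
    fix F assume F: "F \<in> facets"
    then obtain a b c where abc: "F = {a, b, c}" "f a < f b" "f b < f c" using facet_order by blast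
    then have V: "a \<in> V" "b \<in> V" "c \<in> V" using F by (auto simp: V_def)
    have "b \<noteq> lo" "b \<noteq> hi" using lo_le[OF V(1)] hi_ge[OF V(3)] abc by auto
    moreover have "sweep_middle g b F" using F abc by (auto simp: sweep_middle_def f_def)
    ultimately show "F \<in> (\<Union>v\<in>V - {lo, hi}. {F. sweep_middle g v F})" using V by blast
  qed
  moreover have fin': "finite {F. sweep_middle g v F}" for v
    by (rule finite_subset[OF _ finite_facets]) (auto simp: sweep_middle_def)
  ultimately have "card facets \<le> card (\<Union>v\<in>V - {lo, hi}. {F. sweep_middle g v F})"
    using fin by (intro card_mono) auto
  also have "\<dots> \<le> (\<Sum>v\<in>V - {lo, hi}. card {F. sweep_middle g v F})"
    using fin by (intro card_UN_le) auto
  also have "\<dots> \<le> (\<Sum>v\<in>V - {lo, hi}. 2)" by (intro sum_mono card_sweep_middle_le g(1))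
  also have "\<dots> = 2 * card (V - {lo, hi})" by simp
  finally have "card facets \<le> 2 * card (V - {lo, hi})" .
  moreover have "card (V - {lo, hi}) + 2 = card V"
    using fin lo(1) hi(1) \<open>lo \<noteq> hi\<close> card_Diff_subset[of "{lo, hi}" V] card_mono[of V "{lo, hi}"] by simp
  ultimately show ?thesis by (simp add: V_def)
qed

end

subsection \<open>Counting contacts\<close>

definition contact_edges :: "(real^3) set \<Rightarrow> (real^3) set set" where
  "contact_edges C = {e. e \<subseteq> C \<and> card e = 2 \<and> (\<forall>x\<in>e. \<forall>y\<in>e. x \<noteq> y \<longrightarrow> contact x y)}"

definition contact_tris :: "(real^3) set \<Rightarrow> (real^3) set set" where
  "contact_tris C = {T. T \<subseteq> C \<and> contact_triangle T}"

lemma doubleton_contact_edge: "{a, b} \<in> contact_edges C \<longleftrightarrow> a \<in> C \<and> b \<in> C \<and> contact a b"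
  using contact_sym contact_neq by (auto simp: contact_edges_def card_insert_if split: if_splits)

lemma contact_edgeE:
  assumes "e \<in> contact_edges C" "v \<in> e"
  obtains y where "e = {v, y}" "v \<in> C" "y \<in> C" "contact v y"
proof -
  have "card e = 2" using assms by (simp add: contact_edges_def)
  then obtain y where "e = {v, y}" using assms(2) by (auto simp: card_2_iff insert_commute)
  then show ?thesis using that assms(1) doubleton_contact_edge by blast
qed

lemma finite_contact_edges: "finite C \<Longrightarrow> finite (contact_edges C)"
  by (rule finite_subset[of _ "Pow C"]) (auto simp: contact_edges_def)

lemma finite_contact_tris: "finite C \<Longrightarrow> finite (contact_tris C)"
  by (rule finite_subset[of _ "Pow C"]) (auto simp: contact_tris_def)

lemma pairs_of_contact_tris: "pairs_of (contact_tris C) \<subseteq> contact_edges C"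
  by (auto simp: pairs_of_def contact_edges_def contact_tris_def contact_triangle_def)

lemma contact_edges_mono: "C \<subseteq> C' \<Longrightarrow> contact_edges C \<subseteq> contact_edges C'"
  by (auto simp: contact_edges_def)

section \<open>Rhombi and fans of contact triangles\<close>

lemma rhombus_inner:
  assumes "contact v r" "contact v s" "contact u r" "contact u s" "u \<noteq> v" "r \<noteq> s"
  shows "(1 + v \<bullet> u) * (1 + r \<bullet> s) = 1"
proof -
  have ip: "v \<bullet> v = 1" "u \<bullet> u = 1" "r \<bullet> r = 1" "s \<bullet> s = 1" "v \<bullet> r = 1/2" "r \<bullet> v = 1/2" "v \<bullet> s = 1/2" "s \<bullet> v = 1/2"
    "u \<bullet> r = 1/2" "r \<bullet> u = 1/2" "u \<bullet> s = 1/2" "s \<bullet> u = 1/2" "u \<bullet> v = v \<bullet> u" "s \<bullet> r = r \<bullet> s"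
    using assms by (simp_all add: contact_def inner_commute)
  \<comment> \<open>Both v + u and r + s are orthogonal to \<open>x\<close> and \<open>y\<close>,
    hence parallel; the claim is the vanishing of their Gram determinant.\<close>
  define x y where "x = v - u" and "y = r - s"
  have nz: "x \<noteq> 0" "y \<noteq> 0" using assms by (simp_all add: x_def y_def)
  have "x \<bullet> y = 0" "x \<bullet> (v + u) = 0" "x \<bullet> (r + s) = 0"
    by (simp_all add: x_def y_def inner_diff_left inner_diff_right inner_add_right ip)
  then obtain a b c where rel: "a *\<^sub>R y + b *\<^sub>R (v + u) + c *\<^sub>R (r + s) = 0" and abc: "a \<noteq> 0 \<or> b \<noteq> 0 \<or> c \<noteq> 0"
    using plane_dependent[OF nz(1)] by blast
  have perp: "(v + u) \<bullet> y = 0" "(r + s) \<bullet> y = 0"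
    by (simp_all add: y_def inner_diff_right inner_add_left ip)
  have "a * (y \<bullet> y) = 0"
    using arg_cong[OF rel, of "\<lambda>w. w \<bullet> y"] perp by (simp only: inner_add_left[of _ _ y] inner_scaleR_left) simp
  then have "a = 0" using nz(2) by simp
  have gram: "(v + u) \<bullet> (v + u) = 2 + 2 * (v \<bullet> u)" "(r + s) \<bullet> (v + u) = 2" "(v + u) \<bullet> (r + s) = 2" "(r + s) \<bullet> (r + s) = 2 + 2 * (r \<bullet> s)"
    by (simp_all add: inner_add_left inner_add_right ip)
  have rel': "b *\<^sub>R (v + u) + c *\<^sub>R (r + s) = 0" using rel \<open>a = 0\<close> by simp
  have 1: "b * (2 + 2 * (v \<bullet> u)) + c * 2 = 0" and 2: "b * 2 + c * (2 + 2 * (r \<bullet> s)) = 0"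
    using arg_cong[OF rel', of "\<lambda>w. w \<bullet> (v + u)"] arg_cong[OF rel', of "\<lambda>w. w \<bullet> (r + s)"] gram
    by (simp_all only: inner_add_left[of "b *\<^sub>R (v + u)"] inner_scaleR_left) simp_all
  have "b * ((1 + v \<bullet> u) * (1 + r \<bullet> s) - 1) = 0" "c * ((1 + v \<bullet> u) * (1 + r \<bullet> s) - 1) = 0"
    using 1 2 by algebra+
  then show ?thesis using abc \<open>a = 0\<close> by auto
qed

text \<open>Unfolding around v. Five dihedral angles arccos (1/3) fall just short of a full turn:
  the product 161/162 means that y5 is not y0 and yet too close to it. The products of y0 with y2
  and y3 enter \<open>rhombus_inner\<close>; all of them keep the points apart.\<close>

lemma fan_inner_products:
  fixes v y0 y1 :: "real^3"
  assumes "contact v y0" "contact v y1" "contact y0 y1"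
    and y2: "y2 = (2/3) *\<^sub>R (v + y1) - y0" and y3: "y3 = (2/3) *\<^sub>R (v + y2) - y1"
    and y4: "y4 = (2/3) *\<^sub>R (v + y3) - y2" and y5: "y5 = (2/3) *\<^sub>R (v + y4) - y3"
  shows "y0 \<bullet> y2 = - 1/3" "y0 \<bullet> y3 = - 7/18" "y0 \<bullet> y4 = 11/27" "y0 \<bullet> y5 = 161/162"
    "y1 \<bullet> y3 = - 1/3" "y1 \<bullet> y4 = - 7/18" "y2 \<bullet> y4 = - 1/3" "y1 \<bullet> y2 = 1/2" "y2 \<bullet> y3 = 1/2" "y3 \<bullet> y4 = 1/2"
proof -
  have ip: "v \<bullet> v = 1" "y0 \<bullet> y0 = 1" "y1 \<bullet> y1 = 1" "v \<bullet> y0 = 1/2" "y0 \<bullet> v = 1/2" "v \<bullet> y1 = 1/2" "y1 \<bullet> v = 1/2"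
    "y0 \<bullet> y1 = 1/2" "y1 \<bullet> y0 = 1/2"
    using assms(1-3) by (simp_all add: contact_def inner_commute)
  show "y0 \<bullet> y2 = - 1/3" "y0 \<bullet> y3 = - 7/18" "y0 \<bullet> y4 = 11/27" "y0 \<bullet> y5 = 161/162"
    "y1 \<bullet> y3 = - 1/3" "y1 \<bullet> y4 = - 7/18" "y2 \<bullet> y4 = - 1/3" "y1 \<bullet> y2 = 1/2" "y2 \<bullet> y3 = 1/2" "y3 \<bullet> y4 = 1/2"
    unfolding y5 y4 y3 y2
    by (simp_all add: inner_diff_left inner_diff_right inner_add_left inner_add_right ip)
qed

lemma contact_tris_at_edge:
  assumes "contact v y"
  shows "{T \<in> contact_tris C. {v, y} \<subseteq> T} = (\<lambda>z. {v, y, z}) ` {z \<in> C. v \<in> C \<and> y \<in> C \<and> contact v z \<and> contact y z}"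
proof
  show "{T \<in> contact_tris C. {v, y} \<subseteq> T} \<subseteq> (\<lambda>z. {v, y, z}) ` {z \<in> C. v \<in> C \<and> y \<in> C \<and> contact v z \<and> contact y z}"
  proof
    fix T assume "T \<in> {T \<in> contact_tris C. {v, y} \<subseteq> T}"
    then have T: "T \<subseteq> C" "contact_triangle T" "v \<in> T" "y \<in> T" by (auto simp: contact_tris_def)
    have "card (T - {v, y}) = 1"
      using T contact_neq[OF assms] by (subst card_Diff_subset) (auto simp: contact_triangle_def)
    then obtain z where "T - {v, y} = {z}" by (auto simp: card_1_singleton_iff)
    then have "T = {v, y, z}" using T by auto
    then show "T \<in> (\<lambda>z. {v, y, z}) ` {z \<in> C. v \<in> C \<and> y \<in> C \<and> contact v z \<and> contact y z}"
      using T contact_triangle_insertD[of v y z] by auto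
  qed
  show "(\<lambda>z. {v, y, z}) ` {z \<in> C. v \<in> C \<and> y \<in> C \<and> contact v z \<and> contact y z} \<subseteq> {T \<in> contact_tris C. {v, y} \<subseteq> T}"
    using assms contact_triangleI by (auto simp: contact_tris_def)
qed

lemma double_count:
  assumes "finite A" "finite B"
  shows "(\<Sum>a\<in>A. card {b \<in> B. R a b}) = (\<Sum>b\<in>B. card {a \<in> A. R a b})"
  using assms by (intro sum_multicount_gen) auto

lemma card_pairs_in_triple:
  assumes "card F = 3" "\<And>e. e \<subseteq> F \<Longrightarrow> card e = 2 \<Longrightarrow> e \<in> E"
  shows "card {e \<in> E. e \<subseteq> F \<and> card e = 2} = 3"
proof -
  have "finite F" using assms(1) by (auto intro: card_ge_0_finite)
  moreover have "{e \<in> E. e \<subseteq> F \<and> card e = 2} = {e. e \<subseteq> F \<and> card e = 2}" using assms(2) by blast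
  ultimately show ?thesis using n_subsets[of F 2] assms(1) by (simp add: choose_two)
qed

lemma card_pairs_at_vertex:
  assumes "card F = 3" "v \<in> F"
  shows "card {e. e \<subseteq> F \<and> card e = 2 \<and> v \<in> e} = 2"
proof -
  have fin: "finite F" using assms(1) by (auto intro: card_ge_0_finite)
  have "{e. e \<subseteq> F \<and> card e = 2 \<and> v \<in> e} = (\<lambda>y. {v, y}) ` (F - {v})"
    using assms(2) by (auto simp: card_2_iff)
  moreover have "inj_on (\<lambda>y. {v, y}) (F - {v})" by (auto simp: inj_on_def doubleton_eq_iff)
  ultimately show ?thesis using assms fin by (simp add: card_image)
qed

lemma card_3_at:
  assumes "card F = 3" "x \<in> F" "y \<in> F" "x \<noteq> y"
  obtains z where "F = {x, y, z}" "z \<noteq> x" "z \<noteq> y"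
proof -
  have "card (F - {x, y}) = 1" using assms by (subst card_Diff_subset) auto
  then obtain z where "F - {x, y} = {z}" by (auto simp: card_1_singleton_iff)
  then show ?thesis using that[of z] assms by blast
qed

context delaunay begin

definition open_edges :: "(real^3) set set" where
  "open_edges = pairs_of facets - contact_edges C"

lemma contact_tris_facets: "contact_tris C \<subseteq> facets"
proof
  fix T assume T: "T \<in> contact_tris C"
  then have "card T = 3" by (simp add: contact_tris_def contact_triangle_def)
  then obtain a b c where "T = {a, b, c}" by (auto simp: card_3_iff)
  then show "T \<in> facets" using T contact_triangle_facet[of a b c] by (simp add: contact_tris_def)
qed

lemma finite_pairs_of_facets: "finite (pairs_of facets)"
  by (rule finite_subset[of _ "Pow C"]) (use facets_subset finite_C in \<open>auto simp: pairs_of_def\<close>)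

lemma card_facets_at_pair:
  assumes "e \<in> pairs_of facets"
  shows "card {F \<in> facets. e \<subseteq> F} = 2"
proof -
  obtain F where F: "F \<in> facets" "e \<subseteq> F" "card e = 2" using assms by (auto simp: pairs_of_def)
  then obtain a b where ab: "e = {a, b}" "a \<noteq> b" by (auto simp: card_2_iff)
  obtain c d where cd: "c \<noteq> d" "{F \<in> facets. a \<in> F \<and> b \<in> F} = {{a, b, c}, {a, b, d}}" "c \<notin> {a, b}" "d \<notin> {a, b}"
    using facet_pair[of F a b] F ab by auto
  have "{a, b, c} \<noteq> {a, b, d}" using cd by auto
  moreover have "{F \<in> facets. e \<subseteq> F} = {{a, b, c}, {a, b, d}}" using cd(2) ab by simp
  ultimately show ?thesis by simp
qed

lemma contact_edges_pairs_of_facets: "contact_edges C \<subseteq> pairs_of facets"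
proof
  fix e assume e: "e \<in> contact_edges C"
  then obtain a b where ab: "e = {a, b}" "a \<noteq> b" by (auto simp: contact_edges_def card_2_iff)
  then have C: "a \<in> C" "b \<in> C" "a \<bullet> b = 1/2" using e doubleton_contact_edge by (auto simp: contact_def)
  then obtain n where n: "feasible n" "a \<in> tight n" "b \<in> tight n" using contact_pair_tight by blast
  obtain c d where "c \<noteq> d" "{F \<in> facets. a \<in> F \<and> b \<in> F} = {{a, b, c}, {a, b, d}}" "c \<notin> {a, b}" "d \<notin> {a, b}"
    using two_facets_at_pair[OF n ab(2)] .
  then have "{a, b, c} \<in> facets" by auto
  then show "e \<in> pairs_of facets" using ab by (auto simp: pairs_of_def intro!: bexI[of _ "{a, b, c}"])
qed

lemma count_facet_pairs: "3 * card facets = 2 * card (pairs_of facets)"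
proof -
  have "card {e \<in> pairs_of facets. e \<subseteq> F} = 3" if F: "F \<in> facets" for F
  proof -
    have "{e \<in> pairs_of facets. e \<subseteq> F} = {e \<in> pairs_of facets. e \<subseteq> F \<and> card e = 2}" by (auto simp: pairs_of_def)
    then show ?thesis
      using card_pairs_in_triple[of F "pairs_of facets"] facets_card[OF F] F by (auto simp: pairs_of_def)
  qed
  then have "3 * card facets = (\<Sum>F\<in>facets. card {e \<in> pairs_of facets. e \<subseteq> F})" by simp
  also have "\<dots> = (\<Sum>e\<in>pairs_of facets. card {F \<in> facets. e \<subseteq> F})"
    using finite_facets finite_pairs_of_facets by (rule double_count)
  also have "\<dots> = 2 * card (pairs_of facets)" using card_facets_at_pair by simp
  finally show ?thesis .
qed

lemma open_edges_in_bad_facet: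
  assumes "F \<in> facets - contact_tris C"
  shows "1 \<le> card {e \<in> open_edges. e \<subseteq> F}"
proof -
  have F: "F \<in> facets" "\<not> contact_triangle F" using assms facets_subset by (auto simp: contact_tris_def)
  then obtain x y where xy: "x \<in> F" "y \<in> F" "x \<noteq> y" "\<not> contact x y"
    using facets_card[OF F(1)] by (auto simp: contact_triangle_def)
  then have "{x, y} \<in> open_edges" using F(1) doubleton_contact_edge[of x y]
    by (auto simp: open_edges_def pairs_of_def)
  then have "{x, y} \<in> {e \<in> open_edges. e \<subseteq> F}" using xy by simp
  moreover have "finite {e \<in> open_edges. e \<subseteq> F}" using finite_pairs_of_facets by (simp add: open_edges_def)
  ultimately show ?thesis by (metis One_nat_def Suc_leI card_gt_0_iff empty_iff)
qed

lemma count_open_edges: "(\<Sum>F\<in>facets - contact_tris C. card {e \<in> open_edges. e \<subseteq> F}) = 2 * card open_edges"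
proof -
  have fin: "finite open_edges" using finite_pairs_of_facets by (simp add: open_edges_def)
  have zero: "card {e \<in> open_edges. e \<subseteq> F} = 0" if "F \<in> contact_tris C" for F
  proof -
    have "e \<in> contact_edges C" if "e \<subseteq> F" "card e = 2" for e
      using that \<open>F \<in> contact_tris C\<close> pairs_of_contact_tris by (auto simp: pairs_of_def)
    then have "{e \<in> open_edges. e \<subseteq> F} = {}" by (auto simp: open_edges_def pairs_of_def)
    then show ?thesis by (simp only: card.empty)
  qed
  have "(\<Sum>F\<in>facets - contact_tris C. card {e \<in> open_edges. e \<subseteq> F}) = (\<Sum>F\<in>facets. card {e \<in> open_edges. e \<subseteq> F})"
    by (rule sum.mono_neutral_left[OF finite_facets]) (use zero in blast)+
  also have "\<dots> = (\<Sum>e\<in>open_edges. card {F \<in> facets. e \<subseteq> F})" using finite_facets fin by (rule double_count)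
  also have "\<dots> = 2 * card open_edges" using card_facets_at_pair by (simp add: open_edges_def)
  finally show ?thesis .
qed

end

section \<open>The extremal configuration with 26 contacts\<close>

locale dense_contacts = delaunay +
  assumes many: "26 \<le> card (contact_edges C)"
begin

text \<open>Let E, o, f, t count contact edges, open edges, facets and contact triangles. From 3 f =
  2 (E + o) and f - t \<le> 2 o follows t \<ge> 2 E - 2 f \<ge> 2 E - 40 \<ge> 12. Now t + 2 exceeds
  the number of vertices, so E \<ge> 2 t + 2. Together these leave only E = 26, t = 12, f = 20 and o
  = 4.\<close>

lemma numbers:
  shows card_edges: "card (contact_edges C) = 26" and card_tris: "card (contact_tris C) = 12"
    and pairs_tris: "pairs_of (contact_tris C) = contact_edges C" and facets_cover: "\<Union>facets = C" "card C = 12"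
    and bad_unique: "\<And>F. F \<in> facets - contact_tris C \<Longrightarrow> card {e \<in> open_edges. e \<subseteq> F} = 1"
proof -
  let ?E = "contact_edges C" and ?T = "contact_tris C" and ?B = "facets - contact_tris C"
  have finE: "finite ?E" and finT: "finite ?T" using finite_C finite_contact_edges finite_contact_tris by auto
  have N: "card C \<le> 12" using kissing_card_le_12 kissing .
  have V: "\<Union>facets \<subseteq> C" using facets_subset by blast
  then have VN: "card (\<Union>facets) \<le> card C" using finite_C by (rule card_mono[rotated])
  have split: "card facets = card ?T + card ?B"
    using contact_tris_facets finite_facets finT by (simp add: card_Diff_subset card_mono)
  have bad: "card ?B \<le> 2 * card open_edges"
  proof -
    have "card ?B = (\<Sum>F\<in>?B. 1)" by simp
    also have "\<dots> \<le> (\<Sum>F\<in>?B. card {e \<in> open_edges. e \<subseteq> F})" by (intro sum_mono open_edges_in_bad_facet)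
    finally show ?thesis using count_open_edges by simp
  qed
  have fe: "card (pairs_of facets) = card ?E + card open_edges"
    using contact_edges_pairs_of_facets finite_pairs_of_facets finE
    by (simp add: open_edges_def card_Diff_subset card_mono)
  have "facets \<noteq> {}" using many contact_edges_pairs_of_facets by (auto simp: pairs_of_def)
  note T = card_facets_le[OF this]
  have count: "3 * card facets = 2 * card ?E + 2 * card open_edges" using count_facet_pairs fe by simp
  have t12: "12 \<le> card ?T" using many N VN split bad T count by linarith
  have UT: "\<Union>?T \<subseteq> C" by (auto simp: contact_tris_def)
  then have "card (\<Union>?T) \<le> 12" using N card_mono[OF finite_C UT] by linarith
  then have few: "card (\<Union>?T) < card ?T + 2" using t12 by linarith
  have "\<forall>T\<in>?T. contact_triangle T" by (simp add: contact_tris_def)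
  moreover have "?T \<noteq> {}" using t12 by (metis card.empty not_numeral_le_zero)
  ultimately have "2 * card ?T + 2 \<le> card (pairs_of ?T)" using card_pairs_of_ge'[OF finT _ _ few] by blast
  moreover have le: "card (pairs_of ?T) \<le> card ?E" using pairs_of_contact_tris finE by (rule card_mono[rotated])
  ultimately have edges: "2 * card ?T + 2 \<le> card ?E" by linarith
  show E26: "card ?E = 26" using many N VN split bad T count edges t12 by linarith
  show t: "card ?T = 12" using E26 edges t12 by linarith
  have f20: "card facets = 20" using E26 t N VN split bad T count by linarith
  then have o4: "card open_edges = 4" using count E26 by linarith
  have b8: "card ?B = 8" using f20 t split by linarith
  show "pairs_of ?T = ?E"
    using pairs_of_contact_tris finE \<open>2 * card ?T + 2 \<le> card (pairs_of ?T)\<close> le E26 t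
    by (intro card_subset_eq) auto
  show "card C = 12" using T f20 N VN by linarith
  show "\<Union>facets = C" using V finite_C T f20 N VN by (intro card_subset_eq) auto
  \<comment> \<open>The 8 bad facets share 2 * 4 incidences with open edges, and each has at least
    one, so nothing is left over.\<close>
  have "(\<Sum>F\<in>?B. card {e \<in> open_edges. e \<subseteq> F} - 1) = (\<Sum>F\<in>?B. card {e \<in> open_edges. e \<subseteq> F}) - (\<Sum>F\<in>?B. 1)"
    by (intro sum_subtractf_nat open_edges_in_bad_facet)
  also have "\<dots> = 0" unfolding count_open_edges using o4 b8 by simp
  finally have "\<forall>F\<in>?B. card {e \<in> open_edges. e \<subseteq> F} - 1 = 0" using finite_facets by simp
  then have "card {e \<in> open_edges. e \<subseteq> F} - 1 = 0" if "F \<in> ?B" for F using that by blast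
  then show "card {e \<in> open_edges. e \<subseteq> F} = 1" if "F \<in> ?B" for F
    using that open_edges_in_bad_facet[OF that] by (metis diff_is_0_eq le_antisym)
qed

lemma bad_facet_open_unique:
  assumes "F \<in> facets - contact_tris C" "{x, y} \<subseteq> F" "{x', y'} \<subseteq> F" "x \<noteq> y" "x' \<noteq> y'" "\<not> contact x y" "\<not> contact x' y'"
  shows "{x, y} = {x', y'}"
proof -
  have "{x, y} \<in> {e \<in> open_edges. e \<subseteq> F}" "{x', y'} \<in> {e \<in> open_edges. e \<subseteq> F}"
    using assms doubleton_contact_edge[of _ _ C] by (auto simp: open_edges_def pairs_of_def)
  moreover obtain e where "{e \<in> open_edges. e \<subseteq> F} = {e}"
    using bad_unique[OF assms(1)] by (auto simp: card_1_singleton_iff)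
  ultimately show ?thesis by auto
qed

lemma other_facet:
  assumes "{x, y, z} \<in> facets" "x \<noteq> y"
  obtains u where "{x, y, u} \<in> facets" "u \<noteq> x" "u \<noteq> y" "u \<noteq> z"
proof -
  have "{x, y} \<in> pairs_of facets" using assms by (auto simp: pairs_of_def intro!: bexI[of _ "{x, y, z}"])
  then have "card {F \<in> facets. {x, y} \<subseteq> F} = 2" by (rule card_facets_at_pair)
  then obtain F where F: "F \<in> facets" "x \<in> F" "y \<in> F" "F \<noteq> {x, y, z}"
    by (auto simp: card_2_iff)
  obtain u where "F = {x, y, u}" "u \<noteq> x" "u \<noteq> y" using card_3_at[OF facets_card[OF F(1)] F(2,3) assms(2)] .
  then show ?thesis using that[of u] F by auto
qed

definition boundary :: "(real^3) set set" where
  "boundary = {e \<in> contact_edges C. card {T \<in> contact_tris C. e \<subseteq> T} = 1}"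

lemma finite_tris: "finite (contact_tris C)" and finite_edges: "finite (contact_edges C)"
  using finite_contact_tris finite_contact_edges finite_C by auto

text \<open>At least one since \<open>pairs_tris\<close> puts each contact edge into a contact
  triangle, at most two since an edge lies in two facets.\<close>

lemma card_tris_at_edge:
  assumes "e \<in> contact_edges C"
  shows "card {T \<in> contact_tris C. e \<subseteq> T} = (if e \<in> boundary then 1 else 2)"
proof -
  have "e \<in> pairs_of (contact_tris C)" using assms pairs_tris by simp
  then have "{T \<in> contact_tris C. e \<subseteq> T} \<noteq> {}" by (auto simp: pairs_of_def)
  then have "card {T \<in> contact_tris C. e \<subseteq> T} \<noteq> 0" using finite_tris by simp
  moreover have "card {T \<in> contact_tris C. e \<subseteq> T} \<le> card {F \<in> facets. e \<subseteq> F}"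
    using contact_tris_facets finite_facets by (intro card_mono) auto
  moreover have "card {F \<in> facets. e \<subseteq> F} = 2"
    using assms contact_edges_pairs_of_facets by (intro card_facets_at_pair) auto
  ultimately show ?thesis using assms by (auto simp: boundary_def)
qed

lemma boundary_of_bad_facet:
  assumes "e \<in> contact_edges C" "F \<in> facets - contact_tris C" "e \<subseteq> F"
  shows "e \<in> boundary"
proof (rule ccontr)
  assume "e \<notin> boundary"
  then have "card {T \<in> contact_tris C. e \<subseteq> T} = 2" using card_tris_at_edge[OF assms(1)] by simp
  moreover have "{T \<in> contact_tris C. e \<subseteq> T} \<subset> {F \<in> facets. e \<subseteq> F}"
    using assms contact_tris_facets by blast
  then have "card {T \<in> contact_tris C. e \<subseteq> T} < card {F \<in> facets. e \<subseteq> F}"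
    using finite_facets by (intro psubset_card_mono) auto
  moreover have "card {F \<in> facets. e \<subseteq> F} = 2"
    using assms(1) contact_edges_pairs_of_facets by (intro card_facets_at_pair) auto
  ultimately show False by simp
qed

lemma bad_facet_at_boundary:
  assumes "{v, r} \<in> boundary"
  obtains q where "{v, r, q} \<in> facets - contact_tris C" "q \<noteq> v" "q \<noteq> r"
proof -
  have e: "{v, r} \<in> contact_edges C" "card {T \<in> contact_tris C. {v, r} \<subseteq> T} = 1"
    using assms by (auto simp: boundary_def)
  have two: "card {F \<in> facets. {v, r} \<subseteq> F} = 2" using e contact_edges_pairs_of_facets card_facets_at_pair by blast
  have "{T \<in> contact_tris C. {v, r} \<subseteq> T} \<noteq> {F \<in> facets. {v, r} \<subseteq> F}"
  proof
    assume "{T \<in> contact_tris C. {v, r} \<subseteq> T} = {F \<in> facets. {v, r} \<subseteq> F}"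
    then have "(1::nat) = 2" using e(2) two by (simp only:)
    then show False by simp
  qed
  then obtain F where F: "F \<in> facets - contact_tris C" "v \<in> F" "r \<in> F" using contact_tris_facets by blast
  have "v \<noteq> r" using e(1) doubleton_contact_edge contact_neq by blast
  obtain q where "F = {v, r, q}" "q \<noteq> v" "q \<noteq> r"
    using card_3_at[OF _ F(2,3) \<open>v \<noteq> r\<close>] F(1) facets_card by blast
  then show ?thesis using that[of q] F(1) by simp
qed

lemma sum_tris_at_edges:
  assumes "S \<subseteq> contact_edges C"
  shows "(\<Sum>e\<in>S. card {T \<in> contact_tris C. e \<subseteq> T}) + card (S \<inter> boundary) = 2 * card S"
proof -
  have fin: "finite S" using assms finite_edges finite_subset by blast
  have "(\<Sum>e\<in>S. card {T \<in> contact_tris C. e \<subseteq> T}) + card (S \<inter> boundary)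
      = (\<Sum>e\<in>S. (if e \<in> boundary then 1 else 2)) + (\<Sum>e\<in>S. if e \<in> boundary then 1 else 0)"
    using assms card_tris_at_edge fin by (simp add: subset_iff flip: sum.inter_filter) (simp add: Int_def)
  also have "\<dots> = (\<Sum>e\<in>S. 2)" unfolding sum.distrib[symmetric] by (intro sum.cong) auto
  finally show ?thesis by simp
qed

text \<open>Counting incidences of edges and contact triangles gives 3 * 12 = 2 * 26 - 16.\<close>

lemma card_boundary: "card boundary = 16"
proof -
  have "card {e \<in> contact_edges C. e \<subseteq> T} = 3" if T: "T \<in> contact_tris C" for T
  proof -
    have "{e \<in> contact_edges C. e \<subseteq> T} = {e \<in> contact_edges C. e \<subseteq> T \<and> card e = 2}" by (auto simp: contact_edges_def)
    moreover have "e \<in> contact_edges C" if "e \<subseteq> T" "card e = 2" for e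
      using that T pairs_of_contact_tris by (auto simp: pairs_of_def)
    ultimately show ?thesis using card_pairs_in_triple[of T "contact_edges C"] T
      by (simp add: contact_tris_def contact_triangle_def)
  qed
  then have "(\<Sum>T\<in>contact_tris C. card {e \<in> contact_edges C. e \<subseteq> T}) = 36" using card_tris by simp
  then have "(\<Sum>e\<in>contact_edges C. card {T \<in> contact_tris C. e \<subseteq> T}) = 36"
    using double_count[OF finite_tris finite_edges, of "\<lambda>T e. e \<subseteq> T"] by simp
  moreover have "contact_edges C \<inter> boundary = boundary" by (auto simp: boundary_def)
  ultimately show ?thesis using sum_tris_at_edges[of "contact_edges C"] card_edges by simp
qed

text \<open>A contact triangle at v has two edges at v, so the number of incidences at v is even; in
  it, an edge counts once if it is in the boundary and twice otherwise.\<close>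

lemma even_boundary_at: "even (card {e \<in> boundary. v \<in> e})"
proof -
  let ?S = "{e \<in> contact_edges C. v \<in> e}"
  have "card {e \<in> ?S. e \<subseteq> T} = (if v \<in> T then 2 else 0)" if T: "T \<in> contact_tris C" for T
  proof (cases "v \<in> T")
    case True
    have "e \<in> contact_edges C \<longleftrightarrow> card e = 2" if "e \<subseteq> T" for e
    proof
      assume "card e = 2"
      then have "e \<in> pairs_of (contact_tris C)" using that T by (auto simp: pairs_of_def)
      then show "e \<in> contact_edges C" using pairs_of_contact_tris by blast
    qed (simp add: contact_edges_def)
    then have "{e \<in> ?S. e \<subseteq> T} = {e. e \<subseteq> T \<and> card e = 2 \<and> v \<in> e}" by blast
    then show ?thesis using True T card_pairs_at_vertex[of T v] by (simp add: contact_tris_def contact_triangle_def)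
  next
    case False
    then have "{e \<in> ?S. e \<subseteq> T} = {}" by blast
    then have "card {e \<in> ?S. e \<subseteq> T} = 0" by (simp only: card.empty)
    then show ?thesis using False by (simp only: if_False)
  qed
  then have "even (\<Sum>T\<in>contact_tris C. card {e \<in> ?S. e \<subseteq> T})" by (intro dvd_sum) auto
  then have ev: "even (\<Sum>e\<in>?S. card {T \<in> contact_tris C. e \<subseteq> T})"
    using double_count[OF finite_tris, of ?S "\<lambda>T e. e \<subseteq> T"] finite_edges by simp
  have sum: "(\<Sum>e\<in>?S. card {T \<in> contact_tris C. e \<subseteq> T}) + card (?S \<inter> boundary) = 2 * card ?S"
    by (rule sum_tris_at_edges) auto
  have "even ((\<Sum>e\<in>?S. card {T \<in> contact_tris C. e \<subseteq> T}) + card (?S \<inter> boundary))"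
    unfolding sum by simp
  then have "even (card (?S \<inter> boundary))" using ev unfolding even_add by blast
  moreover have "?S \<inter> boundary = {e \<in> boundary. v \<in> e}" by (auto simp: boundary_def)
  ultimately show ?thesis by (simp only:)
qed

lemma sum_over_vertices:
  assumes "S \<subseteq> contact_edges C"
  shows "(\<Sum>v\<in>C. card {e \<in> S. v \<in> e}) = 2 * card S"
proof -
  have fin: "finite S" using assms finite_edges finite_subset by blast
  have "(\<Sum>v\<in>C. card {e \<in> S. v \<in> e}) = (\<Sum>e\<in>S. card {v \<in> C. v \<in> e})" using finite_C fin by (rule double_count)
  also have "\<dots> = (\<Sum>e\<in>S. 2)"
  proof (rule sum.cong)
    fix e assume "e \<in> S"
    then have "{v \<in> C. v \<in> e} = e" "card e = 2" using assms by (auto simp: contact_edges_def)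
    then show "card {v \<in> C. v \<in> e} = 2" by simp
  qed simp
  finally show ?thesis by simp
qed

lemma contact_partner:
  assumes "v \<in> C" "y \<in> C" "contact v y"
  obtains z where "z \<in> C" "contact v z" "contact y z"
proof -
  have "{v, y} \<in> pairs_of (contact_tris C)" using assms doubleton_contact_edge pairs_tris by blast
  then obtain T where "T \<in> {T \<in> contact_tris C. {v, y} \<subseteq> T}" by (auto simp: pairs_of_def)
  then show ?thesis using that unfolding contact_tris_at_edge[OF assms(3)] by blast
qed

text \<open>Off the boundary, the edge from v to y carries a second contact triangle, whose third
  vertex is the mirror image of x.\<close>

lemma fan_step:
  assumes "v \<in> C" "x \<in> C" "y \<in> C" "contact v x" "contact v y" "contact x y" "{v, y} \<notin> boundary"
  defines "z \<equiv> (2/3) *\<^sub>R (v + y) - x"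
  shows "z \<in> C" "contact v z" "contact y z"
proof -
  let ?Z = "{z \<in> C. v \<in> C \<and> y \<in> C \<and> contact v z \<and> contact y z}"
  have "{v, y} \<in> contact_edges C" using assms doubleton_contact_edge by blast
  then have "card ((\<lambda>z. {v, y, z}) ` ?Z) = 2"
    using card_tris_at_edge[of "{v, y}"] assms(7) unfolding contact_tris_at_edge[OF assms(5)] by simp
  moreover have "card ((\<lambda>z. {v, y, z}) ` ?Z) \<le> card ?Z" using finite_C by (intro card_image_le) simp
  ultimately have "2 \<le> card ?Z" by simp
  then have "\<not> ?Z \<subseteq> {x}" using card_mono[of "{x}" ?Z] by auto
  then obtain w where w: "w \<in> C" "contact v w" "contact y w" "w \<noteq> x" by blast
  have "x + w = (2/3) *\<^sub>R (v + y)"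
    using assms w by (intro contact_mirror) (auto intro: contact_sym)
  then have "z = w" by (simp add: z_def algebra_simps)
  then show "z \<in> C" "contact v z" "contact y z" using w by auto
qed

lemma open_edge_cases:
  assumes "{x, y, z} \<in> facets - contact_tris C" "x \<noteq> y" "x \<noteq> z" "y \<noteq> z" "contact x y"
  shows "contact x z \<longleftrightarrow> \<not> contact y z"
proof
  assume "contact x z"
  show "\<not> contact y z"
  proof
    assume "contact y z"
    then have "contact_triangle {x, y, z}" using contact_triangleI assms(5) \<open>contact x z\<close> by blast
    then show False using assms(1) facets_subset by (auto simp: contact_tris_def)
  qed
next
  assume yz: "\<not> contact y z"
  show "contact x z"
  proof (rule ccontr)
    assume "\<not> contact x z"
    then have "{x, z} = {y, z}" using bad_facet_open_unique[OF assms(1), of x z y z] yz assms(2-4) by simp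
    then show False using assms(2-4) by (auto simp: doubleton_eq_iff)
  qed
qed

text \<open>The open edge is the only non-contact pair of the facet beyond it. So two facets with a
  common open edge form a rhombus of contacts with that edge as a diagonal.\<close>

lemma facet_across_open_edge:
  assumes "{x, y, z} \<in> facets" "x \<noteq> y" "\<not> contact x y"
  obtains u where "{x, y, u} \<in> facets - contact_tris C" "u \<noteq> x" "u \<noteq> y" "u \<noteq> z" "contact x u" "contact y u"
proof -
  obtain u where u: "{x, y, u} \<in> facets" "u \<noteq> x" "u \<noteq> y" "u \<noteq> z" using other_facet[OF assms(1,2)] .
  have bad: "{x, y, u} \<in> facets - contact_tris C"
    using u assms(3) contact_triangle_insertD(1)[of x y u] by (auto simp: contact_tris_def)
  have "contact x u"
  proof (rule ccontr)
    assume "\<not> contact x u"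
    then have "{x, y} = {x, u}" using bad_facet_open_unique[OF bad, of x y x u] assms u by simp
    then show False using u by (auto simp: doubleton_eq_iff)
  qed
  moreover have "contact y u"
  proof (rule ccontr)
    assume "\<not> contact y u"
    then have "{x, y} = {y, u}" using bad_facet_open_unique[OF bad, of x y y u] assms u by simp
    then show False using u assms(2) by (auto simp: doubleton_eq_iff)
  qed
  ultimately show ?thesis using that bad u by blast
qed

lemma boundaryI:
  assumes "{x, y, z} \<in> facets - contact_tris C" "contact x y"
  shows "{x, y} \<in> boundary"
proof -
  have "x \<in> C" "y \<in> C" using assms(1) facets_subset by blast+
  then have "{x, y} \<in> contact_edges C" using doubleton_contact_edge assms(2) by blast
  then show ?thesis by (rule boundary_of_bad_facet[OF _ assms(1)]) simp
qed

text \<open>The bad facet at v r has one open side, which is opposite to v or starts at v. In both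
  cases it forms a rhombus v r u s with its neighbour across that side, and the open diagonal is r s
  or v u. The second side of the rhombus at v is again in the boundary and so must be v s.\<close>

lemma rhombus_at_boundary:
  assumes r: "{v, r} \<in> boundary" and s: "\<And>q. {v, q} \<in> boundary \<Longrightarrow> q = r \<or> q = s"
  obtains u where "u \<in> C" "u \<noteq> v" "contact u r" "contact u s"
    "{v, r, s} \<in> facets \<and> \<not> contact r s \<or> {v, r, u} \<in> facets \<and> \<not> contact v u"
proof -
  obtain q where q: "{v, r, q} \<in> facets - contact_tris C" "q \<noteq> v" "q \<noteq> r" using bad_facet_at_boundary[OF r] .
  have "{v, r} \<in> contact_edges C" using r by (simp add: boundary_def)
  then have vr: "contact v r" "v \<noteq> r" using doubleton_contact_edge contact_neq by blast+
  note cases = open_edge_cases[OF q(1) vr(2) q(2)[symmetric] q(3)[symmetric] vr(1)]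
  show ?thesis
  proof (cases "contact v q")
    case True
    then have nc: "\<not> contact r q" using cases by simp
    have "{v, q, r} \<in> facets - contact_tris C" using q(1) by (simp add: insert_commute)
    then have "{v, q} \<in> boundary" using boundaryI True by blast
    then have "q = s" using s q(3) by blast
    have "{r, q, v} \<in> facets" using q(1) by (simp add: insert_commute)
    then obtain u where "{r, q, u} \<in> facets - contact_tris C" "u \<noteq> v" "contact r u" "contact q u"
      using facet_across_open_edge[of r q v] q(3) nc by blast
    then show ?thesis using that[of u] \<open>q = s\<close> q(1) nc facets_subset contact_sym by blast
  next
    case False
    then have rq: "contact r q" using cases by simp
    have "{v, q, r} \<in> facets" using q(1) by (simp add: insert_commute)
    then obtain u where u: "{v, q, u} \<in> facets - contact_tris C" "u \<noteq> r" "contact v u" "contact q u"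
      using facet_across_open_edge[of v q r] q(2) False by blast
    have "{v, u, q} \<in> facets - contact_tris C" using u(1) by (simp add: insert_commute)
    then have "{v, u} \<in> boundary" using boundaryI u(3) by blast
    then have "u = s" using s u(2) by blast
    have "q \<in> C" using q(1) facets_subset by blast
    then show ?thesis using that[of q] rq u(4) \<open>u = s\<close> q(1,2) False contact_sym by blast
  qed
qed

lemma contact_from_inner: "x \<in> C \<Longrightarrow> y \<in> C \<Longrightarrow> x \<bullet> y = 1/2 \<Longrightarrow> contact x y"
  by (simp add: contact_def kissing_unit')

lemma neq_from_inner: "x \<in> C \<Longrightarrow> x \<bullet> y \<noteq> 1 \<Longrightarrow> x \<noteq> y"
  using kissing_unit' by auto

text \<open>The fan rotates from y0 around v until a boundary edge stops it, at y4 at the latest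
  because y5 is too close to y0. The nesting reflects that a point is known to be in C only if the
  edge to its predecessor was no boundary edge.\<close>

lemma fan_at_vertex:
  assumes v: "v \<in> C" and y0: "y0 \<in> C" "contact v y0"
  obtains y1 y2 y3 y4 where "y1 \<in> C" "contact v y1" "contact y0 y1" "y0 \<bullet> y1 = 1/2"
    "y2 = (2/3) *\<^sub>R (v + y1) - y0" "y3 = (2/3) *\<^sub>R (v + y2) - y1" "y4 = (2/3) *\<^sub>R (v + y3) - y2"
    "{v, y1} \<in> boundary \<or> (y2 \<in> C \<and> contact v y2 \<and> ({v, y2} \<in> boundary \<or>
      (y3 \<in> C \<and> contact v y3 \<and> ({v, y3} \<in> boundary \<or> (y4 \<in> C \<and> contact v y4 \<and> {v, y4} \<in> boundary)))))"
proof -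
  obtain y1 where y1: "y1 \<in> C" "contact v y1" "contact y0 y1" using contact_partner[OF v y0] .
  define y2 where "y2 = (2/3) *\<^sub>R (v + y1) - y0"
  define y3 where "y3 = (2/3) *\<^sub>R (v + y2) - y1"
  define y4 where "y4 = (2/3) *\<^sub>R (v + y3) - y2"
  define y5 where "y5 = (2/3) *\<^sub>R (v + y4) - y3"
  note fan = fan_inner_products[OF y0(2) y1(2,3) y2_def y3_def y4_def y5_def]
  have s2: "y2 \<in> C" "contact v y2" "contact y1 y2" if "{v, y1} \<notin> boundary"
    using fan_step[OF v y0(1) y1(1) y0(2) y1(2,3) that] by (simp_all add: y2_def)
  have s3: "y3 \<in> C" "contact v y3" "contact y2 y3" if "{v, y1} \<notin> boundary" "{v, y2} \<notin> boundary"
    using fan_step[OF v y1(1) s2(1) y1(2) s2(2,3)] that by (simp_all add: y3_def)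
  have s4: "y4 \<in> C" "contact v y4" "contact y3 y4"
    if "{v, y1} \<notin> boundary" "{v, y2} \<notin> boundary" "{v, y3} \<notin> boundary"
    using fan_step[OF v s2(1) s3(1) s2(2) s3(2,3)] that by (simp_all add: y4_def)
  have s5: "y5 \<in> C"
    if "{v, y1} \<notin> boundary" "{v, y2} \<notin> boundary" "{v, y3} \<notin> boundary" "{v, y4} \<notin> boundary"
    using fan_step[OF v s3(1) s4(1) s3(2) s4(2,3)] that by (simp_all add: y5_def)
  have "y5 \<notin> C"
  proof
    assume "y5 \<in> C"
    moreover have "y0 \<noteq> y5" using neq_from_inner[OF y0(1), of y5] fan(4) by simp
    ultimately show False using kissing_inner_le[OF kissing y0(1), of y5] fan(4) by simp
  qed
  then have disj: "{v, y1} \<in> boundary \<or> (y2 \<in> C \<and> contact v y2 \<and> ({v, y2} \<in> boundary \<or>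
      (y3 \<in> C \<and> contact v y3 \<and> ({v, y3} \<in> boundary \<or> (y4 \<in> C \<and> contact v y4 \<and> {v, y4} \<in> boundary)))))"
    using s2 s3 s4 s5 by blast
  have "y0 \<bullet> y1 = 1/2" using y1(3) by (simp add: contact_def)
  then show ?thesis using that[OF y1 _ y2_def y3_def y4_def disj] by blast
qed

text \<open>Some contact leaves v, since a facet at v has at most one non-contact pair, and a fan
  started there runs into the boundary.\<close>

lemma boundary_at_vertex_nonempty:
  assumes "v \<in> C"
  shows "{e \<in> boundary. v \<in> e} \<noteq> {}"
proof -
  obtain F where F: "F \<in> facets" "v \<in> F" using assms facets_cover by blast
  have "\<exists>y\<in>C. contact v y"
  proof (cases "F \<in> contact_tris C")
    case True
    obtain a b c where "F = {a, b, c}" "a \<noteq> b" "b \<noteq> c" "a \<noteq> c" using facets_card[OF F(1)] by (auto simp: card_3_iff)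
    then obtain y where y: "y \<in> F" "y \<noteq> v" by blast
    then have "contact v y" using True F(2) by (simp add: contact_tris_def contact_triangle_def)
    then show ?thesis using y(1) facets_subset[OF F(1)] by blast
  next
    case False
    obtain a b c where abc: "F = {a, b, c}" "a \<noteq> b" "b \<noteq> c" "a \<noteq> c" using facets_card[OF F(1)] by (auto simp: card_3_iff)
    then obtain x y where xy: "F = {v, x, y}" "v \<noteq> x" "v \<noteq> y" "x \<noteq> y" using F(2) by blast
    have "contact v x \<or> contact v y"
    proof (rule ccontr)
      assume "\<not> (contact v x \<or> contact v y)"
      then have "{v, x} = {v, y}" using bad_facet_open_unique[of F v x v y] F False xy by simp
      then show False using xy by (auto simp: doubleton_eq_iff)
    qed
    then show ?thesis using xy(1) facets_subset[OF F(1)] by blast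
  qed
  then obtain y0 where "y0 \<in> C" "contact v y0" by blast
  from fan_at_vertex[OF assms this] show ?thesis by blast
qed

text \<open>A fan from one boundary edge ends at the other, v s. If s were y1, y2 or y3, the product
  of y0 and s would fix the shape of the rhombus at v, and all three shapes are impossible. So the
  fan reaches y4, and v touches y0, ..., y4.\<close>

lemma degree_five:
  assumes v: "v \<in> C" and two: "card {e \<in> boundary. v \<in> e} = 2"
  shows "5 \<le> card {e \<in> contact_edges C. v \<in> e}"
proof -
  have "{e \<in> boundary. v \<in> e} \<noteq> {}" using two by (metis card.empty zero_neq_numeral)
  then obtain e where e: "e \<in> boundary" "v \<in> e" by blast
  then have "e \<in> contact_edges C" by (simp add: boundary_def)
  then obtain y0 where "e = {v, y0}" "v \<in> C" "y0 \<in> C" "contact v y0"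
    using contact_edgeE[OF _ e(2)] by blast
  then have y0: "{v, y0} \<in> boundary" "y0 \<in> C" "contact v y0" using e(1) by simp_all
  obtain y1 y2 y3 y4 where y1: "y1 \<in> C" "contact v y1" "contact y0 y1" "y0 \<bullet> y1 = 1/2"
    and y2: "y2 = (2/3) *\<^sub>R (v + y1) - y0" and y3: "y3 = (2/3) *\<^sub>R (v + y2) - y1" and y4: "y4 = (2/3) *\<^sub>R (v + y3) - y2"
    and disj: "{v, y1} \<in> boundary \<or> (y2 \<in> C \<and> contact v y2 \<and> ({v, y2} \<in> boundary \<or>
      (y3 \<in> C \<and> contact v y3 \<and> ({v, y3} \<in> boundary \<or> (y4 \<in> C \<and> contact v y4 \<and> {v, y4} \<in> boundary)))))"
    using fan_at_vertex[OF v y0(2,3)] .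
  note fan = fan_inner_products[OF y0(3) y1(2,3) y2 y3 y4 refl]
  have only: "q = y0 \<or> q = s" if s: "{v, s} \<in> boundary" "s \<noteq> y0" and q: "{v, q} \<in> boundary" for s q
  proof -
    have fin: "finite {e \<in> boundary. v \<in> e}" using finite_edges by (simp add: boundary_def)
    have sub: "{{v, y0}, {v, s}} \<subseteq> {e \<in> boundary. v \<in> e}" and c2: "card {{v, y0}, {v, s}} = 2"
      using y0 s by (auto simp: doubleton_eq_iff)
    have eq: "{{v, y0}, {v, s}} = {e \<in> boundary. v \<in> e}"
      by (rule card_subset_eq[OF fin sub]) (simp only: c2 two)
    have "{v, q} \<in> {{v, y0}, {v, s}}" unfolding eq using q by simp
    then have "{v, q} = {v, y0} \<or> {v, q} = {v, s}" by simp
    then show ?thesis unfolding doubleton_eq_iff by blast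
  qed
  have rh: False if s: "{v, s} \<in> boundary" "s \<in> C" "contact v s" "y0 \<bullet> s \<noteq> 11/27"
    and vals: "y0 \<bullet> s = 1/2 \<or> (y0 \<bullet> s = - 1/3 \<and> s = y2) \<or> y0 \<bullet> s = - 7/18" for s
  proof -
    have "s \<noteq> y0" using neq_from_inner[OF y0(2), of s] vals by auto
    obtain u where u: "u \<in> C" "u \<noteq> v" "contact u y0" "contact u s"
      "{v, y0, s} \<in> facets \<and> \<not> contact y0 s \<or> {v, y0, u} \<in> facets \<and> \<not> contact v u"
      using rhombus_at_boundary[OF y0(1) only[OF s(1) \<open>s \<noteq> y0\<close>]] .
    have eq: "(1 + v \<bullet> u) * (1 + y0 \<bullet> s) = 1"
      using rhombus_inner[OF y0(3) s(3) u(3,4,2)] \<open>s \<noteq> y0\<close> by simp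
    consider "y0 \<bullet> s = 1/2" | "y0 \<bullet> s = - 1/3" "s = y2" | "y0 \<bullet> s = - 7/18" using vals by blast
    then show False
    proof cases
      case 1
      \<comment> \<open>As y0 s is a contact, the facets would have to use the diagonal v u, which
        crosses it.\<close>
      then have c: "contact y0 s" using contact_from_inner y0(2) s(2) by simp
      then have "{v, y0, u} \<in> facets" using u(5) by blast
      moreover have "v + u = (2/3) *\<^sub>R (y0 + s)"
        using c y0(3) s(3) u by (intro contact_mirror) (auto intro: contact_sym)
      ultimately show False using no_crossing_diagonal[of "{v, y0, u}" v u y0 s] y0(2) s(2) by simp
    next
      case 2
      \<comment> \<open>Now v u is a contact, so the facets would have to use y0 s, which crosses
        the contact v y1.\<close>
      have "(1 + v \<bullet> u) * (1 + - 1/3) = 1" using eq unfolding 2(1) .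
      then have "v \<bullet> u = 1/2" by simp
      then have "contact v u" using contact_from_inner v u(1) by simp
      then have "{v, y0, s} \<in> facets" using u(5) by blast
      moreover have "y0 + s = (2/3) *\<^sub>R (v + y1)" by (simp add: 2 y2)
      ultimately show False using no_crossing_diagonal[of "{v, y0, s}" y0 s v y1] v y1(1) by simp
    next
      case three: 3
      \<comment> \<open>Here v and u would be closer than allowed: 7/11 > 1/2.\<close>
      have "(1 + v \<bullet> u) * (1 + - 7/18) = 1" using eq unfolding three .
      then have "v \<bullet> u = 7/11" by simp
      then show False using kissing_inner_le[OF kissing v u(1)] u(2) by simp
    qed
  qed
  have "{v, y1} \<notin> boundary" using rh[of y1] y1 by auto
  then have 2: "y2 \<in> C" "contact v y2" using disj by auto
  then have "{v, y2} \<notin> boundary" using rh[of y2] fan(1) by auto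
  then have 3: "y3 \<in> C" "contact v y3" using disj \<open>{v, y1} \<notin> boundary\<close> by auto
  then have "{v, y3} \<notin> boundary" using rh[of y3] fan(2) by auto
  then have 4: "y4 \<in> C" "contact v y4" using disj \<open>{v, y1} \<notin> boundary\<close> \<open>{v, y2} \<notin> boundary\<close> by auto
  have "distinct [y0, y1, y2, y3, y4]"
    using neq_from_inner[OF y0(2)] neq_from_inner[OF y1(1)] neq_from_inner[OF 2(1)] neq_from_inner[OF 3(1)] fan y1(4)
    by simp
  then have "card {y0, y1, y2, y3, y4} = 5" by simp
  moreover have "inj_on (\<lambda>y. {v, y}) {y0, y1, y2, y3, y4}" by (auto simp: inj_on_def doubleton_eq_iff)
  ultimately have c5: "card ((\<lambda>y. {v, y}) ` {y0, y1, y2, y3, y4}) = 5" by (simp only: card_image)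
  have "(\<lambda>y. {v, y}) ` {y0, y1, y2, y3, y4} \<subseteq> {e \<in> contact_edges C. v \<in> e}"
    using v y0 y1 2 3 4 doubleton_contact_edge by auto
  moreover have "finite {e \<in> contact_edges C. v \<in> e}" using finite_edges by simp
  ultimately have "card ((\<lambda>y. {v, y}) ` {y0, y1, y2, y3, y4}) \<le> card {e \<in> contact_edges C. v \<in> e}"
    by (rule card_mono[rotated])
  then show ?thesis unfolding c5 .
qed

lemma contradiction: False
proof -
  let ?d = "\<lambda>v. card {e \<in> contact_edges C. v \<in> e}" and ?b = "\<lambda>v. card {e \<in> boundary. v \<in> e}"
  have "12 \<le> 2 * ?d v + ?b v" if v: "v \<in> C" for v
  proof -
    have fin: "finite {e \<in> boundary. v \<in> e}" using finite_edges by (simp add: boundary_def)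
    have "?b v \<noteq> 0" using boundary_at_vertex_nonempty[OF v] fin by simp
    moreover have "even (?b v)" by (rule even_boundary_at)
    moreover have "?b v \<le> ?d v" using finite_edges by (intro card_mono) (auto simp: boundary_def)
    moreover have "5 \<le> ?d v" if "?b v = 2" using degree_five[OF v that] .
    \<comment> \<open>If b \<ge> 4, then d \<ge> b gives 2 d + b \<ge> 12; if b = 2, the bound d
      \<ge> 5 does.\<close>
    ultimately show ?thesis by (cases "?b v = 2"; cases "?b v \<ge> 4") (auto elim!: evenE)
  qed
  then have "(\<Sum>v\<in>C. 12) \<le> (\<Sum>v\<in>C. 2 * ?d v + ?b v)" by (intro sum_mono)
  also have "\<dots> = 2 * (\<Sum>v\<in>C. ?d v) + (\<Sum>v\<in>C. ?b v)" by (simp add: sum.distrib sum_distrib_left)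
  also have "\<dots> = 2 * (2 * 26) + 2 * 16"
    using sum_over_vertices[of "contact_edges C"] sum_over_vertices[of boundary] card_edges card_boundary
    by (simp add: boundary_def)
  finally show False using facets_cover(2) by simp
qed

end

section \<open>Saturated packings and the two bounds\<close>

lemma extend_to_saturated:
  assumes "kissing C"
  obtains C' where "C \<subseteq> C'" "kissing C'" "\<And>p. p \<noteq> 0 \<Longrightarrow> \<exists>x\<in>C'. 0 < x \<bullet> p"
proof -
  let ?P = "\<lambda>D. C \<subseteq> D \<and> kissing D"
  \<comment> \<open>A largest packing exists because 12 bounds them all; 13 serves as the strict
    bound.\<close>
  obtain D where D: "?P D" "\<And>D'. ?P D' \<Longrightarrow> card D' \<le> card D"
    using ex_has_greatest_nat[of ?P C card 13] assms kissing_card_le_12 by (metis le_imp_less_Suc numeral_eq_Suc pred_numeral_simps(3) order_refl eval_nat_numeral(3))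
  have "\<exists>x\<in>D. 0 < x \<bullet> p" if p: "p \<noteq> 0" for p
  proof (rule ccontr)
    assume "\<not> (\<exists>x\<in>D. 0 < x \<bullet> p)"
    then have neg: "x \<bullet> p \<le> 0" if "x \<in> D" for x using that by (simp add: not_less)
    \<comment> \<open>The pole of an open half space without points of D has nonpositive products
      with all of D, so it could be added.\<close>
    define q where "q = p /\<^sub>R norm p"
    have q: "norm q = 1" using p by (simp add: q_def)
    have le: "x \<bullet> q \<le> 0" if "x \<in> D" for x
      using neg[OF that] by (simp add: q_def mult_nonneg_nonpos)
    have "q \<notin> D"
    proof
      assume "q \<in> D"
      then show False using le[of q] q by (simp add: dot_square_norm)
    qed
    have fin: "finite D" using D(1) by (simp add: kissing_def)
    have half: "x \<bullet> q \<le> 1/2" "q \<bullet> x \<le> 1/2" if "x \<in> D" for x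
      using le[OF that] by (simp_all add: inner_commute)
    have "kissing (insert q D)"
      unfolding kissing_def
    proof (intro conjI ballI impI)
      show "finite (insert q D)" using fin by simp
      show "insert q D \<subseteq> sphere 0 1" using D(1) q by (simp add: kissing_def)
      fix x y assume "x \<in> insert q D" "y \<in> insert q D" "x \<noteq> y"
      then consider "x \<in> D" "y \<in> D" | "x \<in> D" "y = q" | "x = q" "y \<in> D" by blast
      then show "x \<bullet> y \<le> 1/2"
        using half kissing_inner_le[OF _ _ _ \<open>x \<noteq> y\<close>] D(1) by cases auto
    qed
    then have "card (insert q D) \<le> card D" using D by blast
    then show False using \<open>q \<notin> D\<close> fin by simp
  qed
  then show ?thesis using that D(1) by blast
qed

theorem card_contact_edges_le:
  assumes "kissing C"
  shows "card (contact_edges C) \<le> 25"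
proof (rule ccontr)
  assume "\<not> card (contact_edges C) \<le> 25"
  obtain D where D: "C \<subseteq> D" "kissing D" "\<And>p. p \<noteq> 0 \<Longrightarrow> \<exists>x\<in>D. 0 < x \<bullet> p"
    using extend_to_saturated[OF assms] by blast
  have fin: "finite D" using D(2) by (simp add: kissing_def)
  have "card (contact_edges C) \<le> card (contact_edges D)"
    using contact_edges_mono[OF D(1)] finite_contact_edges[OF fin] by (rule card_mono[rotated])
  then have many: "26 \<le> card (contact_edges D)" using \<open>\<not> card (contact_edges C) \<le> 25\<close> by simp
  obtain h where h: "\<And>x. x \<in> D \<Longrightarrow> \<bar>h x - 1\<bar> < 1/20" "\<And>n. independent {x \<in> D. n \<bullet> x = h x}"
    using generic_heights[OF fin, of "1/20"] by auto
  interpret dense_contacts D h by standard (use D h many in auto)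
  show False by (rule contradiction)
qed

theorem card_contact_tris_le:
  assumes "kissing C"
  shows "card (contact_tris C) \<le> 11"
proof (rule ccontr)
  assume "\<not> card (contact_tris C) \<le> 11"
  then have t: "12 \<le> card (contact_tris C)" by simp
  have fin: "finite C" using assms by (simp add: kissing_def)
  have "\<Union>(contact_tris C) \<subseteq> C" by (auto simp: contact_tris_def)
  then have "card (\<Union>(contact_tris C)) \<le> card C" using fin by (rule card_mono[rotated])
  also have "\<dots> \<le> 12" using kissing_card_le_12[OF assms] .
  finally have few: "card (\<Union>(contact_tris C)) < card (contact_tris C) + 2" using t by linarith
  have "\<forall>T\<in>contact_tris C. contact_triangle T" by (simp add: contact_tris_def)
  moreover have "contact_tris C \<noteq> {}" using t by (metis card.empty not_numeral_le_zero)
  ultimately have "2 * card (contact_tris C) + 2 \<le> card (pairs_of (contact_tris C))"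
    using card_pairs_of_ge'[OF finite_contact_tris[OF fin] _ _ few] by blast
  also have "\<dots> \<le> card (contact_edges C)"
    using pairs_of_contact_tris finite_contact_edges[OF fin] by (rule card_mono[rotated])
  also have "\<dots> \<le> 25" using card_contact_edges_le[OF assms] .
  finally show False using t by linarith
qed

section \<open>From spherical distances to inner products\<close>

lemma sphere_inner_bounds:
  fixes x y :: "'a::real_inner"
  assumes "x \<in> sphere 0 1" "y \<in> sphere 0 1"
  shows "-1 \<le> x \<bullet> y" "x \<bullet> y \<le> 1"
  using Cauchy_Schwarz_ineq2[of x y] assms by auto

lemma arccos_half: "arccos (1/2) = pi / 3"
  using arccos_cos[of "pi / 3"] pi_gt_zero by (simp add: cos_60)

lemma sph_dist_ge_iff:
  assumes "x \<in> sphere 0 1" "y \<in> sphere 0 1"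
  shows "pi / 3 \<le> sph_dist x y \<longleftrightarrow> x \<bullet> y \<le> 1/2"
proof -
  have "sph_dist x y \<ge> arccos (1/2) \<longleftrightarrow> x \<bullet> y \<le> 1/2"
    unfolding sph_dist_def using sphere_inner_bounds[OF assms] by (intro arccos_le_mono) auto
  then show ?thesis by (simp only: arccos_half)
qed

lemma touching_iff_contact:
  assumes "x \<in> sphere 0 1" "y \<in> sphere 0 1"
  shows "touching x y \<longleftrightarrow> contact x y"
proof -
  have "arccos (x \<bullet> y) = arccos (1/2) \<longleftrightarrow> x \<bullet> y = 1/2"
    using sphere_inner_bounds[OF assms] by (intro arccos_eq_iff) auto
  then have "touching x y \<longleftrightarrow> x \<bullet> y = 1/2"
    by (simp only: touching_def sph_dist_def arccos_half)
  then show ?thesis using assms by (simp add: contact_def dot_square_norm)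
qed

lemma cap_packing_kissing: "cap_packing C \<Longrightarrow> kissing C"
  unfolding cap_packing_def kissing_def using sph_dist_ge_iff by blast

theorem theorem3:
  fixes C :: "(real^3) set"
  assumes "cap_packing C"
  shows "card (touching_pairs C) \<le> 25 \<and> card (touching_triplets C) \<le> 11"
proof -
  have "C \<subseteq> sphere 0 1" using assms by (simp add: cap_packing_def)
  then have "touching x y \<longleftrightarrow> contact x y" if "x \<in> C" "y \<in> C" for x y
    using that touching_iff_contact by blast
  then have "touching_pairs C = contact_edges C" "touching_triplets C = contact_tris C"
    unfolding touching_pairs_def contact_edges_def touching_triplets_def contact_tris_def contact_triangle_def
    by blast+
  then show ?thesis
    using card_contact_edges_le card_contact_tris_le cap_packing_kissing[OF assms] by simp
qed

end
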